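(* Let $V$ be a graded symplectic space and $\delta\in\mathfrak{sp}(V)$ an endomorphism of degree $-1$. (1) If the grading is indexed by $\mathbb Z$, then $\delta$ is conjugate by a degree-preserving symplectic transformation to a direct sum of endomorphisms $\delta^{\mathfrak{sp}}_{s;l}$ with $s$ a nonnegative integer and $0\le l\le 2s$; for each such pair $(s,l)$ the number of summands $\delta^{\mathfrak{sp}}_{s;l}$ is an invariant of the conjugacy class. (2) If the grading is indexed by $\frac12\mathbb Z_{\rm odd}$ and $\mathbb K=\mathbb C$, then $\delta$ is conjugate (by a degree-preserving symplectic transformation) to a direct sum of endomorphisms $\delta^{\mathfrak{sp}}_{s;l}$ with $s\in\frac12\mathbb Z_{\rm odd}$, $s>0$, $0\le l\le 2s-1$, and of endomorphisms $\tau^{\mathfrak{sp}}_m$ with $m\in\frac12\mathbb Z_{\rm odd}$, $m>0$; the numbers of summands of each type $\delta^{\mathfrak{sp}}_{s;l}$ and $\tau^{\mathfrak{sp}}_m$ are invariants of the conjugacy class. (3) If the grading is indexed by $\frac12\mathbb Z_{\rm odd}$ and $\mathbb K=\mathbb R$, then $\delta$ is conjugate to a direct sum of endomorphisms of types $\delta^{\mathfrak{sp}}_{s;l}$ (as in (2)), $\tau^{\mathfrak{sp}}_m$ and $-\tau^{\mathfrak{sp}}_m$ ($m\in\frac12\mathbb Z_{\rm odd}$, $m>0$); the numbers of summands of each type $\delta^{\mathfrak{sp}}_{s;l}$, $\tau^{\mathfrak{sp}}_m$, $-\tau^{\mathfrak{sp}}_m$ are invariants of the conjugacy class.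
   Context: $\frac12\mathbb Z_{\rm odd}=\{i+\frac12:i\in\mathbb Z\}$; $[x]$ is the integer part. A graded symplectic space is a finite-dimensional $\mathbb K$-vector space $V$ with symplectic form $\sigma$ and a decomposition $V=\bigoplus_{i\in I}V_i$, where $I=\mathbb Z$ or $I=\frac12\mathbb Z_{\rm odd}$, such that $\sigma(V_i,V_j)=0$ whenever $i+j\ne0$. Degree $-1$ means $\delta(V_i)\subset V_{i-1}$. The direct sum of two graded symplectic spaces (with the same index set) is the skew-orthogonal direct sum with componentwise grading, and direct sums of endomorphisms are defined componentwise. (D1) For $s\in\frac12\mathbb Z$, $s\ge0$, and an integer $0\le l\le2[s]$, $V^{\mathfrak{sp}}_{s;l}$ has basis $e_{s-l},\dots,e_s,f_{-s},\dots,f_{l-s}$ (index $=$ degree) with $\sigma(e_i,e_j)=\sigma(f_i,f_j)=0$, $\sigma(e_i,f_j)=(-1)^{s-i}$ if $j=-i$ and $0$ otherwise; $\delta^{\mathfrak{sp}}_{s;l}(e_i)=e_{i-1}$ ($i>s-l$), $\delta^{\mathfrak{sp}}_{s;l}(e_{s-l})=0$, $\delta^{\mathfrak{sp}}_{s;l}(f_i)=f_{i-1}$ ($i>-s$), $\delta^{\mathfrak{sp}}_{s;l}(f_{-s})=0$. (D2) For $m\in\frac12\mathbb Z_{\rm odd}$, $m>0$, $\mathcal L^{\mathfrak{sp}}_m=\bigoplus_{i\in\frac12\mathbb Z_{\rm odd},\,-m\le i\le m}E_i$ is a graded symplectic space with $\dim E_i=1$, and $\tau^{\mathfrak{sp}}_m\in\mathfrak{sp}(\mathcal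 L^{\mathfrak{sp}}_m)$ is of degree $-1$, maps $E_i$ onto $E_{i-1}$ for $i>-m$ and $E_{-m}$ to $0$; when $\mathbb K=\mathbb R$ one requires additionally $\sigma(\tau^{\mathfrak{sp}}_m(e),e)>0$ for $0\ne e\in E_{1/2}$. *)

theory Defs
  imports Complex_Main "HOL-Library.Multiset"
begin

text \<open>Grading degrees are modelled as rationals; the index set is either the
integers or the half-odd integers.\<close>

definition halfodd :: "rat set" where
  "halfodd = {of_int i + 1/2 | i. True}"

definition gsymp :: "('k::field \<Rightarrow> 'v::ab_group_add \<Rightarrow> 'v) \<Rightarrow> ('v \<Rightarrow> 'v \<Rightarrow> 'k)
    \<Rightarrow> rat set \<Rightarrow> (rat \<Rightarrow> 'v set) \<Rightarrow> bool" where
  "gsymp scale sig I Vg \<longleftrightarrow>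
     vector_space scale \<and>
     (\<exists>B. finite B \<and> module.span scale B = UNIV) \<and>
     (\<forall>x. Vector_Spaces.linear scale (*) (sig x)) \<and>
     (\<forall>y. Vector_Spaces.linear scale (*) (\<lambda>x. sig x y)) \<and>
     (\<forall>x. sig x x = 0) \<and>
     (\<forall>x. (\<forall>y. sig x y = 0) \<longrightarrow> x = 0) \<and>
     (\<forall>i. module.subspace scale (Vg i)) \<and>
     (\<forall>i. i \<notin> I \<longrightarrow> Vg i = {0}) \<and>
     module.span scale (\<Union>i\<in>I. Vg i) = UNIV \<and>
     (\<forall>S x. finite S \<and> S \<subseteq> I \<and> (\<forall>i\<in>S. x i \<in> Vg i) \<and> (\<Sum>i\<in>S. x i) = 0
         \<longrightarrow> (\<forall>i\<in>S. x i = 0)) \<and>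
     (\<forall>i j x y. i + j \<noteq> 0 \<and> x \<in> Vg i \<and> y \<in> Vg j \<longrightarrow> sig x y = 0)"

definition sp_deg_m1 :: "('k::field \<Rightarrow> 'v::ab_group_add \<Rightarrow> 'v) \<Rightarrow> ('v \<Rightarrow> 'v \<Rightarrow> 'k)
    \<Rightarrow> (rat \<Rightarrow> 'v set) \<Rightarrow> ('v \<Rightarrow> 'v) \<Rightarrow> bool" where
  "sp_deg_m1 scale sig Vg d \<longleftrightarrow>
     Vector_Spaces.linear scale scale d \<and>
     (\<forall>x y. sig (d x) y + sig x (d y) = 0) \<and>
     (\<forall>i. d ` Vg i \<subseteq> Vg (i - 1))"

definition graded_conj :: "('k::field \<Rightarrow> 'v::ab_group_add \<Rightarrow> 'v) \<Rightarrow> ('v \<Rightarrow> 'v \<Rightarrow> 'k)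
    \<Rightarrow> (rat \<Rightarrow> 'v set) \<Rightarrow> ('v \<Rightarrow> 'v) \<Rightarrow> ('v \<Rightarrow> 'v) \<Rightarrow> ('v \<Rightarrow> 'v) \<Rightarrow> bool" where
  "graded_conj scale sig Vg g d d' \<longleftrightarrow>
     Vector_Spaces.linear scale scale g \<and> bij g \<and>
     (\<forall>x y. sig (g x) (g y) = sig x y) \<and>
     (\<forall>i. g ` Vg i = Vg i) \<and>
     (\<forall>x. d' (g x) = g (d x))"

text \<open>Block types: DB s l is delta^sp_{s;l}, TB m is tau^sp_m, NTB m is -tau^sp_m.\<close>

datatype blk = DB rat nat | TB rat | NTB rat

text \<open>The restriction of (sig, Vg, d) to the subspace W is isomorphic (by a graded
symplectic isomorphism intertwining d with delta^sp_{s;l}) to the model (D1):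
W has a basis e_{s-l},...,e_s, f_{-s},...,f_{l-s} (index = degree) with the
prescribed pairings and action of d.\<close>

definition is_Dblock :: "('k::field \<Rightarrow> 'v::ab_group_add \<Rightarrow> 'v) \<Rightarrow> ('v \<Rightarrow> 'v \<Rightarrow> 'k)
    \<Rightarrow> (rat \<Rightarrow> 'v set) \<Rightarrow> ('v \<Rightarrow> 'v) \<Rightarrow> rat \<Rightarrow> nat \<Rightarrow> 'v set \<Rightarrow> bool" where
  "is_Dblock scale sig Vg d s l W \<longleftrightarrow>
     (\<exists>e f :: rat \<Rightarrow> 'v.
       let Ei = {s - of_nat k | k. k \<le> l};
           Fi = {- s + of_nat k | k. k \<le> l};
           B = e ` Ei \<union> f ` Fi
       in (\<forall>i\<in>Ei. e i \<in> Vg i) \<and> (\<forall>i\<in>Fi. f i \<in> Vg i) \<and>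
          card B = 2 * (l + 1) \<and>
          \<not> module.dependent scale B \<and>
          module.span scale B = W \<and>
          (\<forall>i\<in>Ei. \<forall>j\<in>Ei. sig (e i) (e j) = 0) \<and>
          (\<forall>i\<in>Fi. \<forall>j\<in>Fi. sig (f i) (f j) = 0) \<and>
          (\<forall>k\<le>l. \<forall>j\<in>Fi. sig (e (s - of_nat k)) (f j) =
                 (if j = - (s - of_nat k) then (-1) ^ k else 0)) \<and>
          (\<forall>i\<in>Ei. d (e i) = (if i = s - of_nat l then 0 else e (i - 1))) \<and>
          (\<forall>i\<in>Fi. d (f i) = (if i = - s then 0 else f (i - 1))))"

text \<open>The restriction of (sig, Vg, d) to the subspace W is a graded symplectic space
of the shape L^sp_m of (D2) (one-dimensional pieces E_i = W \<inter> V_i exactly for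
half-odd i with |i| \<le> m), on which d maps E_i onto E_{i-1} for i > -m and E_{-m} to 0.
The additional sign condition for K = R is imposed separately.\<close>

definition is_Tblock :: "('k::field \<Rightarrow> 'v::ab_group_add \<Rightarrow> 'v) \<Rightarrow> ('v \<Rightarrow> 'v \<Rightarrow> 'k)
    \<Rightarrow> (rat \<Rightarrow> 'v set) \<Rightarrow> ('v \<Rightarrow> 'v) \<Rightarrow> rat \<Rightarrow> 'v set \<Rightarrow> bool" where
  "is_Tblock scale sig Vg d m W \<longleftrightarrow>
     module.subspace scale W \<and>
     module.span scale (\<Union>i. W \<inter> Vg i) = W \<and>
     (\<forall>x\<in>W. (\<forall>y\<in>W. sig x y = 0) \<longrightarrow> x = 0) \<and>
     (\<forall>i. i \<in> halfodd \<and> \<bar>i\<bar> \<le> m \<longrightarrow> vector_space.dim scale (W \<inter> Vg i) = 1) \<and>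
     (\<forall>i. \<not> (i \<in> halfodd \<and> \<bar>i\<bar> \<le> m) \<longrightarrow> W \<inter> Vg i = {0}) \<and>
     (\<forall>i. i \<in> halfodd \<and> - m < i \<and> i \<le> m \<longrightarrow> d ` (W \<inter> Vg i) = W \<inter> Vg (i - 1)) \<and>
     d ` (W \<inter> Vg (- m)) = {0}"

definition okZ :: "('k::field \<Rightarrow> 'v::ab_group_add \<Rightarrow> 'v) \<Rightarrow> ('v \<Rightarrow> 'v \<Rightarrow> 'k)
    \<Rightarrow> (rat \<Rightarrow> 'v set) \<Rightarrow> ('v \<Rightarrow> 'v) \<Rightarrow> 'v set \<Rightarrow> blk \<Rightarrow> bool" where
  "okZ scale sig Vg d W b \<longleftrightarrow> (case b of
     DB s l \<Rightarrow> s \<in> \<int> \<and> s \<ge> 0 \<and> int l \<le> 2 * \<lfloor>s\<rfloor> \<and> is_Dblock scale sig Vg d s l W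
   | TB m \<Rightarrow> False
   | NTB m \<Rightarrow> False)"

definition okC :: "('k::field \<Rightarrow> 'v::ab_group_add \<Rightarrow> 'v) \<Rightarrow> ('v \<Rightarrow> 'v \<Rightarrow> 'k)
    \<Rightarrow> (rat \<Rightarrow> 'v set) \<Rightarrow> ('v \<Rightarrow> 'v) \<Rightarrow> 'v set \<Rightarrow> blk \<Rightarrow> bool" where
  "okC scale sig Vg d W b \<longleftrightarrow> (case b of
     DB s l \<Rightarrow> s \<in> halfodd \<and> s > 0 \<and> int l \<le> 2 * \<lfloor>s\<rfloor> \<and> is_Dblock scale sig Vg d s l W
   | TB m \<Rightarrow> m \<in> halfodd \<and> m > 0 \<and> is_Tblock scale sig Vg d m W
   | NTB m \<Rightarrow> False)"

definition okR :: "(real \<Rightarrow> 'v::ab_group_add \<Rightarrow> 'v) \<Rightarrow> ('v \<Rightarrow> 'v \<Rightarrow> real)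
    \<Rightarrow> (rat \<Rightarrow> 'v set) \<Rightarrow> ('v \<Rightarrow> 'v) \<Rightarrow> 'v set \<Rightarrow> blk \<Rightarrow> bool" where
  "okR scale sig Vg d W b \<longleftrightarrow> (case b of
     DB s l \<Rightarrow> s \<in> halfodd \<and> s > 0 \<and> int l \<le> 2 * \<lfloor>s\<rfloor> \<and> is_Dblock scale sig Vg d s l W
   | TB m \<Rightarrow> m \<in> halfodd \<and> m > 0 \<and> is_Tblock scale sig Vg d m W \<and>
       (\<forall>x \<in> W \<inter> Vg (1/2). x \<noteq> 0 \<longrightarrow> sig (d x) x > 0)
   | NTB m \<Rightarrow> m \<in> halfodd \<and> m > 0 \<and> is_Tblock scale sig Vg (\<lambda>x. - d x) m W \<and>
       (\<forall>x \<in> W \<inter> Vg (1/2). x \<noteq> 0 \<longrightarrow> sig (- d x) x > 0))"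

text \<open>A decomposition of V into a skew-orthogonal direct sum of subspaces W_j, each
admissible for block type b_j.  This is exactly a conjugation of d to the direct sum
of the corresponding model endomorphisms.\<close>

definition block_decomp :: "('k::field \<Rightarrow> 'v::ab_group_add \<Rightarrow> 'v) \<Rightarrow> ('v \<Rightarrow> 'v \<Rightarrow> 'k)
    \<Rightarrow> ('v set \<Rightarrow> blk \<Rightarrow> bool) \<Rightarrow> ('v set \<times> blk) list \<Rightarrow> bool" where
  "block_decomp scale sig ok ws \<longleftrightarrow>
     (\<forall>(W, b) \<in> set ws. ok W b) \<and>
     (\<forall>j < length ws. \<forall>j' < length ws. j \<noteq> j' \<longrightarrow>
        (\<forall>x \<in> fst (ws ! j). \<forall>y \<in> fst (ws ! j'). sig x y = 0)) \<and>
     (\<forall>v. \<exists>x. (\<forall>j < length ws. x j \<in> fst (ws ! j)) \<and> v = (\<Sum>j < length ws. x j)) \<and>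
     (\<forall>x. (\<forall>j < length ws. x j \<in> fst (ws ! j)) \<and> (\<Sum>j < length ws. x j) = 0
        \<longrightarrow> (\<forall>j < length ws. x j = 0))"

end

theory Submission
  imports Defs
begin

text \<open>
Existence is by induction on a nondegenerate, graded, \<open>d\<close>-stable subspace \<open>U\<close>. Let \<open>k\<close> be maximal with
\<open>d^k \<noteq> 0\<close> on \<open>U\<close>; nondegeneracy gives \<open>x\<close> in degree \<open>a\<close> and \<open>y\<close> in degree \<open>k - a\<close> with \<open>sig x (d^k y) = 1\<close>.
If \<open>k \<noteq> 2a\<close>, adding a multiple of a power of \<open>d\<close> applied to \<open>x\<close> makes the string of \<open>y\<close> isotropic, and the two
strings span a \<open>\<delta>\<close>-block. If \<open>k = 2a\<close>, the form \<open>sig x (d^k y)\<close> on degree \<open>a\<close> is skew for even \<open>k\<close> (again a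
\<open>\<delta>\<close>-block) and symmetric for odd \<open>k\<close>, in which case some \<open>z\<close> with \<open>sig z (d^k z) \<noteq> 0\<close> spans a \<open>\<tau>\<close>-block.
In every case the block carries an explicit dual family, so it splits off orthogonally.

For uniqueness, the multiplicity of the strings that start in degree \<open>a\<close> and have length \<open>k + 1\<close> is the
maximal dimension of a subspace of \<open>ker d^(k+1)\<close> in degree \<open>a\<close> no nonzero element of which is mapped by
\<open>d^k\<close> into the range of \<open>d^(k+1)\<close>. Over the reals, the numbers of \<open>\<tau>\<close> and \<open>-\<tau>\<close> are likewise maximal
dimensions of subspaces on which \<open>sig (d y) y\<close>, with \<open>y = d^(a-1/2) v\<close>, is positive or negative definite,
as in Sylvester's law of inertia.
\<close>

section \<open>Graded symplectic spaces\<close>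

text \<open>With homogeneous generators whose degrees add up to \<open>k\<close>,
  \<open>sig ((d ^^ p) x) ((d ^^ q) y)\<close> can be nonzero only for \<open>p + q = k\<close>. So
  the Gram matrix of two strings is antidiagonal, and reversing the strings gives the dual family;
  maximality of \<open>k\<close> closes the strings under \<open>d\<close>. By the same count a
  homogeneous \<open>y\<close> has at most one nonzero pairing \<open>sig y ((d ^^ j) y)\<close>, so
  a single scalar repairs it. A \<open>\<tau>\<close>-block prescribes lines but no normalisation,
  hence no square roots are taken, and all but the signs works over every field of characteristic 0;
  dividing by 2 is essential for the repair and for polarisation. Counting by maximal subspaces that
  avoid a bad complement dispenses with quotient spaces, adds up over blocks, and has the same form
  for multiplicities and for signatures. The obstacle in counting is that a
  \<open>\<delta>\<close>-block has two strings, with tops in degrees \<open>s\<close> and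
  \<open>l - s\<close>: only the higher one is used, and for \<open>l = 2 s\<close> the two
  coincide.\<close>

locale graded_symplectic = finite_dimensional_vector_space scale Basis
  for scale :: "'k::field_char_0 \<Rightarrow> 'v::ab_group_add \<Rightarrow> 'v" (infixr \<open>*s\<close> 75) and Basis +
  fixes sig :: "'v \<Rightarrow> 'v \<Rightarrow> 'k" and I :: "rat set" and Vg :: "rat \<Rightarrow> 'v set"
  assumes gs: "gsymp scale sig I Vg"
begin

lemma sig_add: "sig x (y + z) = sig x y + sig x z" "sig (x + y) z = sig x z + sig y z"
  and sig_scale: "sig x (c *s y) = c * sig x y" "sig (c *s x) y = c * sig x y"
  using gs unfolding gsymp_def Vector_Spaces.linear_iff by auto

lemma sig_self [simp]: "sig x x = 0"
  using gs unfolding gsymp_def by auto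

lemma nondegenerate: "(\<And>y. sig x y = 0) \<Longrightarrow> x = 0"
  using gs unfolding gsymp_def by auto

lemma subspace_Vg: "subspace (Vg i)"
  using gs unfolding gsymp_def by auto

lemma Vg_outside: "i \<notin> I \<Longrightarrow> Vg i = {0}"
  using gs unfolding gsymp_def by auto

lemma span_Vg: "span (\<Union>i\<in>I. Vg i) = UNIV"
  using gs unfolding gsymp_def by auto

lemma Vg_independent:
  assumes "finite S" "S \<subseteq> I" "\<And>i. i \<in> S \<Longrightarrow> x i \<in> Vg i" "(\<Sum>i\<in>S. x i) = 0" "i \<in> S"
  shows "x i = 0"
proof -
  have "\<forall>S x. finite S \<and> S \<subseteq> I \<and> (\<forall>i\<in>S. x i \<in> Vg i) \<and> (\<Sum>i\<in>S. x i) = 0 \<longrightarrow> (\<forall>i\<in>S. x i = 0)"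
    using gs unfolding gsymp_def by (elim conjE) assumption
  then show ?thesis using assms by metis
qed

lemma sig_degree:
  assumes "x \<in> Vg i" "y \<in> Vg j" "i + j \<noteq> 0"
  shows "sig x y = 0"
proof -
  have "\<forall>i j x y. i + j \<noteq> 0 \<and> x \<in> Vg i \<and> y \<in> Vg j \<longrightarrow> sig x y = 0"
    using gs unfolding gsymp_def by (elim conjE) assumption
  then show ?thesis using assms by blast
qed

lemmas Vg_0 [simp] = subspace_0[OF subspace_Vg]
lemmas Vg_add = subspace_add[OF subspace_Vg]
lemmas Vg_scale = subspace_scale[OF subspace_Vg]

lemma sig_0 [simp]: "sig 0 y = 0" "sig x 0 = 0"
  using sig_scale(2)[of 0 0 y] sig_scale(1)[of x 0 0] by simp_all

lemma sig_minus: "sig (- x) y = - sig x y" "sig x (- y) = - sig x y"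
  using sig_scale(2)[of "- 1" x y] sig_scale(1)[of x "- 1" y] by simp_all

lemma sig_diff: "sig (x - z) y = sig x y - sig z y" "sig x (y - z) = sig x y - sig x z"
  using sig_add(2)[of x "- z" y] sig_add(1)[of x y "- z"] by (simp_all add: sig_minus)

lemma sig_sum: "sig (sum f A) y = (\<Sum>a\<in>A. sig (f a) y)" "sig x (sum f A) = (\<Sum>a\<in>A. sig x (f a))"
  by (induction A rule: infinite_finite_induct) (auto simp: sig_add)

lemma sig_skew: "sig x y = - sig y x"
proof -
  have "sig x y + sig y x = sig (x + y) (x + y)"
    unfolding sig_add by simp
  then have "sig x y + sig y x = 0" by simp
  then show ?thesis by (simp add: eq_neg_iff_add_eq_0)
qed

section \<open>Homogeneous components\<close>

lemma ex_degrees: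
  "\<exists>D. finite D \<and> (\<forall>v. \<exists>x. (\<forall>i. x i \<in> Vg i) \<and> (\<forall>i. i \<notin> D \<longrightarrow> x i = 0) \<and> v = (\<Sum>i\<in>D. x i))"
proof -
  define P where "P D v \<longleftrightarrow> (\<exists>x. (\<forall>i. x i \<in> Vg i) \<and> (\<forall>i. i \<notin> D \<longrightarrow> x i = 0) \<and> v = (\<Sum>i\<in>D. x i))"
    for D v
  have mono: "P D' v" if v: "P D v" and "D \<subseteq> D'" "finite D'" for D D' v
  proof -
    obtain x where x: "\<forall>i. x i \<in> Vg i" "\<forall>i. i \<notin> D \<longrightarrow> x i = 0" "v = (\<Sum>i\<in>D. x i)"
      using v unfolding P_def by blast
    moreover have "(\<Sum>i\<in>D. x i) = (\<Sum>i\<in>D'. x i)"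
      using that x by (intro sum.mono_neutral_left) auto
    ultimately show ?thesis
      unfolding P_def using that(2) by (intro exI[of _ x]) auto
  qed
  have sub: "subspace {v. P D v}" for D
  proof (rule subspaceI)
    show "0 \<in> {v. P D v}" unfolding P_def by (auto intro!: exI[of _ "\<lambda>_. 0"])
  next
    fix u v assume "u \<in> {v. P D v}" "v \<in> {v. P D v}"
    then obtain x y where "\<forall>i. x i \<in> Vg i" "\<forall>i. i \<notin> D \<longrightarrow> x i = 0" "u = (\<Sum>i\<in>D. x i)"
      "\<forall>i. y i \<in> Vg i" "\<forall>i. i \<notin> D \<longrightarrow> y i = 0" "v = (\<Sum>i\<in>D. y i)"
      unfolding P_def by blast
    then show "u + v \<in> {v. P D v}"
      unfolding P_def by (auto intro!: exI[of _ "\<lambda>i. x i + y i"] Vg_add simp: sum.distrib)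
  next
    fix c v assume "v \<in> {v. P D v}"
    then obtain x where "\<forall>i. x i \<in> Vg i" "\<forall>i. i \<notin> D \<longrightarrow> x i = 0" "v = (\<Sum>i\<in>D. x i)"
      unfolding P_def by blast
    then show "c *s v \<in> {v. P D v}"
      unfolding P_def by (auto intro!: exI[of _ "\<lambda>i. c *s x i"] Vg_scale simp: scale_sum_right)
  qed
  have ex: "\<exists>D. finite D \<and> P D v" for v
  proof -
    have "v \<in> span (\<Union>i\<in>I. Vg i)" by (simp add: span_Vg)
    then show ?thesis
    proof (induction rule: span_induct_alt)
      case base
      show ?case using subspace_0[OF sub[of "{}"]] by auto
    next
      case (step c u v)
      then obtain i D where i: "u \<in> Vg i" and D: "finite D" "P D v" by auto
      have "P {i} u" unfolding P_def using i by (auto intro!: exI[of _ "\<lambda>j. if j = i then u else 0"])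
      then have "P (insert i D) u" "P (insert i D) v"
        using D mono[of "{i}" u "insert i D"] mono[of D v "insert i D"] by auto
      then have "P (insert i D) (c *s u + v)"
        using subspace_add[OF sub subspace_scale[OF sub]] by auto
      then show ?case using D by auto
    qed
  qed
  \<comment> \<open>Each vector involves finitely many degrees; the union of these sets over the
    finite basis serves all vectors at once.\<close>
  then obtain F where F: "\<And>v. finite (F v)" "\<And>v. P (F v) v" by metis
  define D where "D = (\<Union>b\<in>Basis. F b)"
  have "finite D" unfolding D_def using F finite_Basis by auto
  have "Basis \<subseteq> {v. P D v}"
    using mono[OF F(2)] \<open>finite D\<close> unfolding D_def by blast
  then have "span Basis \<subseteq> {v. P D v}" by (rule span_minimal) (rule sub)
  then show ?thesis using \<open>finite D\<close> unfolding P_def by (auto simp: span_Basis)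
qed

definition degs :: "rat set" where
  "degs = (SOME D. finite D \<and>
     (\<forall>v. \<exists>x. (\<forall>i. x i \<in> Vg i) \<and> (\<forall>i. i \<notin> D \<longrightarrow> x i = 0) \<and> v = (\<Sum>i\<in>D. x i)))"

definition comps :: "'v \<Rightarrow> rat \<Rightarrow> 'v" where
  "comps v = (SOME x. (\<forall>i. x i \<in> Vg i) \<and> (\<forall>i. i \<notin> degs \<longrightarrow> x i = 0) \<and> v = (\<Sum>i\<in>degs. x i))"

definition pr :: "rat \<Rightarrow> 'v \<Rightarrow> 'v" where
  "pr i v = comps v i"

lemma finite_degs [simp]: "finite degs"
  using someI_ex[OF ex_degrees] unfolding degs_def by blast

lemma pr_in [simp]: "pr i v \<in> Vg i"
  and pr_outside: "i \<notin> degs \<Longrightarrow> pr i v = 0"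
  and sum_pr: "(\<Sum>i\<in>degs. pr i v) = v"
proof -
  have "\<exists>x. (\<forall>i. x i \<in> Vg i) \<and> (\<forall>i. i \<notin> degs \<longrightarrow> x i = 0) \<and> v = (\<Sum>i\<in>degs. x i)"
    using someI_ex[OF ex_degrees] unfolding degs_def by blast
  from someI_ex[OF this]
  show "pr i v \<in> Vg i" "i \<notin> degs \<Longrightarrow> pr i v = 0" "(\<Sum>i\<in>degs. pr i v) = v"
    unfolding pr_def comps_def by auto
qed

text \<open>Independence of the pieces is available only for finite sets of degrees inside
  \<open>I\<close>, so both expansions are compared on \<open>(S \<union> degs) \<inter> I\<close>;
  outside of it both sides are zero.\<close>

lemma pr_unique:
  assumes "finite S" "\<And>i. x i \<in> Vg i" "\<And>i. i \<notin> S \<Longrightarrow> x i = 0"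
  shows "pr i (\<Sum>i\<in>S. x i) = x i"
proof (cases "i \<in> (S \<union> degs) \<inter> I")
  case True
  let ?v = "\<Sum>i\<in>S. x i"
  have out: "y j = 0" if "\<And>i. y i \<in> Vg i" "j \<notin> I" for y :: "rat \<Rightarrow> 'v" and j
    using that Vg_outside[of j] by (metis singletonD)
  have "(\<Sum>i\<in>(S \<union> degs) \<inter> I. x i) = ?v"
    by (rule sum.mono_neutral_cong) (use assms out[of x] in auto)
  moreover have "(\<Sum>i\<in>(S \<union> degs) \<inter> I. pr i ?v) = (\<Sum>i\<in>degs. pr i ?v)"
    by (rule sum.mono_neutral_cong) (use assms pr_outside out[of "\<lambda>i. pr i ?v"] in auto)
  ultimately have "(\<Sum>i\<in>(S \<union> degs) \<inter> I. pr i ?v - x i) = 0"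
    by (simp add: sum_subtractf sum_pr)
  then have "pr i ?v - x i = 0"
    by (rule Vg_independent[rotated 3]) (use assms True in \<open>auto intro: subspace_diff[OF subspace_Vg]\<close>)
  then show ?thesis by simp
next
  case False
  then have "pr i (\<Sum>i\<in>S. x i) = 0" "x i = 0"
    using assms pr_outside Vg_outside pr_in by blast+
  then show ?thesis by simp
qed

lemma pr_hom: "v \<in> Vg i \<Longrightarrow> pr j v = (if j = i then v else 0)"
  using pr_unique[of "{i}" "\<lambda>j. if j = i then v else 0" j] by auto

lemma pr_add: "pr i (u + v) = pr i u + pr i v"
proof -
  have "pr i (\<Sum>i\<in>degs. pr i u + pr i v) = pr i u + pr i v"
    by (rule pr_unique) (auto simp: pr_outside intro: Vg_add)
  then show ?thesis by (simp add: sum.distrib sum_pr)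
qed

lemma pr_scale: "pr i (c *s v) = c *s pr i v"
proof -
  have "pr i (\<Sum>i\<in>degs. c *s pr i v) = c *s pr i v"
    by (rule pr_unique) (auto simp: pr_outside intro: Vg_scale)
  then show ?thesis by (simp add: sum_pr flip: scale_sum_right)
qed

lemma pr_0 [simp]: "pr i 0 = 0"
  using pr_scale[of i 0 0] by simp

lemma pr_sum: "pr i (sum f A) = (\<Sum>a\<in>A. pr i (f a))"
  by (induction A rule: infinite_finite_induct) (auto simp: pr_add)

text \<open>A vector of degree \<open>- i\<close> is orthogonal to every component of degree other
  than \<open>i\<close>. In effect \<open>pr (- i)\<close> is the adjoint of
  \<open>pr i\<close>.\<close>

lemma sig_pr:
  assumes "y \<in> Vg (- i)"
  shows "sig (pr i x) y = sig x y"
proof -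
  have "sig x y = (\<Sum>j\<in>degs. sig (pr j x) y)"
    using sig_sum(1)[of "\<lambda>j. pr j x" degs y] by (simp add: sum_pr)
  also have "\<dots> = (\<Sum>j\<in>degs. if j = i then sig (pr i x) y else 0)"
    using sig_degree[OF pr_in assms] by (intro sum.cong) auto
  also have "\<dots> = sig (pr i x) y"
    using pr_outside[of i x] by simp
  finally show ?thesis by simp
qed

text \<open>Projecting a linear combination to degree \<open>i\<close> just deletes the generators
  of other degrees. This is how the graded pieces of a block are later read off from its
  strings.\<close>

lemma span_homogeneous_Int:
  assumes "B \<subseteq> (\<Union>i. Vg i)"
  shows "span B \<inter> Vg i = span (B \<inter> Vg i)"
proof
  have "pr i v \<in> span (B \<inter> Vg i)" if "v \<in> span B" for v
    using that
  proof (induction rule: span_induct_alt)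
    case (step c b v)
    then obtain j where "b \<in> Vg j" using assms by auto
    then have "pr i b \<in> span (B \<inter> Vg i)"
      using step(1) by (auto simp: pr_hom span_zero intro: span_base)
    then show ?case using step by (auto simp: pr_add pr_scale intro: span_add span_scale)
  qed (auto simp: span_zero)
  then show "span B \<inter> Vg i \<subseteq> span (B \<inter> Vg i)"
    by (metis (no_types, lifting) IntE pr_hom subsetI)
  show "span (B \<inter> Vg i) \<subseteq> span B \<inter> Vg i"
    by (rule span_minimal) (auto intro: span_base subspace_inter subspace_Vg)
qed

lemma pr_span:
  assumes "B \<subseteq> (\<Union>i. Vg i)" "v \<in> span B"
  shows "pr i v \<in> span B"
  using assms(2)
proof (induction rule: span_induct_alt)
  case (step c b v)
  then obtain j where "b \<in> Vg j" using assms by auto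
  then have "pr i b \<in> span B"
    using step(1) by (auto simp: pr_hom span_zero intro: span_base)
  then show ?case using step by (auto simp: pr_add pr_scale intro: span_add span_scale)
qed (auto simp: span_zero)

section \<open>Nondegenerate subspaces, complements and orthogonal projection\<close>

definition nondeg :: "'v set \<Rightarrow> bool" where
  "nondeg U \<longleftrightarrow> (\<forall>x\<in>U. (\<forall>y\<in>U. sig x y = 0) \<longrightarrow> x = 0)"

definition perp :: "'v set \<Rightarrow> 'v set \<Rightarrow> 'v set" where
  "perp U W = {u \<in> U. \<forall>w\<in>W. sig u w = 0}"

text \<open>This is \<open>V = W + W^perp\<close>, phrased by the foot of the perpendicular, which a
  dual family yields by a formula instead of a dimension count.\<close>

definition has_projection :: "'v set \<Rightarrow> bool" where
  "has_projection W \<longleftrightarrow> (\<forall>u. \<exists>x\<in>W. \<forall>y\<in>W. sig (u - x) y = 0)"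

text \<open>Pairing with \<open>w j\<close> isolates the coefficient of \<open>v j\<close>. Nonzero
  scalars \<open>c\<close> are allowed instead of 1 because the pairings along strings alternate in
  sign. The assumption on spans says that the subspace contains its own dual family.\<close>

lemma dual_family:
  assumes "finite J" and dual: "\<And>i j. i \<in> J \<Longrightarrow> j \<in> J \<Longrightarrow> sig (v i) (w j) = (if i = j then c i else 0)"
    and c: "\<And>i. i \<in> J \<Longrightarrow> c i \<noteq> 0"
  shows "inj_on v J" "independent (v ` J)"
    and "span (w ` J) = span (v ` J) \<Longrightarrow> nondeg (span (v ` J))"
    and "span (w ` J) = span (v ` J) \<Longrightarrow> has_projection (span (v ` J))"
proof -
  show inj: "inj_on v J"
    by (rule inj_onI) (metis c dual)
  show "independent (v ` J)"
  proof (rule independent_if_scalars_zero)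
    fix f x assume f: "(\<Sum>x\<in>v ` J. f x *s x) = 0" and "x \<in> v ` J"
    then obtain j where j: "j \<in> J" "x = v j" by auto
    have "0 = sig (\<Sum>i\<in>J. f (v i) *s v i) (w j)"
      using f by (simp add: sum.reindex[OF inj])
    also have "\<dots> = (\<Sum>i\<in>J. if i = j then f x * c j else 0)"
      unfolding sig_sum sig_scale using j dual by (intro sum.cong) auto
    finally show "f x = 0" using c j \<open>finite J\<close> by simp
  qed (use assms in auto)
  \<comment> \<open>The orthogonal projection onto the span of the \<open>v i\<close>: it fixes each
    \<open>v i\<close>, and \<open>u - \<phi> u\<close> is orthogonal to each
    \<open>w j\<close>.\<close>
  define \<phi> where "\<phi> x = (\<Sum>i\<in>J. (sig x (w i) / c i) *s v i)" for x
  have \<phi>_in: "\<phi> x \<in> span (v ` J)" for x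
    unfolding \<phi>_def by (intro span_sum span_scale span_base) auto
  have \<phi>_v: "\<phi> (v j) = v j" if "j \<in> J" for j
  proof -
    have "\<phi> (v j) = (\<Sum>i\<in>J. if i = j then v j else 0)"
      unfolding \<phi>_def using that dual c by (intro sum.cong) auto
    then show ?thesis using that assms(1) by simp
  qed
  have \<phi>_id: "\<phi> x = x" if "x \<in> span (v ` J)" for x
    using that
  proof (induction rule: span_induct_alt)
    case (step a b x)
    have "\<phi> (a *s b + x) = a *s \<phi> b + \<phi> x"
      unfolding \<phi>_def by (simp add: sig_add sig_scale scale_left_distrib add_divide_distrib
        sum.distrib scale_sum_right)
    then show ?case using step \<phi>_v by auto
  qed (simp add: \<phi>_def)
  assume sp: "span (w ` J) = span (v ` J)"
  then have w_in: "w i \<in> span (v ` J)" if "i \<in> J" for i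
    using that by (metis imageI span_base)
  show "nondeg (span (v ` J))"
    unfolding nondeg_def
  proof (intro ballI impI)
    fix x assume x: "x \<in> span (v ` J)" "\<forall>y\<in>span (v ` J). sig x y = 0"
    then have "\<phi> x = 0" unfolding \<phi>_def using w_in by auto
    then show "x = 0" using \<phi>_id x by simp
  qed
  show "has_projection (span (v ` J))"
    unfolding has_projection_def
  proof (intro allI bexI[OF _ \<phi>_in] ballI)
    fix u y assume "y \<in> span (v ` J)"
    then have "y \<in> span (w ` J)" by (simp add: sp)
    moreover have "sig (u - \<phi> u) (w j) = 0" if "j \<in> J" for j
    proof -
      have "sig (\<phi> u) (w j) = (\<Sum>i\<in>J. if i = j then sig u (w j) else 0)"
        unfolding \<phi>_def sig_sum sig_scale using that dual c by (intro sum.cong) auto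
      then show ?thesis using that assms(1) by (simp add: sig_diff)
    qed
    ultimately show "sig (u - \<phi> u) y = 0"
      by (induction rule: span_induct_alt) (auto simp: sig_add sig_scale)
  qed
qed

text \<open>Each \<open>u\<close> in \<open>U\<close> is \<open>w + (u - w)\<close> with
  \<open>w\<close> in \<open>W\<close> and \<open>u - w\<close> in the complement, so a vector of
  the complement that is orthogonal to the complement is orthogonal to all of
  \<open>U\<close>.\<close>

lemma perp_nondeg:
  assumes "nondeg U" "has_projection W" "W \<subseteq> U" "subspace U"
  shows "nondeg (perp U W)"
  unfolding nondeg_def
proof (intro ballI impI)
  fix x assume x: "x \<in> perp U W" "\<forall>y\<in>perp U W. sig x y = 0"
  have "sig x u = 0" if "u \<in> U" for u
  proof -
    obtain w where w: "w \<in> W" "\<forall>y\<in>W. sig (u - w) y = 0"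
      using assms(2) unfolding has_projection_def by blast
    have "u - w \<in> perp U W"
      using w that assms(3,4) unfolding perp_def by (auto intro: subspace_diff)
    then have "sig x (u - w) = 0" "sig x w = 0" using x w unfolding perp_def by auto
    then show ?thesis by (simp add: sig_diff)
  qed
  then show "x = 0" using assms(1) x unfolding nondeg_def perp_def by auto
qed

end

section \<open>Endomorphisms of degree -1 and orthogonal splitting\<close>

locale graded_sp_endo = graded_symplectic scale Basis sig I Vg
  for scale :: "'k::field_char_0 \<Rightarrow> 'v::ab_group_add \<Rightarrow> 'v" (infixr \<open>*s\<close> 75) and Basis sig I Vg +
  fixes d :: "'v \<Rightarrow> 'v"
  assumes sp: "sp_deg_m1 scale sig Vg d"
begin

lemma d_linear: "Vector_Spaces.linear scale scale d"
  using sp unfolding sp_deg_m1_def by simp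

lemma d_add: "d (x + y) = d x + d y" and d_scale: "d (c *s x) = c *s d x"
  using d_linear unfolding Vector_Spaces.linear_iff by auto

lemma d_0 [simp]: "d 0 = 0"
  using d_scale[of 0 0] by simp

lemma d_Vg: "x \<in> Vg i \<Longrightarrow> d x \<in> Vg (i - 1)"
  using sp unfolding sp_deg_m1_def by blast

lemma sig_d: "sig (d x) y = - sig x (d y)"
  using sp unfolding sp_deg_m1_def by (simp add: eq_neg_iff_add_eq_0)

lemma d_sum: "d (sum f A) = (\<Sum>a\<in>A. d (f a))"
  by (induction A rule: infinite_finite_induct) (auto simp: d_add)

lemma dpow_add: "(d ^^ n) (x + y) = (d ^^ n) x + (d ^^ n) y"
  by (induction n) (auto simp: d_add)

lemma dpow_scale: "(d ^^ n) (c *s x) = c *s (d ^^ n) x"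
  by (induction n) (auto simp: d_scale)

lemma dpow_0 [simp]: "(d ^^ n) 0 = 0"
  by (induction n) auto

lemma dpow_sum: "(d ^^ n) (sum f A) = (\<Sum>a\<in>A. (d ^^ n) (f a))"
  by (induction A rule: infinite_finite_induct) (auto simp: dpow_add)

lemma dpow_dpow: "(d ^^ m) ((d ^^ n) x) = (d ^^ (m + n)) x"
  by (simp add: funpow_add)

lemma dpow_eq_0: "(d ^^ m) x = 0 \<Longrightarrow> m \<le> n \<Longrightarrow> (d ^^ n) x = 0"
  by (metis dpow_0 dpow_dpow le_add_diff_inverse2)

lemma dpow_Vg: "x \<in> Vg i \<Longrightarrow> (d ^^ n) x \<in> Vg (i - of_nat n)"
proof (induction n)
  case (Suc n)
  then show ?case using d_Vg[of "(d ^^ n) x" "i - of_nat n"] by (simp add: algebra_simps)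
qed auto

lemma sig_dpow: "sig ((d ^^ n) x) y = (- 1) ^ n * sig x ((d ^^ n) y)"
proof (induction n arbitrary: y)
  case (Suc n)
  then show ?case by (simp add: sig_d flip: funpow_swap1)
qed auto

lemma sig_dpow_dpow: "sig ((d ^^ m) x) ((d ^^ n) y) = (- 1) ^ m * sig x ((d ^^ (m + n)) y)"
  by (simp add: sig_dpow dpow_dpow)

lemma nilpotent: "\<exists>N. \<forall>v. (d ^^ N) v = 0"
proof -
  \<comment> \<open>\<open>M\<close> bounds the spread of the degrees, so more than \<open>M\<close>
    applications of \<open>d\<close> lead below the lowest one. Inserting 0 only makes
    \<open>Max\<close> and \<open>Min\<close> meaningful when \<open>degs\<close> is empty.\<close>
  define M where "M = Max (insert 0 degs) - Min (insert 0 degs)"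
  obtain N where N: "of_nat N > M" using reals_Archimedean2 by blast
  have "(d ^^ N) (pr i v) = 0" if "i \<in> degs" for i v
  proof -
    have "i \<le> Max (insert 0 degs)" using that by simp
    then have "i - of_nat N < Min (insert 0 degs)" using N unfolding M_def by linarith
    then have "i - of_nat N \<notin> degs"
      using Min_le[of "insert 0 degs"] by (meson finite.insertI finite_degs insertI2 not_less)
    then have "pr (i - of_nat N) ((d ^^ N) (pr i v)) = 0" by (rule pr_outside)
    then show ?thesis using pr_hom[OF dpow_Vg[OF pr_in, of N i v]] by simp
  qed
  then have "(d ^^ N) v = 0" for v
    using dpow_sum[of N "\<lambda>i. pr i v" degs] by (simp add: sum_pr)
  then show ?thesis by blast
qed

section \<open>Graded \<open>d\<close>-stable subspaces and orthogonal splitting\<close>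

definition stable :: "'v set \<Rightarrow> bool" where
  "stable U \<longleftrightarrow> subspace U \<and> (\<forall>u\<in>U. d u \<in> U) \<and> (\<forall>u\<in>U. \<forall>i. pr i u \<in> U)"

lemma stable_dpow: "stable U \<Longrightarrow> u \<in> U \<Longrightarrow> (d ^^ n) u \<in> U"
  by (induction n) (auto simp: stable_def)

lemma stable_span:
  assumes "B \<subseteq> (\<Union>i. Vg i)" "\<And>b. b \<in> B \<Longrightarrow> d b \<in> span B"
  shows "stable (span B)"
  unfolding stable_def
proof (intro conjI ballI allI)
  show "d u \<in> span B" if "u \<in> span B" for u
    using that
    by (induction rule: span_induct_alt)
      (auto simp: d_add d_scale span_zero intro: span_add span_scale assms(2))
  show "pr i u \<in> span B" if "u \<in> span B" for u i
    using that assms(1) by (rule pr_span[rotated])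
qed simp

text \<open>The adjoint of \<open>d\<close> is \<open>- d\<close> and that of \<open>pr i\<close> is
  \<open>pr (- i)\<close>; both preserve \<open>W\<close>, hence \<open>d\<close> and
  \<open>pr i\<close> preserve its complement.\<close>

lemma stable_perp:
  assumes U: "stable U" and W: "stable W"
  shows "stable (perp U W)"
  unfolding stable_def
proof (intro conjI ballI allI)
  show "subspace (perp U W)"
    using U unfolding stable_def perp_def
    by (auto intro!: subspaceI simp: sig_add sig_scale subspace_0 subspace_add subspace_scale)
  show "d u \<in> perp U W" if "u \<in> perp U W" for u
    using that U W unfolding perp_def stable_def by (auto simp: sig_d)
  fix u i assume u: "u \<in> perp U W"
  have "sig (pr i u) w = 0" if "w \<in> W" for w
  proof -
    have "sig (pr i u) w = sig (pr i u) (pr (- i) w)"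
      using sig_pr[of "pr i u" "- i" w] sig_skew[of "pr i u"] by simp
    also have "\<dots> = sig u (pr (- i) w)" by (simp add: sig_pr)
    also have "\<dots> = 0" using u W that unfolding perp_def stable_def by auto
    finally show ?thesis .
  qed
  then show "pr i u \<in> perp U W" using u U unfolding perp_def stable_def by auto
qed

definition splits :: "'v set \<Rightarrow> bool" where
  "splits W \<longleftrightarrow> W \<noteq> {0} \<and> stable W \<and> nondeg W \<and> has_projection W"

text \<open>The predicate \<open>ok\<close> stays arbitrary so that one induction serves all three
  classifications. After a block is split off, its complement in \<open>U\<close> satisfies the same
  hypotheses in smaller dimension.\<close>

lemma decomposition_if_blocks:
  assumes blk: "\<And>U. stable U \<Longrightarrow> nondeg U \<Longrightarrow> U \<noteq> {0} \<Longrightarrow> \<exists>W b. ok W b \<and> W \<subseteq> U \<and> splits W"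
  shows "\<exists>ws. block_decomp scale sig ok ws"
proof -
  have main: "\<exists>ws. (\<forall>(W, b) \<in> set ws. ok W b \<and> W \<subseteq> U) \<and>
     (\<forall>j < length ws. \<forall>j' < length ws. j \<noteq> j' \<longrightarrow>
        (\<forall>x \<in> fst (ws ! j). \<forall>y \<in> fst (ws ! j'). sig x y = 0)) \<and>
     (\<forall>v\<in>U. \<exists>x. (\<forall>j < length ws. x j \<in> fst (ws ! j)) \<and> v = (\<Sum>j < length ws. x j)) \<and>
     (\<forall>x. (\<forall>j < length ws. x j \<in> fst (ws ! j)) \<and> (\<Sum>j < length ws. x j) = 0
        \<longrightarrow> (\<forall>j < length ws. x j = 0))" if "stable U" "nondeg U" for U
    using that
  proof (induction "dim U" arbitrary: U rule: less_induct)
    case less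
    show ?case
    proof (cases "U = {0}")
      case True
      then show ?thesis by (intro exI[of _ "[]"]) auto
    next
      case False
      then obtain W b where W: "ok W b" "W \<subseteq> U" "splits W" using blk[OF less(2,3)] by blast
      let ?P = "perp U W"
      have Us: "subspace U" and stP: "stable ?P"
        using less(2) W(3) stable_perp[of U W] by (auto simp: stable_def[of U] splits_def)
      have ndP: "nondeg ?P"
        using perp_nondeg[OF less(3) _ W(2) Us] W(3) unfolding splits_def by auto
      have PU: "?P \<subseteq> U" unfolding perp_def by auto
      have sW: "subspace W" using W unfolding splits_def stable_def by auto
      obtain w where w: "w \<in> W" "w \<noteq> 0" using W(3) subspace_0[OF sW] unfolding splits_def by auto
      \<comment> \<open>A nonzero vector of the nondegenerate \<open>W\<close> is not orthogonal to
        \<open>W\<close>; this makes the dimension drop strictly.\<close>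
      then have "w \<notin> ?P" using W(3) unfolding splits_def nondeg_def perp_def by auto
      then have "?P \<subset> U" using PU w W by auto
      then have "dim ?P < dim U"
        using stP Us by (intro dim_psubset) (simp add: stable_def span_eq_iff[THEN iffD2])
      from less(1)[OF this stP ndP] obtain ws where
        ok: "\<forall>(W', b) \<in> set ws. ok W' b \<and> W' \<subseteq> ?P" and
        orth: "\<forall>j < length ws. \<forall>j' < length ws. j \<noteq> j' \<longrightarrow>
          (\<forall>x \<in> fst (ws ! j). \<forall>y \<in> fst (ws ! j'). sig x y = 0)" and
        ex: "\<forall>v\<in>?P. \<exists>x. (\<forall>j < length ws. x j \<in> fst (ws ! j)) \<and> v = (\<Sum>j < length ws. x j)" and
        un: "\<forall>x. (\<forall>j < length ws. x j \<in> fst (ws ! j)) \<and> (\<Sum>j < length ws. x j) = 0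
          \<longrightarrow> (\<forall>j < length ws. x j = 0)"
        by (elim exE conjE) (rule that)
      have okU: "ok W' b' \<and> W' \<subseteq> U" if "(W', b') \<in> set ws" for W' b'
        using bspec[OF ok that] PU by auto
      have inP: "fst (ws ! j) \<subseteq> ?P" if "j < length ws" for j
        using ok that nth_mem[of j ws] by (auto simp: split_beta)
      have pW: "sig x y = 0" "sig y x = 0" if "x \<in> W" "y \<in> ?P" for x y
        using that sig_skew[of x y] unfolding perp_def by auto
      show ?thesis
      proof (intro exI[of _ "(W, b) # ws"] conjI)
        show "\<forall>(W', b')\<in>set ((W, b) # ws). ok W' b' \<and> W' \<subseteq> U"
          using okU W(1,2) by auto
        show "\<forall>j<length ((W, b) # ws). \<forall>j'<length ((W, b) # ws). j \<noteq> j' \<longrightarrow>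
          (\<forall>x\<in>fst (((W, b) # ws) ! j). \<forall>y\<in>fst (((W, b) # ws) ! j'). sig x y = 0)"
        proof (intro allI impI ballI)
          fix j j' x y
          assume "j < length ((W, b) # ws)" "j' < length ((W, b) # ws)" "j \<noteq> j'"
            "x \<in> fst (((W, b) # ws) ! j)" "y \<in> fst (((W, b) # ws) ! j')"
          then consider i where "j = 0" "j' = Suc i" "i < length ws" "x \<in> W" "y \<in> fst (ws ! i)"
            | i where "j = Suc i" "j' = 0" "i < length ws" "x \<in> fst (ws ! i)" "y \<in> W"
            | i i' where "i < length ws" "i' < length ws" "i \<noteq> i'" "x \<in> fst (ws ! i)" "y \<in> fst (ws ! i')"
            by (cases j; cases j') auto
          then show "sig x y = 0"
          proof cases
            case 1 then show ?thesis using pW inP by blast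
          next
            case 2 then show ?thesis using pW inP by blast
          next
            case 3 then show ?thesis using orth by blast
          qed
        qed
        show "\<forall>v\<in>U. \<exists>x. (\<forall>j<length ((W, b) # ws). x j \<in> fst (((W, b) # ws) ! j)) \<and>
          v = (\<Sum>j<length ((W, b) # ws). x j)"
        proof
          fix v assume v: "v \<in> U"
          obtain w where w: "w \<in> W" "\<forall>y\<in>W. sig (v - w) y = 0"
            using W(3) unfolding splits_def has_projection_def by blast
          then have "v - w \<in> ?P" using v W Us unfolding perp_def by (auto intro: subspace_diff)
          then obtain x where x: "\<forall>j < length ws. x j \<in> fst (ws ! j)" "v - w = (\<Sum>j < length ws. x j)"
            using ex by blast
          show "\<exists>x. (\<forall>j<length ((W, b) # ws). x j \<in> fst (((W, b) # ws) ! j)) \<and>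
            v = (\<Sum>j<length ((W, b) # ws). x j)"
          proof (intro exI[of _ "case_nat w x"] conjI allI impI)
            fix j assume "j < length ((W, b) # ws)"
            then show "case_nat w x j \<in> fst (((W, b) # ws) ! j)"
              using x w by (cases j) auto
          next
            show "v = (\<Sum>j<length ((W, b) # ws). case_nat w x j)"
              using x(2) by (simp add: sum.lessThan_Suc_shift del: sum.lessThan_Suc)
                (metis add.commute diff_add_cancel)
          qed
        qed
        show "\<forall>x. (\<forall>j<length ((W, b) # ws). x j \<in> fst (((W, b) # ws) ! j)) \<and>
          (\<Sum>j<length ((W, b) # ws). x j) = 0 \<longrightarrow> (\<forall>j<length ((W, b) # ws). x j = 0)"
        proof (intro allI impI)
          fix x j assume x: "(\<forall>j<length ((W, b) # ws). x j \<in> fst (((W, b) # ws) ! j)) \<and>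
            (\<Sum>j<length ((W, b) # ws). x j) = 0" and j: "j < length ((W, b) # ws)"
          have x0: "x 0 \<in> W" and xS: "\<And>j. j < length ws \<Longrightarrow> x (Suc j) \<in> fst (ws ! j)"
            using x by force+
          have sum: "x 0 + (\<Sum>j<length ws. x (Suc j)) = 0"
            using x by (simp add: sum.lessThan_Suc_shift del: sum.lessThan_Suc)
          have "(\<Sum>j<length ws. x (Suc j)) \<in> ?P"
            using xS inP stP unfolding stable_def by (intro subspace_sum) auto
          \<comment> \<open>\<open>x 0\<close> is minus a vector of the complement, hence orthogonal
            to \<open>W\<close>, although it lies in \<open>W\<close>.\<close>
          then have "sig (x 0) y = 0" if "y \<in> W" for y
            using pW(2)[OF that] sum that
            by (metis add_cancel_right_right add_eq_0_iff pW(2) sig_minus(1) neg_0_equal_iff_equal)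
          then have z: "x 0 = 0" using x0 W(3) unfolding splits_def nondeg_def by auto
          then have "\<forall>j<length ws. x (Suc j) = 0" using un[rule_format, of "\<lambda>j. x (Suc j)"] xS sum by simp
          then show "x j = 0" using z j by (cases j) auto
        qed
      qed
    qed
  qed
  have "stable UNIV" "nondeg UNIV"
    using nondegenerate unfolding stable_def nondeg_def by auto
  from main[OF this] show ?thesis
    unfolding block_decomp_def by simp
qed

section \<open>Pairs of strings of maximal length\<close>

lemma ex_long_string:
  assumes U: "stable U" "nondeg U" "U \<noteq> {0}"
  obtains k a x y where "x \<in> U" "x \<in> Vg a" "y \<in> U" "y \<in> Vg (of_nat k - a)"
    "sig x ((d ^^ k) y) = 1" "\<forall>u\<in>U. (d ^^ Suc k) u = 0"
proof -
  have sU: "subspace U" using U unfolding stable_def by auto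
  define n where "n = (LEAST n. \<forall>u\<in>U. (d ^^ n) u = 0)"
  have n: "\<forall>u\<in>U. (d ^^ n) u = 0"
    unfolding n_def by (rule LeastI_ex) (use nilpotent in blast)
  have "n \<noteq> 0" using n U(3) subspace_0[OF sU] by auto
  then obtain k where k: "n = Suc k" by (cases n) auto
  then have "\<not> (\<forall>u\<in>U. (d ^^ k) u = 0)"
    using not_less_Least[of k "\<lambda>n. \<forall>u\<in>U. (d ^^ n) u = 0"] by (simp flip: n_def)
  then obtain y where y: "y \<in> U" "(d ^^ k) y \<noteq> 0" by auto
  have "(d ^^ k) y = (\<Sum>i\<in>degs. (d ^^ k) (pr i y))"
    using dpow_sum[of k "\<lambda>i. pr i y" degs] by (simp add: sum_pr)
  then obtain i where i: "(d ^^ k) (pr i y) \<noteq> 0"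
    using y(2) by (metis sum.neutral)
  \<comment> \<open>\<open>(d ^^ k) ?y\<close> has degree \<open>i - k\<close>, so only the
    component of \<open>x\<close> in degree \<open>k - i\<close> can pair with it.\<close>
  let ?y = "pr i y" and ?a = "of_nat k - i"
  have yU: "?y \<in> U" using y U unfolding stable_def by auto
  then obtain x where x: "x \<in> U" "sig ((d ^^ k) ?y) x \<noteq> 0"
    using i U(2) stable_dpow[OF U(1)] unfolding nondeg_def by blast
  let ?c = "sig (pr ?a x) ((d ^^ k) ?y)"
  have "?c = sig x ((d ^^ k) ?y)"
    using dpow_Vg[OF pr_in, of k i y] by (intro sig_pr) simp
  then have c: "?c \<noteq> 0" using x sig_skew[of x] by simp
  show ?thesis
  proof (rule that)
    show "(1 / ?c) *s pr ?a x \<in> U" "?y \<in> U" "(1 / ?c) *s pr ?a x \<in> Vg ?a"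
      using x U yU by (auto simp: stable_def subspace_scale intro: Vg_scale)
    show "?y \<in> Vg (of_nat k - ?a)" by simp
    show "sig ((1 / ?c) *s pr ?a x) ((d ^^ k) ?y) = 1" using c by (simp add: sig_scale)
    show "\<forall>u\<in>U. (d ^^ Suc k) u = 0" using n k by simp
  qed
qed

end

section \<open>Construction of blocks\<close>

lemma halfodd_iff: "x \<in> halfodd \<longleftrightarrow> (\<exists>i::int. x = of_int i + 1/2)"
  unfolding halfodd_def by auto

lemma halfodd_int_odd:
  assumes "m \<in> halfodd" "of_nat l = 2 * m"
  shows "odd l"
proof -
  obtain i where "m = of_int i + 1/2" using assms(1) unfolding halfodd_iff by auto
  then have "of_int (int l) = (of_int (2 * i + 1) :: rat)" using assms(2) by simp
  then have "int l = 2 * i + 1" by (simp only: of_int_eq_iff)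
  then show ?thesis by presburger
qed

text \<open>Turns the index set in \<open>is_Tblock\<close> into positions
  \<open>0, ..., 2 m\<close> along a string that starts in degree \<open>m\<close>.\<close>

lemma halfodd_range:
  assumes "m \<in> halfodd" "of_nat l = 2 * m"
  shows "i \<in> halfodd \<and> \<bar>i\<bar> \<le> m \<longleftrightarrow> (\<exists>p\<le>l. i = m - of_nat p)"
proof
  assume i: "i \<in> halfodd \<and> \<bar>i\<bar> \<le> m"
  then obtain a b where ab: "m = of_int a + 1/2" "i = of_int b + 1/2"
    using assms unfolding halfodd_iff by auto
  then have "b \<le> a" using i by auto
  then have "m - of_nat (nat (a - b)) = i" using ab by (simp add: of_nat_nat)
  moreover have "nat (a - b) \<le> l"
  proof -
    have "of_nat (nat (a - b)) = m - i" using ab \<open>b \<le> a\<close> by (simp add: of_nat_nat)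
    also have "\<dots> \<le> of_nat l" using i assms(2) by linarith
    finally show ?thesis by (simp only: of_nat_le_iff)
  qed
  ultimately show "\<exists>p\<le>l. i = m - of_nat p" by metis
next
  assume "\<exists>p\<le>l. i = m - of_nat p"
  then obtain p where p: "p \<le> l" "i = m - of_nat p" by auto
  obtain a where a: "m = of_int a + 1/2" using assms unfolding halfodd_iff by auto
  have "i = of_int (a - int p) + 1/2" using a p by simp
  moreover have "(of_nat p :: rat) \<le> of_nat l" using p(1) by (simp only: of_nat_le_iff)
  ultimately show "i \<in> halfodd \<and> \<bar>i\<bar> \<le> m"
    using p assms(2) unfolding halfodd_iff by (intro conjI exI[of _ "a - int p"]) auto
qed

context graded_symplectic
begin

lemma Vg_disjoint: "x \<in> Vg i \<Longrightarrow> x \<in> Vg j \<Longrightarrow> x \<noteq> 0 \<Longrightarrow> i = j"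
  using pr_hom by metis

lemma Vg_nonzero_in: "x \<in> Vg i \<Longrightarrow> x \<noteq> 0 \<Longrightarrow> i \<in> I"
  using Vg_outside by blast

end

context graded_sp_endo
begin

text \<open>An even power of \<open>d\<close> is self-adjoint while \<open>sig\<close> is skew, so
  this value equals its own negative.\<close>

lemma sig_dpow_even: "even t \<Longrightarrow> sig y ((d ^^ t) y) = 0"
  using sig_dpow[of t y y] sig_skew[of "(d ^^ t) y" y] by simp

lemma sig_dpow_degree:
  assumes "x \<in> Vg a" "y \<in> Vg b" "of_nat n \<noteq> a + b"
  shows "sig x ((d ^^ n) y) = 0"
  by (rule sig_degree[OF assms(1) dpow_Vg[OF assms(2)]]) (use assms(3) in auto)

text \<open>Isotropic strings of \<open>x\<close> and \<open>y\<close> with antidiagonal mutual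
  pairing are the model (D1) up to relabelling by degree. The dual of \<open>(d ^^ p) x\<close> is
  \<open>(d ^^ (l - p)) y\<close> and conversely.\<close>

lemma D_block:
  assumes x: "x \<in> Vg s" and y: "y \<in> Vg (of_nat l - s)"
    and nil: "(d ^^ Suc l) x = 0" "(d ^^ Suc l) y = 0" and xy1: "sig x ((d ^^ l) y) = 1"
    and xx0: "\<And>j. sig x ((d ^^ j) x) = 0" and yy0: "\<And>j. sig y ((d ^^ j) y) = 0"
  defines "B \<equiv> (\<lambda>p. (d ^^ p) x) ` {..l} \<union> (\<lambda>p. (d ^^ p) y) ` {..l}"
  shows "is_Dblock scale sig Vg d s l (span B)" "splits (span B)"
proof -
  have xx: "sig ((d ^^ i) x) ((d ^^ j) x) = 0" for i j by (simp add: sig_dpow_dpow xx0)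
  have yy: "sig ((d ^^ i) y) ((d ^^ j) y) = 0" for i j by (simp add: sig_dpow_dpow yy0)
  have xy: "sig ((d ^^ p) x) ((d ^^ q) y) = (if p + q = l then (- 1) ^ p else 0)" for p q
  proof -
    have "sig x ((d ^^ (p + q)) y) = 0" if "p + q < l"
      by (rule sig_dpow_degree[OF x y]) (use that in simp)
    moreover have "(d ^^ (p + q)) y = 0" if "p + q > l"
      using dpow_eq_0[OF nil(2)] that by simp
    ultimately show ?thesis unfolding sig_dpow_dpow using xy1
      by (cases "p + q" l rule: linorder_cases) auto
  qed
  have yx: "sig ((d ^^ p) y) ((d ^^ q) x) = (if p + q = l then - ((- 1) ^ q) else 0)" for p q
    using xy[of q p] sig_skew[of "(d ^^ p) y"] by (auto simp: add.commute)
  define J where "J = (UNIV :: bool set) \<times> {..l}"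
  define v where "v = (\<lambda>(b, p). (d ^^ p) (if b then x else y))"
  define w where "w = (\<lambda>(b, p). (d ^^ (l - p)) (if b then y else x))"
  \<comment> \<open>The Boolean selects the string. On the \<open>y\<close>-string the sign comes
    from exchanging the arguments of \<open>sig\<close> and moving \<open>d ^^ (l - p)\<close>
    across.\<close>
  define c :: "bool \<times> nat \<Rightarrow> 'k" where "c = (\<lambda>(b, p). if b then (- 1) ^ p else - ((- 1) ^ (l - p)))"
  have vJ: "v ` J = B"
    unfolding v_def J_def B_def by (auto simp: UNIV_bool image_iff split: if_splits)
  have wJ: "w ` J = B"
  proof
    show "w ` J \<subseteq> B" unfolding w_def J_def B_def by auto
    show "B \<subseteq> w ` J"
    proof
      fix b assume "b \<in> B"
      then consider p where "p \<le> l" "b = (d ^^ p) x" | p where "p \<le> l" "b = (d ^^ p) y"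
        unfolding B_def by auto
      then show "b \<in> w ` J"
      proof cases
        case 1
        then show ?thesis by (intro image_eqI[of _ _ "(False, l - p)"]) (auto simp: w_def J_def)
      next
        case 2
        then show ?thesis by (intro image_eqI[of _ _ "(True, l - p)"]) (auto simp: w_def J_def)
      qed
    qed
  qed
  have fin: "finite J" unfolding J_def by simp
  have dual: "sig (v i) (w j) = (if i = j then c i else 0)" if "i \<in> J" "j \<in> J" for i j
    using that unfolding J_def v_def w_def c_def by (auto simp: xx yy xy yx split: if_splits)
  have c0: "c i \<noteq> 0" if "i \<in> J" for i
    unfolding c_def by (auto split: prod.splits)
  note df = dual_family[of J v w c, OF fin dual c0, unfolded vJ wJ]
  have cB: "card B = 2 * (l + 1)"
  proof -
    have "card B = card J" using card_image[OF df(1)] vJ by simp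
    then show ?thesis unfolding J_def by (simp add: card_cartesian_product)
  qed
  have hom: "B \<subseteq> (\<Union>i. Vg i)"
    unfolding B_def using dpow_Vg x y by blast
  have "d b \<in> span B" if b: "b \<in> B" for b
  proof -
    obtain p z where p: "p \<le> l" "b = (d ^^ p) z" "z = x \<or> z = y"
      using b unfolding B_def by blast
    have "(d ^^ Suc p) z \<in> span B"
    proof (cases "p = l")
      case True
      then have "(d ^^ Suc p) z = 0" using nil p(3) by blast
      then show ?thesis by (simp only: span_zero)
    next
      case False
      then have "(d ^^ Suc p) z \<in> B" unfolding B_def using p by (metis Suc_leI UnI1 UnI2 atMost_iff image_eqI le_neq_implies_less)
      then show ?thesis by (rule span_base)
    qed
    then show ?thesis using p by simp
  qed
  then have st: "stable (span B)" by (rule stable_span[OF hom])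
  have "x \<noteq> 0" using xy1 by auto
  moreover have "x \<in> span B" by (rule span_base) (auto simp: B_def intro: image_eqI[of _ _ 0])
  ultimately show "splits (span B)"
    unfolding splits_def using st df(3,4)[of, OF _ _ _ refl] by auto
  \<comment> \<open>The exponent is the distance from the top degree, which is \<open>s\<close> for
    \<open>e\<close> and \<open>l - s\<close> for \<open>f\<close>. Thus \<open>f (- s)\<close> is
    the last vector of the \<open>y\<close>-string, and \<open>f (- s + k)\<close> has exponent
    \<open>l - k\<close>.\<close>
  define e where "e i = (d ^^ nat \<lfloor>s - i\<rfloor>) x" for i
  define f where "f i = (d ^^ nat \<lfloor>of_nat l - s - i\<rfloor>) y" for i
  have e: "e (s - of_nat k) = (d ^^ k) x" for k unfolding e_def by simp
  have f: "f (- s + of_nat k) = (d ^^ (l - k)) y" if "k \<le> l" for k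
  proof -
    have "(of_nat l - s - (- s + of_nat k) :: rat) = of_nat (l - k)" using that by (simp add: of_nat_diff)
    then show ?thesis unfolding f_def by (simp only: floor_of_nat nat_int)
  qed
  define Ei where "Ei = {s - of_nat k | k. k \<le> l}"
  define Fi where "Fi = {- s + of_nat k | k. k \<le> l}"
  have eE: "e ` Ei = (\<lambda>p. (d ^^ p) x) ` {..l}"
    unfolding Ei_def using e by (force simp: image_iff)
  have fF: "f ` Fi = (\<lambda>p. (d ^^ p) y) ` {..l}"
  proof
    show "f ` Fi \<subseteq> (\<lambda>p. (d ^^ p) y) ` {..l}" unfolding Fi_def using f by auto
    show "(\<lambda>p. (d ^^ p) y) ` {..l} \<subseteq> f ` Fi"
    proof clarify
      fix p assume "p \<le> l"
      then have "f (- s + of_nat (l - p)) = (d ^^ p) y" "- s + of_nat (l - p) \<in> Fi"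
        using f[of "l - p"] unfolding Fi_def by (auto simp del: of_nat_diff)
      then show "(d ^^ p) y \<in> f ` Fi" by (metis image_eqI)
    qed
  qed
  have B: "e ` Ei \<union> f ` Fi = B" unfolding eE fF B_def ..
  show "is_Dblock scale sig Vg d s l (span B)"
    unfolding is_Dblock_def Let_def Ei_def[symmetric] Fi_def[symmetric]
  proof (rule exI[of _ e], rule exI[of _ f], unfold B, intro conjI ballI allI impI)
    show "e i \<in> Vg i" if "i \<in> Ei" for i
      using that dpow_Vg[OF x] unfolding Ei_def by (auto simp: e)
    show "f i \<in> Vg i" if i: "i \<in> Fi" for i
    proof -
      obtain k where k: "k \<le> l" "i = - s + of_nat k" using i unfolding Fi_def by auto
      then have "of_nat l - s - of_nat (l - k) = i" by (simp add: of_nat_diff)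
      then show ?thesis using dpow_Vg[OF y, of "l - k"] f[OF k(1)] k(2) by metis
    qed
    show "sig (e i) (e j) = 0" for i j unfolding e_def by (rule xx)
    show "sig (f i) (f j) = 0" for i j unfolding f_def by (rule yy)
    show "sig (e (s - of_nat k)) (f j) = (if j = - (s - of_nat k) then (- 1) ^ k else 0)"
      if k: "k \<le> l" and j: "j \<in> Fi" for k j
    proof -
      obtain k' where k': "k' \<le> l" "j = - s + of_nat k'" using j unfolding Fi_def by auto
      have "f j = (d ^^ (l - k')) y" using f k' by simp
      then show ?thesis using k k' by (auto simp: e xy)
    qed
    show "d (e i) = (if i = s - of_nat l then 0 else e (i - 1))" if i: "i \<in> Ei" for i
    proof -
      obtain k where k: "k \<le> l" "i = s - of_nat k" using i unfolding Ei_def by auto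
      have "i - 1 = s - of_nat (Suc k)" using k by simp
      then have "e (i - 1) = d (e i)" using e[of "Suc k"] e[of k] k(2) by (metis funpow.simps(2) comp_apply)
      then show ?thesis using k nil(1) by (auto simp: e)
    qed
    show "d (f i) = (if i = - s then 0 else f (i - 1))" if i: "i \<in> Fi" for i
    proof -
      obtain k where k: "k \<le> l" "i = - s + of_nat k" using i unfolding Fi_def by auto
      show ?thesis
      proof (cases k)
        case 0
        then have "i = - s" "f i = (d ^^ l) y" using k f[OF k(1)] by auto
        then show ?thesis using nil(2) by simp
      next
        case (Suc k')
        then have "i - 1 = - s + of_nat k'" "i \<noteq> - s" using k by (auto simp del: of_nat_Suc simp: of_nat_Suc)
        moreover have "l - k' = Suc (l - k)" using Suc k by simp
        moreover have "f i = (d ^^ (l - k)) y" using f k by simp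
        moreover have "f (- s + of_nat k') = (d ^^ (l - k')) y" using Suc k by (intro f) simp
        ultimately show ?thesis by (metis funpow.simps(2) comp_apply)
      qed
    qed
  qed (use df(2) cB in auto)
qed

text \<open>One string is its own dual family, read backwards. The value of
  \<open>sig x ((d ^^ l) x)\<close> need only be nonzero. The third claim gives the graded lines,
  needed for the sign in degree 1/2.\<close>

lemma T_block:
  assumes x: "x \<in> Vg m" and m: "m \<in> halfodd" "of_nat l = 2 * m"
    and nil: "(d ^^ Suc l) x = 0" and ne: "sig x ((d ^^ l) x) \<noteq> 0"
  defines "B \<equiv> (\<lambda>p. (d ^^ p) x) ` {..l}"
  shows "is_Tblock scale sig Vg d m (span B)" "splits (span B)"
    and "p \<le> l \<Longrightarrow> span B \<inter> Vg (m - of_nat p) = span {(d ^^ p) x}"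
proof -
  have xx: "sig ((d ^^ p) x) ((d ^^ q) x) = (if p + q = l then (- 1) ^ p * sig x ((d ^^ l) x) else 0)" for p q
  proof -
    have "sig x ((d ^^ (p + q)) x) = 0" if "p + q < l"
    proof (rule sig_dpow_degree[OF x x])
      have "(of_nat (p + q) :: rat) < of_nat l" using that by (simp only: of_nat_less_iff)
      then show "of_nat (p + q) \<noteq> m + m" using m(2) by simp
    qed
    moreover have "(d ^^ (p + q)) x = 0" if "p + q > l"
      using dpow_eq_0[OF nil] that by simp
    ultimately show ?thesis unfolding sig_dpow_dpow
      by (cases "p + q" l rule: linorder_cases) auto
  qed
  have wJ: "(\<lambda>p. (d ^^ (l - p)) x) ` {..l} = B"
    unfolding B_def
  proof (intro equalityI subsetI)
    fix b assume "b \<in> (\<lambda>p. (d ^^ p) x) ` {..l}"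
    then obtain p where "p \<le> l" "b = (d ^^ p) x" by auto
    then show "b \<in> (\<lambda>p. (d ^^ (l - p)) x) ` {..l}"
      by (intro image_eqI[of _ _ "l - p"]) auto
  qed auto
  note df = dual_family[of "{..l}" "\<lambda>p. (d ^^ p) x" "\<lambda>p. (d ^^ (l - p)) x"
      "\<lambda>p. (- 1) ^ p * sig x ((d ^^ l) x)", unfolded wJ B_def[symmetric]]
  have dual: "sig ((d ^^ i) x) ((d ^^ (l - j)) x) = (if i = j then (- 1) ^ i * sig x ((d ^^ l) x) else 0)"
    if "i \<in> {..l}" "j \<in> {..l}" for i j
    using that by (auto simp: xx)
  have ind: "independent B" and nd: "nondeg (span B)" and pj: "has_projection (span B)"
    using df(2-4)[OF _ dual] ne by auto
  have B0: "(d ^^ p) x \<noteq> 0" if "p \<le> l" for p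
    using ind dependent_zero[of B] that unfolding B_def by force
  have hom: "B \<subseteq> (\<Union>i. Vg i)"
    unfolding B_def using dpow_Vg x by blast
  have "d b \<in> span B" if b: "b \<in> B" for b
  proof -
    obtain p where p: "p \<le> l" "b = (d ^^ p) x"
      using b unfolding B_def by blast
    have "(d ^^ Suc p) x \<in> span B"
    proof (cases "p = l")
      case True
      then show ?thesis using nil by (simp only: span_zero)
    next
      case False
      then have "(d ^^ Suc p) x \<in> B"
        unfolding B_def using p by (intro image_eqI[of _ _ "Suc p"]) auto
      then show ?thesis by (rule span_base)
    qed
    then show ?thesis using p by simp
  qed
  then have st: "stable (span B)" by (rule stable_span[OF hom])
  have "x \<noteq> 0" using ne by auto
  moreover have "x \<in> span B" by (rule span_base) (auto simp: B_def intro: image_eqI[of _ _ 0])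
  ultimately show "splits (span B)"
    unfolding splits_def using st nd pj by auto
  have WV: "span B \<inter> Vg (m - of_nat p) = span {(d ^^ p) x}" if "p \<le> l" for p
  proof -
    have "B \<inter> Vg (m - of_nat p) = {(d ^^ p) x}"
    proof (intro equalityI subsetI)
      fix b assume "b \<in> B \<inter> Vg (m - of_nat p)"
      then obtain q where q: "q \<le> l" "b = (d ^^ q) x" "b \<in> Vg (m - of_nat p)" unfolding B_def by auto
      then have "m - of_nat q = m - of_nat p"
        using Vg_disjoint[OF dpow_Vg[OF x] _ B0] by blast
      then show "b \<in> {(d ^^ p) x}" using q by simp
    next
      fix b assume "b \<in> {(d ^^ p) x}"
      then show "b \<in> B \<inter> Vg (m - of_nat p)" using that dpow_Vg[OF x, of p] unfolding B_def by auto
    qed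
    then show ?thesis using span_homogeneous_Int[OF hom] by simp
  qed
  then show "p \<le> l \<Longrightarrow> span B \<inter> Vg (m - of_nat p) = span {(d ^^ p) x}" .
  have WV0: "span B \<inter> Vg i = {0}" if "\<not> (\<exists>p\<le>l. i = m - of_nat p)" for i
  proof -
    have "B \<inter> Vg i = {}"
      using that Vg_disjoint[OF dpow_Vg[OF x] _ B0] unfolding B_def by force
    then show ?thesis using span_homogeneous_Int[OF hom] by simp
  qed
  have dspan: "d ` span {z} = span {d z}" for z
    by (simp add: span_singleton image_image d_scale)
  show "is_Tblock scale sig Vg d m (span B)"
    unfolding is_Tblock_def halfodd_range[OF m]
  proof (intro conjI allI impI)
    show "span (\<Union>i. span B \<inter> Vg i) = span B"
    proof
      show "span (\<Union>i. span B \<inter> Vg i) \<subseteq> span B" by (rule span_minimal) auto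
      have "B \<subseteq> (\<Union>i. span B \<inter> Vg i)" using hom span_base by blast
      then show "span B \<subseteq> span (\<Union>i. span B \<inter> Vg i)" by (rule span_mono)
    qed
    show "\<forall>x\<in>span B. (\<forall>y\<in>span B. sig x y = 0) \<longrightarrow> x = 0" using nd unfolding nondeg_def .
    show "dim (span B \<inter> Vg i) = 1" if "\<exists>p\<le>l. i = m - of_nat p" for i
      using that WV B0 by auto
    show "span B \<inter> Vg i = {0}" if "\<not> (\<exists>p\<le>l. i = m - of_nat p)" for i
      using that by (rule WV0)
    show "d ` (span B \<inter> Vg i) = span B \<inter> Vg (i - 1)" if i: "i \<in> halfodd \<and> - m < i \<and> i \<le> m" for i
    proof -
      obtain p where p: "p \<le> l" "i = m - of_nat p" using halfodd_range[OF m, of i] i by auto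
      have "p \<noteq> l" using p i m(2) by auto
      then have "span B \<inter> Vg (m - of_nat (Suc p)) = span {(d ^^ Suc p) x}"
        using p by (intro WV) auto
      moreover have "i - 1 = m - of_nat (Suc p)" using p by simp
      moreover have "d ` (span B \<inter> Vg i) = span {(d ^^ Suc p) x}"
        using WV[OF p(1)] p(2) dspan by simp
      ultimately show ?thesis by metis
    qed
    have "- m = m - of_nat l" using m by simp
    moreover have "d ` (span B \<inter> Vg (m - of_nat l)) = {0}"
      using WV[of l] dspan nil by simp
    ultimately show "d ` (span B \<inter> Vg (- m)) = {0}" by metis
  qed simp
qed

text \<open>As \<open>x\<close> pairs with \<open>(d ^^ j) x\<close> only for
  \<open>j = 2 a > k\<close>, its string is isotropic at once; only \<open>y\<close> needs repair.
  Integrality of \<open>2 a\<close> makes the shift \<open>r = 2 a - k\<close>, from degree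
  \<open>a\<close> down to degree \<open>k - a\<close>, a number of steps.\<close>

lemma D_block_asymmetric:
  assumes U: "stable U" and x: "x \<in> U" "x \<in> Vg a" and y: "y \<in> U" "y \<in> Vg (of_nat k - a)"
    and xy: "sig x ((d ^^ k) y) = 1" and nil: "\<forall>u\<in>U. (d ^^ Suc k) u = 0"
    and ka: "of_nat k < 2 * a" and a: "2 * a \<in> \<int>"
  shows "\<exists>W. is_Dblock scale sig Vg d a k W \<and> W \<subseteq> U \<and> splits W"
proof -
  have sU: "subspace U" using U unfolding stable_def by simp
  have xx: "sig x ((d ^^ j) x) = 0" for j
  proof (cases "j \<le> k")
    case True
    then have "(of_nat j :: rat) \<le> of_nat k" by (simp only: of_nat_le_iff)
    then show ?thesis using ka by (intro sig_dpow_degree[OF x(2) x(2)]) linarith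
  next
    case False
    then show ?thesis using dpow_eq_0[OF bspec[OF nil x(1)]] by simp
  qed
  have "2 * a - of_nat k \<in> \<int>" using a by simp
  then obtain z where z: "2 * a - of_nat k = of_int z" by (rule Ints_cases)
  define r where "r = nat z"
  have r: "2 * a - of_nat k = of_nat r" using z ka unfolding r_def by (simp add: of_nat_nat)
  \<comment> \<open>Adding \<open>c\<close> times \<open>(d ^^ r) x\<close> changes
    \<open>sig y ((d ^^ (k - r)) y)\<close> by \<open>c * ((- 1) ^ r - (- 1) ^ k)\<close>. For odd
    \<open>k - r\<close> this is \<open>- 2 * c * (- 1) ^ k\<close>, and \<open>c\<close> is chosen
    to cancel the original value. For \<open>r > k\<close> nothing needs repair.\<close>
  define c where "c = (if r \<le> k then sig y ((d ^^ (k - r)) y) * (- 1) ^ k / 2 else 0)"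
  define y' where "y' = y + c *s (d ^^ r) x"
  have y'U: "y' \<in> U"
    unfolding y'_def using x y sU stable_dpow[OF U] by (auto intro: subspace_add subspace_scale)
  have "a - of_nat r = of_nat k - a" using r by (simp add: algebra_simps)
  then have "(d ^^ r) x \<in> Vg (of_nat k - a)"
    using dpow_Vg[OF x(2), of r] by metis
  then have y'V: "y' \<in> Vg (of_nat k - a)"
    unfolding y'_def using y(2) by (intro Vg_add Vg_scale)
  have xy': "sig x ((d ^^ k) y') = 1"
    unfolding y'_def by (simp add: dpow_add dpow_scale dpow_dpow sig_add sig_scale xx xy)
  have yy': "sig y' ((d ^^ j) y') = 0" for j
  \<comment> \<open>Since \<open>y'\<close> has degree \<open>k - a\<close>, the only exponent
    allowed by degree is \<open>2 (k - a) = k - r\<close>.\<close>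
  proof (cases "r \<le> k \<and> j = k - r")
    case False
    have "of_nat j \<noteq> of_nat k - a + (of_nat k - a)"
    proof
      assume "of_nat j = of_nat k - a + (of_nat k - a)"
      then have "(of_nat (j + r) :: rat) = of_nat k" using r by simp
      then have "j + r = k" by (simp only: of_nat_eq_iff)
      then show False using False by auto
    qed
    then show ?thesis by (rule sig_dpow_degree[OF y'V y'V])
  next
    case True
    then have jr: "j + r = k" by simp
    let ?A = "sig y ((d ^^ j) y)"
    have c: "c = ?A * (- 1) ^ k / 2" unfolding c_def using True by simp
    have yx: "sig y ((d ^^ k) x) = - ((- 1) ^ k)"
      using sig_skew[of y] sig_dpow[of k x y] xy by simp
    have "sig y' ((d ^^ j) y') = ?A + c * sig y ((d ^^ k) x) + c * sig ((d ^^ r) x) ((d ^^ j) y)"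
      unfolding y'_def
      by (simp add: dpow_add dpow_scale dpow_dpow sig_add sig_scale sig_dpow_dpow[of r x _ x] xx jr)
    also have "sig ((d ^^ r) x) ((d ^^ j) y) = (- 1) ^ r"
      using xy jr by (simp add: sig_dpow_dpow add.commute)
    finally have eq: "sig y' ((d ^^ j) y') = ?A - c * (- 1) ^ k + c * (- 1) ^ r" by (simp add: yx)
    show ?thesis
    proof (cases "even j")
      case True
      then have "?A = 0" by (rule sig_dpow_even)
      then show ?thesis using eq c by simp
    next
      case False
      then have "(- 1) ^ r = - ((- 1) ^ k :: 'k)" using jr by (auto simp flip: jr simp: power_add)
      then show ?thesis using eq c by (simp add: field_simps flip: power_add)
    qed
  qed
  let ?B = "(\<lambda>p. (d ^^ p) x) ` {..k} \<union> (\<lambda>p. (d ^^ p) y') ` {..k}"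
  have "span ?B \<subseteq> U"
    using stable_dpow[OF U] x(1) y'U by (intro span_minimal sU) auto
  with D_block[OF x(2) y'V bspec[OF nil x(1)] bspec[OF nil y'U] xy' xx yy'] show ?thesis
    by (intro exI[of _ "span ?B"] conjI)
qed

text \<open>For \<open>k > 2 a\<close> the roles of \<open>x\<close> and \<open>y\<close> are
  exchanged, as the degree \<open>k - a\<close> of \<open>y\<close> then satisfies
  \<open>k < 2 (k - a)\<close>. The case \<open>k = 2 a\<close> is left open because its outcome
  depends on the parity of \<open>k\<close>.\<close>

lemma block_cases:
  assumes U: "stable U" "nondeg U" "U \<noteq> {0}" and I: "\<And>i. i \<in> I \<Longrightarrow> 2 * i \<in> \<int>"
  obtains (D) s l W where "s \<in> I" "of_nat l < 2 * s" "is_Dblock scale sig Vg d s l W" "W \<subseteq> U" "splits W"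
    | (self_dual) s l x y where "s \<in> I" "of_nat l = 2 * s" "x \<in> U" "x \<in> Vg s" "y \<in> U" "y \<in> Vg s"
      "sig x ((d ^^ l) y) = 1" "\<forall>u\<in>U. (d ^^ Suc l) u = 0"
proof -
  obtain k a x y where x: "x \<in> U" "x \<in> Vg a" and y: "y \<in> U" "y \<in> Vg (of_nat k - a)"
    and xy: "sig x ((d ^^ k) y) = 1" and nil: "\<forall>u\<in>U. (d ^^ Suc k) u = 0"
    by (rule ex_long_string[OF U]) (rule that)
  have "x \<noteq> 0" "y \<noteq> 0" using xy by auto
  then have aI: "a \<in> I" "of_nat k - a \<in> I" using Vg_nonzero_in[OF x(2)] Vg_nonzero_in[OF y(2)] by auto
  consider "of_nat k < 2 * a" | "of_nat k = 2 * a" | "of_nat k > 2 * a" by linarith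
  then show ?thesis
  proof cases
    case 1
    from D_block_asymmetric[OF U(1) x y xy nil 1 I[OF aI(1)]]
    show ?thesis using D[OF aI(1) 1] by (elim exE conjE)
  next
    case 2
    then have "of_nat k - a = a" by simp
    then show ?thesis using self_dual[OF aI(1) 2 x _ _ xy nil] y by simp
  next
    case 3
    \<comment> \<open>The factor undoes the sign that arises when \<open>d ^^ k\<close> is moved to
      the other argument and the arguments are exchanged.\<close>
    define x' where "x' = (- ((- 1) ^ k)) *s x"
    have x': "x' \<in> U" "x' \<in> Vg (of_nat k - (of_nat k - a))"
      using x U(1) unfolding x'_def stable_def by (auto intro: subspace_scale Vg_scale subspace_neg subspace_neg[OF subspace_Vg])
    have "sig y ((d ^^ k) x) = - ((- 1) ^ k)"
      using sig_skew[of y] sig_dpow[of k x y] xy by simp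
    then have "sig y ((d ^^ k) x') = 1"
      unfolding x'_def by (simp only: dpow_scale sig_scale) (simp flip: power_add)
    note yx = this
    have ka: "of_nat k < 2 * (of_nat k - a)" using 3 by (simp add: algebra_simps)
    from D_block_asymmetric[OF U(1) y x' yx nil ka I[OF aI(2)]]
    show ?thesis using D[OF aI(2) ka] by (elim exE conjE)
  qed
qed

end

section \<open>Existence of block decompositions\<close>

lemma floor_Ints_bound:
  assumes "s \<in> \<int>" "of_nat l \<le> 2 * (s :: rat)"
  shows "int l \<le> 2 * \<lfloor>s\<rfloor>" "s \<ge> 0"
proof -
  obtain i where s: "s = of_int i" using assms(1) by (rule Ints_cases)
  have "of_int (int l) \<le> (of_int (2 * i) :: rat)" using assms(2) s by simp
  then have "int l \<le> 2 * i" by (simp only: of_int_le_iff)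
  then show "int l \<le> 2 * \<lfloor>s\<rfloor>" "s \<ge> 0" using s by auto
qed

text \<open>For half-odd \<open>s\<close> one has
  \<open>2 * \<lfloor>s\<rfloor> = 2 * s - 1\<close>, so the bound excludes the self-dual length
  \<open>l = 2 s\<close>, which belongs to the \<open>\<tau>\<close>-blocks.\<close>

lemma halfodd_bound_iff:
  assumes "s \<in> halfodd"
  shows "int l \<le> 2 * \<lfloor>s\<rfloor> \<longleftrightarrow> of_nat l < 2 * s"
proof -
  obtain i where s: "s = of_int i + 1/2" using assms unfolding halfodd_iff by auto
  have fl: "\<lfloor>s\<rfloor> = i" unfolding s by linarith
  have "of_nat l < 2 * s \<longleftrightarrow> of_int (int l) < (of_int (2 * i + 1) :: rat)" using s by simp
  also have "\<dots> \<longleftrightarrow> int l < 2 * i + 1" by (simp only: of_int_less_iff)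
  finally show ?thesis using fl by auto
qed

lemma halfodd_double_Ints: "i \<in> halfodd \<Longrightarrow> 2 * i \<in> \<int>"
  unfolding halfodd_iff by (auto simp: algebra_simps)

context graded_sp_endo
begin

lemma ex_decomp_Z:
  assumes I: "I = \<int>"
  shows "\<exists>ws. block_decomp scale sig (okZ scale sig Vg d) ws"
proof (rule decomposition_if_blocks)
  fix U assume U: "stable U" "nondeg U" "U \<noteq> {0}"
  have I2: "2 * i \<in> \<int>" if "i \<in> I" for i using that I by simp
  show "\<exists>W b. okZ scale sig Vg d W b \<and> W \<subseteq> U \<and> splits W"
  proof (rule block_cases[OF U I2])
    fix s l W assume "s \<in> I" "of_nat l < 2 * s" "is_Dblock scale sig Vg d s l W" "W \<subseteq> U" "splits W"
    then show ?thesis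
      using floor_Ints_bound[of s l] I by (intro exI[of _ W] exI[of _ "DB s l"]) (auto simp: okZ_def)
  next
    fix s l x y assume s: "s \<in> I" "of_nat l = 2 * s" and x: "x \<in> U" "x \<in> Vg s"
      and y: "y \<in> U" "y \<in> Vg s" and xy: "sig x ((d ^^ l) y) = 1" and nil: "\<forall>u\<in>U. (d ^^ Suc l) u = 0"
    obtain i where i: "s = of_int i" using s(1) I by (auto elim: Ints_cases)
    then have "of_int (int l) = (of_int (2 * i) :: rat)" using s(2) by simp
    then have "int l = 2 * i" by (simp only: of_int_eq_iff)
    then have "even l" by presburger
    \<comment> \<open>For \<open>j = l\<close> evenness of \<open>l\<close> gives zero, for other
      \<open>j\<close> the degree does. Hence both strings are isotropic without any
      correction.\<close>
    have zz: "sig z ((d ^^ j) z) = 0" if "z \<in> Vg s" for z j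
    proof (cases "j = l")
      case True
      then show ?thesis using \<open>even l\<close> sig_dpow_even by simp
    next
      case False
      then have "(of_nat j :: rat) \<noteq> of_nat l" by simp
      then show ?thesis using s(2) by (intro sig_dpow_degree[OF that that]) simp
    qed
    have "of_nat l - s = s" using s(2) by simp
    then have y': "y \<in> Vg (of_nat l - s)" using y by simp
    let ?B = "(\<lambda>p. (d ^^ p) x) ` {..l} \<union> (\<lambda>p. (d ^^ p) y) ` {..l}"
    have sU: "subspace U" using U(1) unfolding stable_def by simp
    have "span ?B \<subseteq> U"
      using stable_dpow[OF U(1)] x(1) y(1) by (intro span_minimal sU) auto
    moreover note D_block[OF x(2) y' bspec[OF nil x(1)] bspec[OF nil y(1)] xy zz[OF x(2)] zz[OF y(2)]]
    ultimately show ?thesis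
      using floor_Ints_bound[of s l] s I
      by (intro exI[of _ "span ?B"] exI[of _ "DB s l"]) (auto simp: okZ_def)
  qed
qed

text \<open>Polarisation: for odd \<open>l\<close> the form \<open>sig u ((d ^^ l) v)\<close> is
  symmetric. If its quadratic form vanished on \<open>x\<close>, \<open>y\<close> and
  \<open>x + y\<close>, then \<open>2 = 0\<close> would follow.\<close>

lemma self_dual_T:
  assumes U: "stable U" and s: "s \<in> halfodd" "of_nat l = 2 * s" and x: "x \<in> U" "x \<in> Vg s"
    and y: "y \<in> U" "y \<in> Vg s" and xy: "sig x ((d ^^ l) y) = 1" and nil: "\<forall>u\<in>U. (d ^^ Suc l) u = 0"
  obtains z W where "z \<in> Vg s" "sig z ((d ^^ l) z) \<noteq> 0" "is_Tblock scale sig Vg d s W" "splits W" "W \<subseteq> U"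
    "\<And>p. p \<le> l \<Longrightarrow> W \<inter> Vg (s - of_nat p) = span {(d ^^ p) z}"
proof -
  have sU: "subspace U" using U unfolding stable_def by simp
  have "odd l" using s by (rule halfodd_int_odd)
  then have yx: "sig y ((d ^^ l) x) = 1"
    using sig_skew[of y] sig_dpow[of l x y] xy by simp
  have "\<exists>z. z \<in> U \<and> z \<in> Vg s \<and> sig z ((d ^^ l) z) \<noteq> 0"
  proof (rule ccontr)
    assume "\<not> ?thesis"
    then have no: "sig z ((d ^^ l) z) = 0" if "z \<in> U" "z \<in> Vg s" for z using that by blast
    have "sig (x + y) ((d ^^ l) (x + y)) = 0"
      using x y sU by (intro no subspace_add Vg_add)
    then have "(2 :: 'k) = 0"
      using no[OF x] no[OF y] xy yx by (simp add: dpow_add sig_add)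
    then show False by simp
  qed
  then obtain z where z: "z \<in> U" "z \<in> Vg s" "sig z ((d ^^ l) z) \<noteq> 0" by blast
  let ?B = "(\<lambda>p. (d ^^ p) z) ` {..l}"
  have "span ?B \<subseteq> U"
    using stable_dpow[OF U] z(1) by (intro span_minimal sU) auto
  then show ?thesis
    using that[of z "span ?B"] T_block[OF z(2) s bspec[OF nil z(1)] z(3)] z by blast
qed

lemma ex_decomp_C:
  assumes I: "I = halfodd"
  shows "\<exists>ws. block_decomp scale sig (okC scale sig Vg d) ws"
proof (rule decomposition_if_blocks)
  fix U assume U: "stable U" "nondeg U" "U \<noteq> {0}"
  have I2: "2 * i \<in> \<int>" if "i \<in> I" for i using that I halfodd_double_Ints by simp
  show "\<exists>W b. okC scale sig Vg d W b \<and> W \<subseteq> U \<and> splits W"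
  proof (rule block_cases[OF U I2])
    fix s l W assume *: "s \<in> I" "of_nat l < 2 * s" "is_Dblock scale sig Vg d s l W" "W \<subseteq> U" "splits W"
    then have "s > 0" by (metis le_less_trans of_nat_0_le_iff zero_less_mult_iff zero_less_numeral not_numeral_less_zero)
    then show ?thesis
      using * halfodd_bound_iff[of s l] I
      by (intro exI[of _ W] exI[of _ "DB s l"]) (auto simp: okC_def)
  next
    fix s l x y assume s: "s \<in> I" "of_nat l = 2 * s" and x: "x \<in> U" "x \<in> Vg s"
      and y: "y \<in> U" "y \<in> Vg s" and xy: "sig x ((d ^^ l) y) = 1" and nil: "\<forall>u\<in>U. (d ^^ Suc l) u = 0"
    have sh: "s \<in> halfodd" using s I by simp
    have "l \<noteq> 0" using halfodd_int_odd[OF sh s(2)] by (metis even_zero)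
    then have "s > 0" using s(2) by (metis of_nat_0_less_iff neq0_conv zero_less_mult_iff not_numeral_less_zero)
    obtain z W where W: "is_Tblock scale sig Vg d s W" "splits W" "W \<subseteq> U"
      by (rule self_dual_T[OF U(1) sh s(2) x y xy nil]) (rule that)
    then show ?thesis
      using sh \<open>s > 0\<close> by (intro exI[of _ W] exI[of _ "TB s"]) (auto simp: okC_def)
  qed
qed

lemma subspace_neg_image:
  assumes "subspace S"
  shows "(\<lambda>x. - d x) ` S = d ` S"
proof -
  have d_neg: "d (- x) = - d x" for x using d_scale[of "- 1" x] by simp
  have "uminus ` S = S"
    using assms subspace_neg by (auto simp: image_iff) (metis minus_minus)
  then have "d ` S = d ` uminus ` S" by simp
  also have "\<dots> = (\<lambda>x. - d x) ` S" by (simp add: image_image d_neg)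
  finally show ?thesis ..
qed

text \<open>\<open>d\<close> and \<open>- d\<close> have the same image on every subspace, so the
  shape of a \<open>\<tau>\<close>-block does not see the sign; only the condition in degree 1/2
  does.\<close>

lemma is_Tblock_neg:
  assumes "subspace W"
  shows "is_Tblock scale sig Vg (\<lambda>x. - d x) m W \<longleftrightarrow> is_Tblock scale sig Vg d m W"
  unfolding is_Tblock_def
  using subspace_neg_image[OF subspace_inter[OF assms subspace_Vg]] by simp

end

locale graded_sp_endo_real = graded_sp_endo scale Basis sig I Vg d
  for scale :: "real \<Rightarrow> 'v::ab_group_add \<Rightarrow> 'v" (infixr \<open>*s\<close> 75) and Basis sig I Vg d
begin

lemma ex_decomp_R:
  assumes I: "I = halfodd"
  shows "\<exists>ws. block_decomp scale sig (okR scale sig Vg d) ws"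
proof (rule decomposition_if_blocks)
  fix U assume U: "stable U" "nondeg U" "U \<noteq> {0}"
  have I2: "2 * i \<in> \<int>" if "i \<in> I" for i using that I halfodd_double_Ints by simp
  show "\<exists>W b. okR scale sig Vg d W b \<and> W \<subseteq> U \<and> splits W"
  proof (rule block_cases[OF U I2])
    fix s l W assume *: "s \<in> I" "of_nat l < 2 * s" "is_Dblock scale sig Vg d s l W" "W \<subseteq> U" "splits W"
    then have "s > 0" by (metis le_less_trans of_nat_0_le_iff zero_less_mult_iff zero_less_numeral not_numeral_less_zero)
    then show ?thesis
      using * halfodd_bound_iff[of s l] I
      by (intro exI[of _ W] exI[of _ "DB s l"]) (auto simp: okR_def)
  next
    fix s l x y assume s: "s \<in> I" "of_nat l = 2 * s" and x: "x \<in> U" "x \<in> Vg s"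
      and y: "y \<in> U" "y \<in> Vg s" and xy: "sig x ((d ^^ l) y) = 1" and nil: "\<forall>u\<in>U. (d ^^ Suc l) u = 0"
    have sh: "s \<in> halfodd" using s I by simp
    have odd: "odd l" using halfodd_int_odd[OF sh s(2)] .
    then have "l \<noteq> 0" by (metis even_zero)
    then have s0: "s > 0" using s(2) by (metis of_nat_0_less_iff neq0_conv zero_less_mult_iff not_numeral_less_zero)
    obtain z W where z: "z \<in> Vg s" "sig z ((d ^^ l) z) \<noteq> 0"
      and W: "is_Tblock scale sig Vg d s W" "splits W" "W \<subseteq> U"
      and WV: "\<And>p. p \<le> l \<Longrightarrow> W \<inter> Vg (s - of_nat p) = span {(d ^^ p) z}"
      by (rule self_dual_T[OF U(1) sh s(2) x y xy nil]) (rule that)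
    \<comment> \<open>As \<open>2 s = l = 2 p + 1\<close>, the string of \<open>z\<close> reaches
      degree 1/2 after \<open>p\<close> steps.\<close>
    obtain p where p: "l = 2 * p + 1" using odd by (rule oddE)
    have "s - of_nat p = 1/2" using s(2) p by (simp add: field_simps)
    moreover have "p \<le> l" using p by simp
    ultimately have W12: "W \<inter> Vg (1/2) = span {(d ^^ p) z}" using WV by metis
    let ?q = "sig (d ((d ^^ p) z)) ((d ^^ p) z)"
    have "?q = (- 1) ^ Suc p * sig z ((d ^^ l) z)"
      using sig_dpow_dpow[of "Suc p" z p z] p by (simp add: mult_2)
    then have q: "?q \<noteq> 0" using z by simp
    \<comment> \<open>The piece in degree 1/2 is a line, and for \<open>u\<close> equal to
      \<open>c\<close> times its generator the product is \<open>(c * ?q)\<close> squared. So the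
      sign of \<open>?q\<close> decides between \<open>TB\<close> and \<open>NTB\<close>.\<close>
    have sign: "sig (d u) u * ?q > 0" if u: "u \<in> W \<inter> Vg (1/2)" "u \<noteq> 0" for u
    proof -
      obtain c where c: "u = c *s (d ^^ p) z" using u(1) unfolding W12 by (auto simp: span_singleton)
      then have "sig (d u) u * ?q = (c * ?q)\<^sup>2"
        by (simp add: d_scale sig_scale power2_eq_square)
      moreover have "c \<noteq> 0" using c u(2) by auto
      ultimately show ?thesis using q by simp
    qed
    have sW: "subspace W" using W(2) unfolding splits_def stable_def by simp
    show ?thesis
    proof (cases "?q > 0")
      case True
      then have "sig (d u) u > 0" if "u \<in> W \<inter> Vg (1/2)" "u \<noteq> 0" for u
        using sign[OF that] by (simp add: zero_less_mult_iff)
      then show ?thesis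
        using sh s0 W by (intro exI[of _ W] exI[of _ "TB s"]) (auto simp: okR_def)
    next
      case False
      then have "sig (- d u) u > 0" if "u \<in> W \<inter> Vg (1/2)" "u \<noteq> 0" for u
        using sign[OF that] by (simp add: zero_less_mult_iff sig_minus)
      then show ?thesis
        using sh s0 W is_Tblock_neg[OF sW] by (intro exI[of _ W] exI[of _ "NTB s"]) (auto simp: okR_def)
    qed
  qed
qed

end

section \<open>Invariant dimensions\<close>

context finite_dimensional_vector_space
begin

definition sumset :: "'i set \<Rightarrow> ('i \<Rightarrow> 'b set) \<Rightarrow> 'b set" where
  "sumset J S = {sum x J | x. \<forall>j\<in>J. x j \<in> S j}"

lemma subspace_sumset:
  assumes "\<And>j. j \<in> J \<Longrightarrow> subspace (S j)"
  shows "subspace (sumset J S)"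
proof (rule subspaceI)
  show "0 \<in> sumset J S"
    unfolding sumset_def using assms subspace_0 by (force intro!: exI[of _ "\<lambda>_. 0"])
next
  fix u v assume "u \<in> sumset J S" "v \<in> sumset J S"
  then obtain x y where "u = sum x J" "v = sum y J" "\<forall>j\<in>J. x j \<in> S j" "\<forall>j\<in>J. y j \<in> S j"
    unfolding sumset_def by auto
  then show "u + v \<in> sumset J S"
    unfolding sumset_def using assms
    by (auto intro!: exI[of _ "\<lambda>j. x j + y j"] simp: sum.distrib subspace_add)
next
  fix c v assume "v \<in> sumset J S"
  then obtain x where "v = sum x J" "\<forall>j\<in>J. x j \<in> S j"
    unfolding sumset_def by auto
  then show "c *s v \<in> sumset J S"
    unfolding sumset_def using assms
    by (auto intro!: exI[of _ "\<lambda>j. c *s x j"] simp: scale_sum_right subspace_scale)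
qed

lemma dim_sumset:
  assumes "finite J" "\<And>j. j \<in> J \<Longrightarrow> subspace (S j)"
    and "\<And>x. (\<forall>j\<in>J. x j \<in> S j) \<Longrightarrow> sum x J = 0 \<Longrightarrow> \<forall>j\<in>J. x j = 0"
  shows "dim (sumset J S) = (\<Sum>j\<in>J. dim (S j))"
  using assms
proof (induction J rule: finite_induct)
  case empty
  then show ?case by (simp add: sumset_def)
next
  case (insert i J)
  have sub: "subspace (S i)" "subspace (sumset J S)"
    using insert.prems(1) by (auto intro: subspace_sumset)
  have indep: "\<forall>j\<in>J. x j = 0" if "\<forall>j\<in>J. x j \<in> S j" "sum x J = 0" for x
  proof -
    have "sum (x(i := 0)) J = sum x J" using insert.hyps by (intro sum.cong) auto
    then have "\<forall>j\<in>insert i J. (x(i := 0)) j = 0"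
      using that insert.hyps subspace_0[OF sub(1)] by (intro insert.prems(2)) auto
    then show ?thesis using insert.hyps by (metis fun_upd_other insertI2)
  qed
  have eq: "sumset (insert i J) S = {u + v | u v. u \<in> S i \<and> v \<in> sumset J S}"
  proof (intro equalityI subsetI)
    fix w assume "w \<in> sumset (insert i J) S"
    then obtain x where "w = sum x (insert i J)" "\<forall>j\<in>insert i J. x j \<in> S j"
      unfolding sumset_def by auto
    then show "w \<in> {u + v | u v. u \<in> S i \<and> v \<in> sumset J S}"
      using insert.hyps unfolding sumset_def by auto
  next
    fix w assume "w \<in> {u + v | u v. u \<in> S i \<and> v \<in> sumset J S}"
    then obtain u x where w: "w = u + sum x J" "u \<in> S i" "\<forall>j\<in>J. x j \<in> S j"
      unfolding sumset_def by auto
    moreover have "sum (x(i := u)) J = sum x J" using insert.hyps by (intro sum.cong) auto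
    ultimately have "w = sum (x(i := u)) (insert i J)" "\<forall>j\<in>insert i J. (x(i := u)) j \<in> S j"
      using insert.hyps by auto
    then show "w \<in> sumset (insert i J) S" unfolding sumset_def by blast
  qed
  have "S i \<inter> sumset J S \<subseteq> {0}"
  proof
    fix u assume u: "u \<in> S i \<inter> sumset J S"
    then obtain x where x: "u = sum x J" "\<forall>j\<in>J. x j \<in> S j" unfolding sumset_def by auto
    have "sum (x(i := - u)) J = sum x J" using insert.hyps by (intro sum.cong) auto
    then have "\<forall>j\<in>insert i J. (x(i := - u)) j = 0"
      using x u insert.hyps sub(1) by (intro insert.prems(2)) (auto intro: subspace_neg)
    then show "u \<in> {0}" by (metis fun_upd_same insertI1 neg_equal_0_iff_equal singletonI)
  qed
  then have "dim (S i \<inter> sumset J S) = 0" by simp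
  then have "dim (sumset (insert i J) S) = dim (S i) + dim (sumset J S)"
    using dim_sums_Int[OF sub] unfolding eq by linarith
  moreover have "dim (sumset J S) = (\<Sum>j\<in>J. dim (S j))"
    using insert.prems(1) indep by (intro insert.IH) auto
  ultimately show ?case using insert.hyps by simp
qed

end

section \<open>Maximal good subspaces and conjugation\<close>

context graded_symplectic
begin

text \<open>The endomorphism is an argument, not a locale parameter, so that \<open>d\<close> and a
  conjugate \<open>d'\<close> can be compared. The exponent is \<open>Suc k\<close> because
  \<open>k\<close> counts steps: a string of \<open>k + 1\<close> vectors dies at step
  \<open>k + 1\<close>.\<close>

definition deg_ker :: "('v \<Rightarrow> 'v) \<Rightarrow> rat \<Rightarrow> nat \<Rightarrow> 'v set" where
  "deg_ker d a k = {v \<in> Vg a. (d ^^ Suc k) v = 0}"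

text \<open>In the application of \<open>max_good\<close>, a decomposition writes \<open>deg_ker d a k\<close> as the sum of a good subspace and
a subspace without good vectors; the dimension of the former is then maximal, hence an invariant.\<close>

definition good_subspace :: "('v \<Rightarrow> 'v) \<Rightarrow> rat \<Rightarrow> nat \<Rightarrow> ('v \<Rightarrow> bool) \<Rightarrow> 'v set \<Rightarrow> bool" where
  "good_subspace d a k G P \<longleftrightarrow> subspace P \<and> P \<subseteq> deg_ker d a k \<and> (\<forall>v\<in>P. v \<noteq> 0 \<longrightarrow> G v)"

definition max_good :: "('v \<Rightarrow> 'v) \<Rightarrow> rat \<Rightarrow> nat \<Rightarrow> ('v \<Rightarrow> bool) \<Rightarrow> nat \<Rightarrow> bool" where
  "max_good d a k G n \<longleftrightarrow>
    (\<exists>P. good_subspace d a k G P \<and> dim P = n) \<and> (\<forall>P. good_subspace d a k G P \<longrightarrow> dim P \<le> n)"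

lemma conj_pow:
  assumes "graded_conj scale sig Vg g d d'"
  shows "(d' ^^ n) (g x) = g ((d ^^ n) x)"
  by (induction n) (use assms in \<open>auto simp: graded_conj_def\<close>)

text \<open>\<open>g\<close> induces a dimension-preserving bijection between the good subspaces of
  \<open>d\<close> and those of \<open>d'\<close>, so the two maxima agree.\<close>

lemma max_good_conj:
  assumes g: "graded_conj scale sig Vg g d d'"
    and G: "\<And>v. G' (g v) \<longleftrightarrow> G v"
    and n: "max_good d a k G n" and n': "max_good d' a k G' n'"
  shows "n = n'"
proof -
  have lin: "Vector_Spaces.linear scale scale g" and bij: "bij g" and im: "\<And>i. g ` Vg i = Vg i"
    using g unfolding graded_conj_def by auto
  interpret g: Vector_Spaces.linear scale scale g by (rule lin)
  interpret pair: finite_dimensional_vector_space_pair_1 scale Basis scale by unfold_locales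
  have inj: "g x = g y \<longleftrightarrow> x = y" for x y using bij by (auto simp: bij_def inj_eq)
  have Vg: "g x \<in> Vg i \<longleftrightarrow> x \<in> Vg i" for x i using im[of i] inj by (metis image_iff)
  have Kg: "g v \<in> deg_ker d' a k \<longleftrightarrow> v \<in> deg_ker d a k" for v
    unfolding deg_ker_def using conj_pow[OF g, of "Suc k" v] inj[of _ 0] Vg[of v a] by (simp add: g.zero)
  have dim: "dim (g ` P) = dim P" for P
    using bij by (intro pair.dim_image_eq lin) (auto simp: bij_def intro: inj_on_subset)
  have good: "good_subspace d' a k G' (g ` P) \<longleftrightarrow> good_subspace d a k G P" for P
  proof -
    have "subspace (g ` P) \<longleftrightarrow> subspace P"
    proof
      assume "subspace (g ` P)"
      then have "subspace (g -` (g ` P))" by (rule g.subspace_vimage)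
      then show "subspace P" using bij by (simp add: inj_vimage_image_eq bij_def)
    qed (rule g.subspace_image)
    then show ?thesis unfolding good_subspace_def using Kg G inj[of _ 0] by (auto simp: g.zero)
  qed
  have "n \<le> n'"
    using n n' good dim unfolding max_good_def by metis
  moreover obtain P' where P': "good_subspace d' a k G' P'" "dim P' = n'"
    using n' unfolding max_good_def by auto
  have "P' = g ` (g -` P')" using bij by (simp add: bij_def surj_image_vimage_eq)
  then have "n' \<le> n"
    using P' n good[of "g -` P'"] dim[of "g -` P'"] unfolding max_good_def by metis
  ultimately show ?thesis by simp
qed

text \<open>Transport of structure along \<open>g\<close>; it makes every fact of the locale
  available for \<open>d'\<close> as well.\<close>

lemma conj_sp:
  assumes "graded_conj scale sig Vg g d d'" "sp_deg_m1 scale sig Vg d"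
  shows "sp_deg_m1 scale sig Vg d'"
proof -
  have lin: "Vector_Spaces.linear scale scale g" and bij: "bij g" and im: "\<And>i. g ` Vg i = Vg i"
    and sg: "\<And>x y. sig (g x) (g y) = sig x y" and dg: "\<And>x. d' (g x) = g (d x)"
    using assms(1) unfolding graded_conj_def by auto
  have ld: "Vector_Spaces.linear scale scale d" and dV: "\<And>i. d ` Vg i \<subseteq> Vg (i - 1)"
    and sd: "\<And>x y. sig (d x) y + sig x (d y) = 0"
    using assms(2) unfolding sp_deg_m1_def by auto
  have gl: "g (x + y) = g x + g y" "g (c *s x) = c *s g x" for x y c
    using lin unfolding Vector_Spaces.linear_iff by auto
  have dl: "d (x + y) = d x + d y" "d (c *s x) = c *s d x" for x y c
    using ld unfolding Vector_Spaces.linear_iff by auto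
  have ex: "\<exists>x. y = g x" for y using bij by (metis bij_pointE)
  show ?thesis
    unfolding sp_deg_m1_def Vector_Spaces.linear_iff
  proof (intro conjI allI subsetI)
    fix x y c i
    obtain x' y' where xy: "x = g x'" "y = g y'" using ex by blast
    show "d' (x + y) = d' x + d' y" unfolding xy by (metis gl(1) dl(1) dg)
    show "d' (c *s x) = c *s d' x" unfolding xy by (metis gl(2) dl(2) dg)
    show "sig (d' x) y + sig x (d' y) = 0" unfolding xy dg sg by (rule sd)
    show "x \<in> Vg (i - 1)" if x: "x \<in> d' ` Vg i"
    proof -
      obtain u where u: "u \<in> Vg i" "x = d' u" using x by auto
      then have "u \<in> g ` Vg i" by (simp only: im)
      then obtain w where "w \<in> Vg i" "x = d' (g w)" using u by auto
      then have "x \<in> g ` Vg (i - 1)" using dV[of i] dg by auto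
      then show ?thesis by (simp only: im)
    qed
  qed (rule vector_space_axioms)+
qed

end

section \<open>Reading invariants off a block decomposition\<close>

context graded_sp_endo
begin

lemma subspace_deg_ker: "subspace (deg_ker d a k)"
  unfolding deg_ker_def by (auto intro!: subspaceI Vg_add Vg_scale simp: dpow_add dpow_scale
    simp del: funpow.simps)

lemma block_decomp_unique:
  assumes "block_decomp scale sig ok ws" "\<forall>j<length ws. x j \<in> fst (ws ! j)"
    "(\<Sum>j<length ws. x j) = 0" "j < length ws"
  shows "x j = 0"
proof -
  have "\<forall>x. (\<forall>j<length ws. x j \<in> fst (ws ! j)) \<and> (\<Sum>j<length ws. x j) = 0
      \<longrightarrow> (\<forall>j<length ws. x j = 0)"
    using assms(1) unfolding block_decomp_def by (elim conjE)
  then show ?thesis using assms by simp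
qed

text \<open>The blocks in \<open>J\<close> contribute \<open>P\<close>, the others \<open>N\<close>,
  and together these span \<open>deg_ker d a k\<close>. A good \<open>P'\<close> meets
  \<open>N\<close> only in 0, so \<open>dim P' + dim N\<close> is at most
  \<open>dim P + dim N\<close>.\<close>

lemma max_good_decomp:
  assumes dec: "block_decomp scale sig ok ws"
    and st: "\<And>j. j < length ws \<Longrightarrow> stable (fst (ws ! j))"
    and J: "J \<subseteq> {..<length ws}"
    and KJ: "\<And>j. j \<in> J \<Longrightarrow> fst (ws ! j) \<inter> Vg a \<subseteq> deg_ker d a k"
    and dimJ: "\<And>j. j \<in> J \<Longrightarrow> dim (fst (ws ! j) \<inter> Vg a) = c"
    and good: "\<And>x. (\<And>j. j \<in> J \<Longrightarrow> x j \<in> fst (ws ! j) \<inter> Vg a) \<Longrightarrow> sum x J \<noteq> 0 \<Longrightarrow> G (sum x J)"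
    and bad: "\<And>x. (\<And>j. j \<in> {..<length ws} - J \<Longrightarrow> x j \<in> fst (ws ! j) \<inter> deg_ker d a k) \<Longrightarrow>
      \<not> G (sum x ({..<length ws} - J))"
  shows "max_good d a k G (c * card J)"
proof -
  let ?n = "length ws"
  have fin: "finite J" using J finite_subset by blast
  have ex: "\<exists>x. (\<forall>j<?n. x j \<in> fst (ws ! j)) \<and> v = (\<Sum>j<?n. x j)" for v
    using dec unfolding block_decomp_def by (elim conjE) (erule allE)
  note un = block_decomp_unique[OF dec]
  have sW: "subspace (fst (ws ! j))" if "j < ?n" for j using st[OF that] unfolding stable_def by simp
  define P where "P = sumset J (\<lambda>j. fst (ws ! j) \<inter> Vg a)"
  define N where "N = sumset ({..<?n} - J) (\<lambda>j. fst (ws ! j) \<inter> deg_ker d a k)"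
  have sP: "subspace P" unfolding P_def
    using J sW by (intro subspace_sumset subspace_inter subspace_Vg) auto
  have sN: "subspace N" unfolding N_def
    using sW by (intro subspace_sumset subspace_inter subspace_deg_ker) auto
  have P_K: "P \<subseteq> deg_ker d a k"
    unfolding P_def sumset_def using KJ by (auto intro!: subspace_sum[OF subspace_deg_ker])
  have K_PN: "deg_ker d a k \<subseteq> {u + v | u v. u \<in> P \<and> v \<in> N}"
  proof
    fix v assume v: "v \<in> deg_ker d a k"
    obtain x where x: "\<forall>j<?n. x j \<in> fst (ws ! j)" "v = (\<Sum>j<?n. x j)" using ex by blast
    \<comment> \<open>These differences lie in the blocks and add up to
      \<open>v - pr a v = 0\<close>, so directness kills each one: block components of a homogeneous
      vector are homogeneous.\<close>
    have "x j - pr a (x j) = 0" if "j < ?n" for j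
    proof -
      have "(\<Sum>j<?n. x j - pr a (x j)) = v - pr a v"
        using x(2) by (simp add: sum_subtractf pr_sum)
      also have "\<dots> = 0" using v pr_hom[of v a a] unfolding deg_ker_def by simp
      finally have sum0: "(\<Sum>j<?n. x j - pr a (x j)) = 0" .
      have "\<forall>j<?n. x j - pr a (x j) \<in> fst (ws ! j)"
      proof (intro allI impI)
        fix j assume "j < ?n"
        then show "x j - pr a (x j) \<in> fst (ws ! j)"
          using st[of j] x(1) by (intro subspace_diff sW) (auto simp: stable_def)
      qed
      from un[OF this sum0 that] show ?thesis .
    qed
    then have xV: "x j \<in> Vg a" if "j < ?n" for j using that pr_in[of a "x j"] by simp
    have "(d ^^ Suc k) (x j) = 0" if "j < ?n" for j
    proof -
      have "(\<Sum>j<?n. (d ^^ Suc k) (x j)) = (d ^^ Suc k) v" unfolding x(2) by (rule dpow_sum[symmetric])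
      also have "\<dots> = 0" using v unfolding deg_ker_def by simp
      finally have sum0: "(\<Sum>j<?n. (d ^^ Suc k) (x j)) = 0" .
      have "\<forall>j<?n. (d ^^ Suc k) (x j) \<in> fst (ws ! j)"
        using stable_dpow[OF st] x(1) by blast
      from un[OF this sum0 that] show ?thesis .
    qed
    with xV have xK: "x j \<in> deg_ker d a k" if "j < ?n" for j using that unfolding deg_ker_def by simp
    have "v = sum x J + sum x ({..<?n} - J)"
      using x(2) J sum.subset_diff[OF J, of x] by (simp add: add.commute)
    moreover have "sum x J \<in> P" unfolding P_def sumset_def using x(1) xV J by (auto intro!: exI[of _ x])
    moreover have "sum x ({..<?n} - J) \<in> N"
      unfolding N_def sumset_def using x(1) xK by (auto intro!: exI[of _ x])
    ultimately show "v \<in> {u + v | u v. u \<in> P \<and> v \<in> N}" by blast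
  qed
  have N_K: "N \<subseteq> deg_ker d a k"
    unfolding N_def sumset_def by (auto intro!: subspace_sum[OF subspace_deg_ker])
  have N_bad: "\<not> G v" if "v \<in> N" for v
    using that bad unfolding N_def sumset_def by auto
  have gP: "good_subspace d a k G P"
    unfolding good_subspace_def
  proof (intro conjI sP P_K ballI impI)
    fix v assume "v \<in> P" "v \<noteq> 0"
    then show "G v" using good unfolding P_def sumset_def by blast
  qed
  have dP: "dim P = c * card J"
  proof -
    have "dim P = (\<Sum>j\<in>J. dim (fst (ws ! j) \<inter> Vg a))"
      unfolding P_def
    proof (rule dim_sumset[OF fin])
      show "subspace (fst (ws ! j) \<inter> Vg a)" if "j \<in> J" for j
        using J that sW by (intro subspace_inter subspace_Vg) auto
      fix x assume x: "\<forall>j\<in>J. x j \<in> fst (ws ! j) \<inter> Vg a" "sum x J = 0"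
      let ?x = "\<lambda>j. if j \<in> J then x j else 0"
      have "(\<Sum>j<?n. ?x j) = sum x J"
        using J by (simp add: sum.inter_restrict[symmetric] Int_absorb1)
      then have "(\<Sum>j<?n. ?x j) = 0" using x by simp
      moreover have "\<forall>j<?n. ?x j \<in> fst (ws ! j)" using x subspace_0[OF sW] by auto
      ultimately have "\<forall>j<?n. ?x j = 0" using un[of ?x] by blast
      then show "\<forall>j\<in>J. x j = 0" using J by (metis lessThan_iff subsetD)
    qed
    then show ?thesis using dimJ by simp
  qed
  have "dim P' \<le> c * card J" if P': "good_subspace d a k G P'" for P'
  proof -
    have sP': "subspace P'" "P' \<subseteq> deg_ker d a k" using P' unfolding good_subspace_def by auto
    have "P' \<inter> N \<subseteq> {0}" using P' N_bad unfolding good_subspace_def by auto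
    then have "dim (P' \<inter> N) = 0" by simp
    then have "dim P' + dim N = dim {u + v | u v. u \<in> P' \<and> v \<in> N}"
      using dim_sums_Int[OF sP'(1) sN] by linarith
    also have "\<dots> \<le> dim (deg_ker d a k)"
      using subspace_add[OF subspace_deg_ker] sP'(2) N_K by (intro dim_subset) blast
    also have "\<dots> \<le> dim {u + v | u v. u \<in> P \<and> v \<in> N}" by (rule dim_subset[OF K_PN])
    also have "\<dots> \<le> dim P + dim N" using dim_sums_Int[OF sP sN] by linarith
    finally show ?thesis using dP by simp
  qed
  then show ?thesis unfolding max_good_def using gP dP by blast
qed

text \<open>\<open>matched a k c W\<close>: the strings of \<open>W\<close> starting in degree \<open>a\<close> all have length \<open>k + 1\<close>, and there are \<open>c\<close>
of them; \<open>unmatched a k W\<close>: no string of \<open>W\<close> starts in degree \<open>a\<close> and has length \<open>k + 1\<close>.\<close>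

definition matched :: "rat \<Rightarrow> nat \<Rightarrow> nat \<Rightarrow> 'v set \<Rightarrow> bool" where
  "matched a k c W \<longleftrightarrow> (\<forall>v\<in>W. (d ^^ Suc k) v = 0) \<and> (\<forall>v\<in>W \<inter> Vg a. (d ^^ k) v = 0 \<longrightarrow> v = 0)
    \<and> dim (W \<inter> Vg a) = c"

definition unmatched :: "rat \<Rightarrow> nat \<Rightarrow> 'v set \<Rightarrow> bool" where
  "unmatched a k W \<longleftrightarrow> (\<forall>v\<in>W \<inter> Vg a. (d ^^ Suc k) v = 0 \<longrightarrow> (\<exists>z. (d ^^ k) v = (d ^^ Suc k) z))"

text \<open>An equation \<open>(d ^^ k) v = (d ^^ Suc k) z\<close> can be compared block by block.
  On a matched block its right side is 0, and \<open>d ^^ k\<close> is injective in degree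
  \<open>a\<close>, so the component of \<open>v\<close> vanishes. Unmatched blocks supply preimages
  that are simply added.\<close>

lemma max_good_matched:
  assumes dec: "block_decomp scale sig ok ws"
    and st: "\<And>j. j < length ws \<Longrightarrow> stable (fst (ws ! j))"
    and J: "J \<subseteq> {..<length ws}"
    and m: "\<And>j. j \<in> J \<Longrightarrow> matched a k c (fst (ws ! j))"
    and u: "\<And>j. j \<in> {..<length ws} - J \<Longrightarrow> unmatched a k (fst (ws ! j))"
  shows "max_good d a k (\<lambda>v. \<nexists>z. (d ^^ k) v = (d ^^ Suc k) z) (c * card J)"
proof (rule max_good_decomp[OF dec st J])
  let ?n = "length ws"
  show "fst (ws ! j) \<inter> Vg a \<subseteq> deg_ker d a k" if "j \<in> J" for j
    using m[OF that] unfolding matched_def deg_ker_def by auto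
  show "dim (fst (ws ! j) \<inter> Vg a) = c" if "j \<in> J" for j
    using m[OF that] unfolding matched_def by auto
  show "\<nexists>z. (d ^^ k) (sum x J) = (d ^^ Suc k) z"
    if x: "\<And>j. j \<in> J \<Longrightarrow> x j \<in> fst (ws ! j) \<inter> Vg a" and nz: "sum x J \<noteq> 0" for x
  proof
    assume "\<exists>z. (d ^^ k) (sum x J) = (d ^^ Suc k) z"
    then obtain z where z: "(d ^^ k) (sum x J) = (d ^^ Suc k) z" ..
    obtain y where y: "\<forall>j<?n. y j \<in> fst (ws ! j)" "z = (\<Sum>j<?n. y j)"
      using dec unfolding block_decomp_def by (elim conjE) blast
    note un = block_decomp_unique[OF dec]
    let ?x = "\<lambda>j. if j \<in> J then x j else 0"
    have sx: "(\<Sum>j<?n. ?x j) = sum x J"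
      using J by (simp add: sum.inter_restrict[symmetric] Int_absorb1)
    have "(\<Sum>j<?n. (d ^^ k) (?x j) - (d ^^ Suc k) (y j)) = 0"
      unfolding sum_subtractf dpow_sum[symmetric] sx y(2)[symmetric] z by simp
    moreover have "(d ^^ k) (?x j) - (d ^^ Suc k) (y j) \<in> fst (ws ! j)" if "j < ?n" for j
      using st[OF that] stable_dpow[OF st[OF that]] x[of j] y(1) that subspace_0
      by (intro subspace_diff) (auto simp: stable_def simp del: funpow.simps)
    ultimately have eq: "(d ^^ k) (?x j) - (d ^^ Suc k) (y j) = 0" if "j < ?n" for j
      using un[of "\<lambda>j. (d ^^ k) (?x j) - (d ^^ Suc k) (y j)" j] that by blast
    have "x j = 0" if j: "j \<in> J" for j
    proof -
      have jn: "j < ?n" using J j by auto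
      have "(d ^^ Suc k) (y j) = 0" using m[OF j] y(1) jn unfolding matched_def by blast
      then have "(d ^^ k) (x j) = 0" using eq[OF jn] j by (simp del: funpow.simps)
      then show ?thesis using m[OF j] x[OF j] unfolding matched_def by blast
    qed
    then show False using nz by simp
  qed
  show "\<not> (\<nexists>z. (d ^^ k) (sum x ({..<?n} - J)) = (d ^^ Suc k) z)"
    if x: "\<And>j. j \<in> {..<?n} - J \<Longrightarrow> x j \<in> fst (ws ! j) \<inter> deg_ker d a k" for x
  proof -
    have "\<exists>z. (d ^^ k) (x j) = (d ^^ Suc k) z" if "j \<in> {..<?n} - J" for j
      using u[OF that] x[OF that] unfolding unmatched_def deg_ker_def by blast
    then obtain z where z: "\<And>j. j \<in> {..<?n} - J \<Longrightarrow> (d ^^ k) (x j) = (d ^^ Suc k) (z j)" by metis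
    have "(d ^^ k) (sum x ({..<?n} - J)) = (d ^^ Suc k) (sum z ({..<?n} - J))"
      unfolding dpow_sum by (intro sum.cong z) auto
    then show ?thesis by blast
  qed
qed

end

section \<open>Doubled strings\<close>

context graded_sp_endo
begin

text \<open>Converse of \<open>D_block\<close>: the basis indexed by degree is rewritten as two
  strings starting at \<open>x = e s\<close> and \<open>y = f (l - s)\<close>.\<close>

lemma is_Dblock_strings:
  assumes "is_Dblock scale sig Vg d s l W"
  obtains x y where "x \<in> Vg s" "y \<in> Vg (of_nat l - s)" "(d ^^ Suc l) x = 0" "(d ^^ Suc l) y = 0"
    "W = span ((\<lambda>p. (d ^^ p) x) ` {..l} \<union> (\<lambda>p. (d ^^ p) y) ` {..l})"
    "\<And>p q. p \<le> l \<Longrightarrow> q \<le> l \<Longrightarrow> sig ((d ^^ p) x) ((d ^^ q) x) = 0"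
    "\<And>p q. p \<le> l \<Longrightarrow> q \<le> l \<Longrightarrow> sig ((d ^^ p) y) ((d ^^ q) y) = 0"
    "\<And>p q. p \<le> l \<Longrightarrow> q \<le> l \<Longrightarrow> sig ((d ^^ p) x) ((d ^^ q) y) = (if p + q = l then (- 1) ^ p else 0)"
proof -
  define Ei where "Ei = {s - of_nat k | k. k \<le> l}"
  define Fi where "Fi = {- s + of_nat k | k. k \<le> l}"
  obtain e f where eV: "\<forall>i\<in>Ei. e i \<in> Vg i" and fV: "\<forall>i\<in>Fi. f i \<in> Vg i"
    and sp: "span (e ` Ei \<union> f ` Fi) = W"
    and ee: "\<forall>i\<in>Ei. \<forall>j\<in>Ei. sig (e i) (e j) = 0"
    and ff: "\<forall>i\<in>Fi. \<forall>j\<in>Fi. sig (f i) (f j) = 0"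
    and ef: "\<forall>k\<le>l. \<forall>j\<in>Fi. sig (e (s - of_nat k)) (f j) = (if j = - (s - of_nat k) then (-1) ^ k else 0)"
    and de: "\<forall>i\<in>Ei. d (e i) = (if i = s - of_nat l then 0 else e (i - 1))"
    and df: "\<forall>i\<in>Fi. d (f i) = (if i = - s then 0 else f (i - 1))"
    using assms unfolding is_Dblock_def Let_def Ei_def[symmetric] Fi_def[symmetric]
    by (elim exE conjE) (rule that)
  define x where "x = e s"
  define y where "y = f (of_nat l - s)"
  have Ei: "s - of_nat p \<in> Ei" if "p \<le> l" for p using that unfolding Ei_def by auto
  have Fi: "of_nat l - s - of_nat p \<in> Fi" if "p \<le> l" for p
  proof -
    have "of_nat l - s - of_nat p = - s + of_nat (l - p)" using that by (simp add: of_nat_diff)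
    then show ?thesis unfolding Fi_def using diff_le_self by blast
  qed
  have e: "e (s - of_nat p) = (d ^^ p) x" if "p \<le> l" for p
    using that
  proof (induction p)
    case 0
    then show ?case by (simp add: x_def)
  next
    case (Suc p)
    have "s - of_nat p \<noteq> s - of_nat l" using Suc by simp
    then have "d (e (s - of_nat p)) = e (s - of_nat p - 1)" using bspec[OF de Ei[OF Suc_leD[OF Suc.prems]]] by (simp only: if_False)
    moreover have "s - of_nat (Suc p) = s - of_nat p - 1" by simp
    ultimately show ?case using Suc by (metis Suc_leD comp_apply funpow.simps(2))
  qed
  have f: "f (of_nat l - s - of_nat p) = (d ^^ p) y" if "p \<le> l" for p
    using that
  proof (induction p)
    case 0
    then show ?case by (simp add: y_def)
  next
    case (Suc p)
    have "of_nat l - s - of_nat p \<noteq> - s" using Suc by auto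
    then have "d (f (of_nat l - s - of_nat p)) = f (of_nat l - s - of_nat p - 1)" using bspec[OF df Fi[OF Suc_leD[OF Suc.prems]]] by (simp only: if_False)
    moreover have "of_nat l - s - of_nat (Suc p) = of_nat l - s - of_nat p - 1" by simp
    ultimately show ?case using Suc by (metis Suc_leD comp_apply funpow.simps(2))
  qed
  have eE: "e ` Ei = (\<lambda>p. (d ^^ p) x) ` {..l}"
    unfolding Ei_def using e by (force simp: image_iff)
  have fF: "f ` Fi = (\<lambda>p. (d ^^ p) y) ` {..l}"
  proof (intro equalityI subsetI)
    fix z assume "z \<in> f ` Fi"
    then obtain k where k: "k \<le> l" "z = f (- s + of_nat k)" unfolding Fi_def by blast
    have "- s + of_nat k = of_nat l - s - of_nat (l - k)" using k by (simp add: of_nat_diff)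
    then have "z = (d ^^ (l - k)) y" using f[of "l - k"] k by simp
    then show "z \<in> (\<lambda>p. (d ^^ p) y) ` {..l}" by auto
  next
    fix z assume "z \<in> (\<lambda>p. (d ^^ p) y) ` {..l}"
    then obtain p where "p \<le> l" "z = (d ^^ p) y" by auto
    then show "z \<in> f ` Fi" using Fi[of p] f[of p] by (metis image_eqI)
  qed
  show ?thesis
  proof (rule that[of x y])
    show "x \<in> Vg s" using eV Ei[of 0] by (simp add: x_def)
    show "y \<in> Vg (of_nat l - s)" using fV Fi[of 0] by (simp add: y_def)
    show "(d ^^ Suc l) x = 0" using bspec[OF de Ei[OF order_refl]] e[OF order_refl] by simp
    have "- s \<in> Fi" using Fi[OF order_refl] by simp
    then have "d (f (- s)) = 0" using bspec[OF df, of "- s"] by simp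
    moreover have "f (- s) = (d ^^ l) y" using f[OF order_refl] by simp
    ultimately have "d ((d ^^ l) y) = 0" by simp
    then show "(d ^^ Suc l) y = 0" by simp
    show "W = span ((\<lambda>p. (d ^^ p) x) ` {..l} \<union> (\<lambda>p. (d ^^ p) y) ` {..l})"
      using sp unfolding eE fF by simp
    show "sig ((d ^^ p) x) ((d ^^ q) x) = 0" if "p \<le> l" "q \<le> l" for p q
      using ee Ei[OF that(1)] Ei[OF that(2)] e[OF that(1)] e[OF that(2)] by metis
    show "sig ((d ^^ p) y) ((d ^^ q) y) = 0" if "p \<le> l" "q \<le> l" for p q
      using ff Fi[OF that(1)] Fi[OF that(2)] f[OF that(1)] f[OF that(2)] by metis
    show "sig ((d ^^ p) x) ((d ^^ q) y) = (if p + q = l then (- 1) ^ p else 0)" if "p \<le> l" "q \<le> l" for p q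
    proof -
      have "of_nat l - s - of_nat q = - (s - of_nat p) \<longleftrightarrow> (of_nat l :: rat) = of_nat (p + q)" by auto
      also have "\<dots> \<longleftrightarrow> p + q = l" by (simp only: of_nat_eq_iff) auto
      finally have iff: "of_nat l - s - of_nat q = - (s - of_nat p) \<longleftrightarrow> p + q = l" .
      have "sig (e (s - of_nat p)) (f (of_nat l - s - of_nat q)) = (if of_nat l - s - of_nat q = - (s - of_nat p) then (- 1) ^ p else 0)"
        using ef[rule_format, OF that(1) Fi[OF that(2)]] .
      then show ?thesis unfolding iff e[OF that(1)] f[OF that(2)] .
    qed
  qed
qed

text \<open>If \<open>d ^^ k\<close> does not already kill the term, then \<open>p + k = l\<close>.
  As the vector is not the top of a string of exactly this length, \<open>p > 0\<close>, and the
  preceding string vector is a preimage.\<close>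

lemma string_step:
  assumes nil: "(d ^^ Suc l) u = 0" and nz: "\<And>j. j \<le> l \<Longrightarrow> (d ^^ j) u \<noteq> 0" and "p \<le> l"
    and z: "\<alpha> *s (d ^^ (Suc k + p)) u = 0" and ne: "\<alpha> = 0 \<or> (p, k) \<noteq> (0, l)"
  shows "\<exists>z. (d ^^ k) (\<alpha> *s (d ^^ p) u) = (d ^^ Suc k) z"
proof (cases "\<alpha> = 0 \<or> p + k > l")
  case True
  then have "(d ^^ k) (\<alpha> *s (d ^^ p) u) = (d ^^ Suc k) 0"
    using dpow_eq_0[OF nil, of "k + p"] by (auto simp: dpow_scale dpow_dpow simp del: funpow.simps)
  then show ?thesis by blast
next
  case False
  then have "(d ^^ (Suc k + p)) u = 0" using z by simp
  then have "\<not> Suc k + p \<le> l" using nz by blast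
  then have "p \<noteq> 0" using False ne by auto
  then have "(d ^^ k) (\<alpha> *s (d ^^ p) u) = (d ^^ Suc k) (\<alpha> *s (d ^^ (p - 1)) u)"
    by (simp add: dpow_scale dpow_dpow del: funpow.simps)
  then show ?thesis by blast
qed

text \<open>Each string meets a given degree in at most one line, so a homogeneous vector of
  \<open>W\<close> is a combination of at most two string vectors, which can be treated
  separately.\<close>

lemma is_Dblock_matching:
  assumes W: "is_Dblock scale sig Vg d s l W"
  shows D_stable: "stable W"
    and D_matched: "of_nat l \<le> 2 * s \<Longrightarrow> matched s l (if of_nat l = 2 * s then 2 else 1) W"
    and D_unmatched: "(a, k) \<noteq> (s, l) \<Longrightarrow> (a, k) \<noteq> (of_nat l - s, l) \<Longrightarrow> unmatched a k W"
proof -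
  obtain x y where x: "x \<in> Vg s" and y: "y \<in> Vg (of_nat l - s)"
    and nil: "(d ^^ Suc l) x = 0" "(d ^^ Suc l) y = 0"
    and Wsp: "W = span ((\<lambda>p. (d ^^ p) x) ` {..l} \<union> (\<lambda>p. (d ^^ p) y) ` {..l})"
    and xx: "\<And>p q. p \<le> l \<Longrightarrow> q \<le> l \<Longrightarrow> sig ((d ^^ p) x) ((d ^^ q) x) = 0"
    and yy: "\<And>p q. p \<le> l \<Longrightarrow> q \<le> l \<Longrightarrow> sig ((d ^^ p) y) ((d ^^ q) y) = 0"
    and xy: "\<And>p q. p \<le> l \<Longrightarrow> q \<le> l \<Longrightarrow> sig ((d ^^ p) x) ((d ^^ q) y) = (if p + q = l then (- 1) ^ p else 0)"
    by (rule is_Dblock_strings[OF W]) (rule that)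
  define B where "B = (\<lambda>p. (d ^^ p) x) ` {..l} \<union> (\<lambda>p. (d ^^ p) y) ` {..l}"
  have hom: "B \<subseteq> (\<Union>i. Vg i)" unfolding B_def using dpow_Vg x y by blast
  have dB: "(d ^^ Suc l) b = 0" if b: "b \<in> B" for b
  proof -
    obtain p z where "b = (d ^^ p) z" "(d ^^ Suc l) z = 0" using b nil unfolding B_def by blast
    then show ?thesis by (metis add.commute dpow_0 dpow_dpow)
  qed
  have "d b \<in> span B" if b: "b \<in> B" for b
  proof -
    obtain p z where p: "p \<le> l" "b = (d ^^ p) z" "z = x \<or> z = y"
      using b unfolding B_def by blast
    have "(d ^^ Suc p) z \<in> span B"
    proof (cases "p = l")
      case True
      then have "(d ^^ Suc p) z = 0" using nil p(3) by blast
      then show ?thesis by (simp only: span_zero)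
    next
      case False
      then have "(d ^^ Suc p) z \<in> B" unfolding B_def using p by (metis Suc_leI UnI1 UnI2 atMost_iff image_eqI le_neq_implies_less)
      then show ?thesis by (rule span_base)
    qed
    then show ?thesis using p by simp
  qed
  then show "stable W" unfolding Wsp B_def[symmetric] by (rule stable_span[OF hom])
  \<comment> \<open>Pairing with \<open>(d ^^ (l - p)) y\<close> annihilates the
    \<open>y\<close>-string and detects \<open>(d ^^ p) x\<close>.\<close>
  have sep: "\<alpha> *s (d ^^ p) x = 0 \<and> \<beta> *s (d ^^ q) y = 0"
    if z: "\<alpha> *s (d ^^ p) x + \<beta> *s (d ^^ q) y = 0" for \<alpha> \<beta> p q
  proof (cases "p \<le> l")
    case True
    have "sig ((d ^^ q) y) ((d ^^ (l - p)) y) = 0"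
      using yy[of q "l - p"] dpow_eq_0[OF nil(2), of q] by (cases "q \<le> l") auto
    then have "0 = \<alpha> * (- 1) ^ p"
      using arg_cong[OF z, of "\<lambda>u. sig u ((d ^^ (l - p)) y)"] xy[OF True, of "l - p"] True
      by (simp add: sig_add sig_scale)
    then have "\<alpha> = 0" by simp
    then show ?thesis using z by simp
  next
    case False
    then have "(d ^^ p) x = 0" using dpow_eq_0[OF nil(1)] by simp
    then show ?thesis using z by simp
  qed
  have xnz: "(d ^^ p) x \<noteq> 0" if "p \<le> l" for p
    using xy[OF that, of "l - p"] that by auto
  have ynz: "(d ^^ p) y \<noteq> 0" if "p \<le> l" for p
    using xy[of "l - p" p] that by auto
  have comb: "\<exists>\<alpha> \<beta> p q. v = \<alpha> *s (d ^^ p) x + \<beta> *s (d ^^ q) y \<and> p \<le> l \<and> q \<le> l \<and>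
      (\<alpha> = 0 \<or> a = s - of_nat p) \<and> (\<beta> = 0 \<or> a = of_nat l - s - of_nat q)"
    if v: "v \<in> W \<inter> Vg a" for v a
  proof -
    \<comment> \<open>Position of degree \<open>a\<close> on the \<open>x\<close>-string. The
      default 0 is harmless: when the string misses degree \<open>a\<close>, the coefficient is set
      to 0 below.\<close>
    define p where "p = (if \<exists>p\<le>l. a = s - of_nat p then SOME p. p \<le> l \<and> a = s - of_nat p else 0)"
    define q where "q = (if \<exists>q\<le>l. a = of_nat l - s - of_nat q then SOME q. q \<le> l \<and> a = of_nat l - s - of_nat q else 0)"
    have p: "p \<le> l" "(\<exists>p\<le>l. a = s - of_nat p) \<Longrightarrow> a = s - of_nat p"
      using someI_ex[of "\<lambda>p. p \<le> l \<and> a = s - of_nat p"] unfolding p_def by auto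
    have q: "q \<le> l" "(\<exists>q\<le>l. a = of_nat l - s - of_nat q) \<Longrightarrow> a = of_nat l - s - of_nat q"
      using someI_ex[of "\<lambda>q. q \<le> l \<and> a = of_nat l - s - of_nat q"] unfolding q_def by auto
    define ex where "ex = (if a = s - of_nat p then (d ^^ p) x else 0)"
    define fy where "fy = (if a = of_nat l - s - of_nat q then (d ^^ q) y else 0)"
    have "B \<inter> Vg a \<subseteq> {ex, fy}"
    proof
      fix b assume "b \<in> B \<inter> Vg a"
      then consider i where "i \<le> l" "b = (d ^^ i) x" "b \<in> Vg a" | i where "i \<le> l" "b = (d ^^ i) y" "b \<in> Vg a"
        unfolding B_def by auto
      then show "b \<in> {ex, fy}"
      proof cases
        case 1
        then have ai: "a = s - of_nat i"
          using Vg_disjoint[OF dpow_Vg[OF x, of i]] xnz[of i] by metis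
        then have "a = s - of_nat p" using p(2) 1(1) by blast
        then show ?thesis using ai 1(2) unfolding ex_def by auto
      next
        case 2
        then have ai: "a = of_nat l - s - of_nat i"
          using Vg_disjoint[OF dpow_Vg[OF y, of i]] ynz[of i] by metis
        then have "a = of_nat l - s - of_nat q" using q(2) 2(1) by blast
        then show ?thesis using ai 2(2) unfolding fy_def by auto
      qed
    qed
    then have "span (B \<inter> Vg a) \<subseteq> span {ex, fy}" by (rule span_mono)
    then have "v \<in> span {ex, fy}"
      using v span_homogeneous_Int[OF hom, of a] unfolding Wsp B_def[symmetric] by auto
    then obtain \<alpha> where "v - \<alpha> *s ex \<in> span {fy}" by (auto simp: span_insert)
    then obtain \<beta> where "v - \<alpha> *s ex = \<beta> *s fy" by (auto simp: span_singleton)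
    then have "v = \<alpha> *s ex + \<beta> *s fy" by (simp add: algebra_simps)
    moreover define \<alpha>' where "\<alpha>' = (if a = s - of_nat p then \<alpha> else 0)"
    moreover define \<beta>' where "\<beta>' = (if a = of_nat l - s - of_nat q then \<beta> else 0)"
    ultimately have "v = \<alpha>' *s (d ^^ p) x + \<beta>' *s (d ^^ q) y"
      unfolding ex_def fy_def by auto
    moreover have "\<alpha>' = 0 \<or> a = s - of_nat p" "\<beta>' = 0 \<or> a = of_nat l - s - of_nat q"
      unfolding \<alpha>'_def \<beta>'_def by auto
    ultimately show ?thesis using p(1) q(1) by blast
  qed
  show "unmatched a k W" if ne: "(a, k) \<noteq> (s, l)" "(a, k) \<noteq> (of_nat l - s, l)"
    unfolding unmatched_def
  proof (intro ballI impI)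
    fix v assume v: "v \<in> W \<inter> Vg a" and dv: "(d ^^ Suc k) v = 0"
    obtain \<alpha> \<beta> p q where v_eq: "v = \<alpha> *s (d ^^ p) x + \<beta> *s (d ^^ q) y" and pq: "p \<le> l" "q \<le> l"
      and ap: "\<alpha> = 0 \<or> a = s - of_nat p" and bq: "\<beta> = 0 \<or> a = of_nat l - s - of_nat q"
      using comb[OF v] by (elim exE conjE) (rule that)
    have "\<alpha> *s (d ^^ (Suc k + p)) x + \<beta> *s (d ^^ (Suc k + q)) y = 0"
      using dv unfolding v_eq dpow_add dpow_scale dpow_dpow .
    then have z: "\<alpha> *s (d ^^ (Suc k + p)) x = 0" "\<beta> *s (d ^^ (Suc k + q)) y = 0"
      using sep by blast+
    have "\<alpha> = 0 \<or> (p, k) \<noteq> (0, l)" "\<beta> = 0 \<or> (q, k) \<noteq> (0, l)" using ap bq ne by auto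
    then obtain z1 z2 where "(d ^^ k) (\<alpha> *s (d ^^ p) x) = (d ^^ Suc k) z1"
      "(d ^^ k) (\<beta> *s (d ^^ q) y) = (d ^^ Suc k) z2"
      using string_step[OF nil(1) xnz pq(1) z(1)] string_step[OF nil(2) ynz pq(2) z(2)] by blast
    then have "(d ^^ k) v = (d ^^ Suc k) (z1 + z2)" unfolding v_eq dpow_add by simp
    then show "\<exists>z. (d ^^ k) v = (d ^^ Suc k) z" by blast
  qed
  show "matched s l (if of_nat l = 2 * s then 2 else 1) W" if ls: "of_nat l \<le> 2 * s"
    unfolding matched_def
  proof (intro conjI ballI impI)
    show "(d ^^ Suc l) v = 0" if "v \<in> W" for v
      using that unfolding Wsp B_def[symmetric]
    proof (induction rule: span_induct_alt)
      case (step c b v)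
      then show ?case using dB[of b] by (simp add: dpow_add dpow_scale del: funpow.simps)
    qed (simp del: funpow.simps)
  next
    fix v assume v: "v \<in> W \<inter> Vg s" and dv: "(d ^^ l) v = 0"
    obtain \<alpha> \<beta> p q where v_eq: "v = \<alpha> *s (d ^^ p) x + \<beta> *s (d ^^ q) y" and pq: "p \<le> l" "q \<le> l"
      and ap: "\<alpha> = 0 \<or> s = s - of_nat p" and bq: "\<beta> = 0 \<or> s = of_nat l - s - of_nat q"
      using comb[OF v] by (elim exE conjE) (rule that)
    have "\<alpha> *s (d ^^ (l + p)) x + \<beta> *s (d ^^ (l + q)) y = 0"
      using dv unfolding v_eq dpow_add dpow_scale dpow_dpow .
    then have z: "\<alpha> *s (d ^^ (l + p)) x = 0" "\<beta> *s (d ^^ (l + q)) y = 0"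
      using sep by blast+
    have "\<alpha> = 0" using ap z(1) xnz[of l] by auto
    \<comment> \<open>In degree \<open>s\<close> the position on the \<open>y\<close>-string is
      \<open>q = l - 2 s\<close>, which is at most 0; so \<open>q = 0\<close>, and
      \<open>(d ^^ l) y\<close> is nonzero.\<close>
    moreover have "\<beta> = 0"
    proof (rule ccontr)
      assume "\<beta> \<noteq> 0"
      then have "(of_nat q :: rat) = of_nat l - 2 * s" using bq by (simp add: algebra_simps)
      then have "(of_nat q :: rat) \<le> 0" using ls by linarith
      then have "q = 0" by simp
      then show False using z(2) ynz[of l] \<open>\<beta> \<noteq> 0\<close> by simp
    qed
    ultimately show "v = 0" using v_eq by simp
  next
    have x0: "x \<noteq> 0" and y0: "y \<noteq> 0" using xnz[of 0] ynz[of 0] by auto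
    have BV: "B \<inter> Vg s = (if of_nat l = 2 * s then {x, y} else {x})"
    proof (intro equalityI subsetI)
      fix b assume "b \<in> B \<inter> Vg s"
      then consider i where "i \<le> l" "b = (d ^^ i) x" "b \<in> Vg s" | i where "i \<le> l" "b = (d ^^ i) y" "b \<in> Vg s"
        unfolding B_def by auto
      then show "b \<in> (if of_nat l = 2 * s then {x, y} else {x})"
      proof cases
        case 1
        then have "s = s - of_nat i"
          using Vg_disjoint[OF dpow_Vg[OF x, of i]] xnz[of i] by metis
        then show ?thesis using 1 by auto
      next
        case 2
        then have "s = of_nat l - s - of_nat i"
          using Vg_disjoint[OF dpow_Vg[OF y, of i]] ynz[of i] by metis
        then have i: "(of_nat i :: rat) = of_nat l - 2 * s" by (simp add: algebra_simps)
        then have "(of_nat i :: rat) \<le> 0" using ls by linarith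
        then have "i = 0" by simp
        then show ?thesis using 2 i by auto
      qed
    next
      fix b assume b: "b \<in> (if of_nat l = 2 * s then {x, y} else {x})"
      have "x \<in> B" "y \<in> B" unfolding B_def by (auto intro: image_eqI[of _ _ 0])
      moreover have "y \<in> Vg s" if "of_nat l = 2 * s"
      proof -
        have "of_nat l - s = s" using that by simp
        then show ?thesis using y by simp
      qed
      ultimately show "b \<in> B \<inter> Vg s" using b x by (auto split: if_splits)
    qed
    have "x \<notin> span {y}"
    proof
      assume "x \<in> span {y}"
      then obtain c where "x = c *s y" by (auto simp: span_singleton)
      then have "1 *s (d ^^ 0) x + (- c) *s (d ^^ 0) y = 0" by simp
      then show False using sep x0 by (metis scale_one funpow_0)
    qed
    then have "dim {x, y} = 2" using y0 by (simp add: dim_insert)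
    then show "dim (W \<inter> Vg s) = (if of_nat l = 2 * s then 2 else 1)"
      unfolding Wsp B_def[symmetric] span_homogeneous_Int[OF hom] BV using x0 by simp
  qed
qed

end

section \<open>Self-dual strings and multiplicities\<close>

text \<open>Starting degree and number of steps of the string by which a block is counted. For
  \<open>DB\<close> it is the higher of the two strings; a \<open>\<tau>\<close>-string runs from
  \<open>m\<close> to \<open>- m\<close> in \<open>2 m\<close> steps.\<close>

fun top_data :: "blk \<Rightarrow> rat \<times> nat" where
  "top_data (DB s l) = (s, l)"
| "top_data (TB m) = (m, nat \<lfloor>2 * m\<rfloor>)"
| "top_data (NTB m) = (m, nat \<lfloor>2 * m\<rfloor>)"

text \<open>For \<open>l = 2 s\<close> both strings of a \<open>\<delta>\<close>-block start in degree \<open>s\<close>, so it counts twice.\<close>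

fun block_mult :: "blk \<Rightarrow> nat" where
  "block_mult (DB s l) = (if of_nat l = 2 * s then 2 else 1)"
| "block_mult _ = 1"

text \<open>Common consequence of the admissibility conditions of all three classifications. The
  strict bound for half-odd \<open>s\<close> separates the top data of \<open>DB\<close> from those
  of \<open>\<tau>\<close>-blocks.\<close>

definition valid_blk :: "blk \<Rightarrow> bool" where
  "valid_blk b \<longleftrightarrow> (case b of
     DB s l \<Rightarrow> of_nat l \<le> 2 * s \<and> (s \<in> halfodd \<longrightarrow> of_nat l < 2 * s)
   | TB m \<Rightarrow> m \<in> halfodd \<and> m > 0
   | NTB m \<Rightarrow> m \<in> halfodd \<and> m > 0)"

lemma halfodd_top:
  assumes "m \<in> halfodd" "m > 0"
  shows "of_nat (nat \<lfloor>2 * m\<rfloor>) = 2 * m"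
proof -
  obtain i where i: "m = of_int i + 1/2" using assms unfolding halfodd_iff by auto
  then have "2 * m = of_int (2 * i + 1)" by simp
  moreover from this have "2 * i + 1 \<ge> 0" using assms(2) i by linarith
  ultimately show ?thesis by (simp only: floor_of_int of_nat_nat)
qed

lemma top_data_DB_neq:
  assumes "valid_blk (DB s l)" "m \<in> halfodd" "m > 0"
  shows "(s, l) \<noteq> (m, nat \<lfloor>2 * m\<rfloor>)"
proof
  assume "(s, l) = (m, nat \<lfloor>2 * m\<rfloor>)"
  then have "s = m" "of_nat l = 2 * m" using halfodd_top[OF assms(2,3)] by auto
  then show False using assms(1,2) by (simp add: valid_blk_def)
qed

text \<open>String lengths cannot see the sign of \<open>\<tau>\<close>; this is the only ambiguity,
  and it is resolved by \<open>mid_form\<close>.\<close>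

lemma top_data_eqD:
  assumes "valid_blk b" "valid_blk b'" "top_data b = top_data b'"
  shows "b = b' \<or> (\<exists>m. b = TB m \<and> b' = NTB m) \<or> (\<exists>m. b = NTB m \<and> b' = TB m)"
proof -
  have T: "m \<in> halfodd" "m > 0" if "valid_blk (TB m) \<or> valid_blk (NTB m)" for m
    using that by (auto simp: valid_blk_def)
  show ?thesis
    using assms top_data_DB_neq T by (cases b; cases b') fastforce+
qed

context graded_sp_endo
begin

text \<open>No generator is given here, so the argument uses that \<open>d\<close> maps each of the
  lines \<open>W \<inter> Vg (m - p)\<close> onto the next one.\<close>

lemma is_Tblock_matching:
  assumes T: "is_Tblock scale sig Vg d m W" and m: "m \<in> halfodd" "of_nat l = 2 * m"
  shows "stable W" and "matched m l 1 W" and "(a, k) \<noteq> (m, l) \<Longrightarrow> unmatched a k W"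
proof -
  have sW: "subspace W" and spW: "span (\<Union>i. W \<inter> Vg i) = W"
    and dim1: "\<And>p. p \<le> l \<Longrightarrow> dim (W \<inter> Vg (m - of_nat p)) = 1"
    and out: "\<And>i. \<not> (\<exists>p\<le>l. i = m - of_nat p) \<Longrightarrow> W \<inter> Vg i = {0}"
    and onto0: "\<And>i. i \<in> halfodd \<Longrightarrow> - m < i \<Longrightarrow> i \<le> m \<Longrightarrow> d ` (W \<inter> Vg i) = W \<inter> Vg (i - 1)"
    and bot: "d ` (W \<inter> Vg (- m)) = {0}"
    using T unfolding is_Tblock_def halfodd_range[OF m] by auto
  have onto: "d ` (W \<inter> Vg (m - of_nat p)) = W \<inter> Vg (m - of_nat (Suc p))" if "p < l" for p
  proof -
    have "m - of_nat p \<in> halfodd" using halfodd_range[OF m, of "m - of_nat p"] that by auto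
    moreover have "(of_nat p :: rat) < of_nat l" using that by (simp only: of_nat_less_iff)
    then have "- m < m - of_nat p" using m(2) by linarith
    ultimately have "d ` (W \<inter> Vg (m - of_nat p)) = W \<inter> Vg (m - of_nat p - 1)"
      by (intro onto0) auto
    moreover have "m - of_nat p - 1 = m - of_nat (Suc p)" by simp
    ultimately show ?thesis by metis
  qed
  have ml: "m - of_nat l = - m" using m(2) by simp
  have dE: "d b \<in> W" if b: "b \<in> W \<inter> Vg i" for b i
  proof (cases "\<exists>p\<le>l. i = m - of_nat p")
    case True
    then obtain p where p: "p \<le> l" "i = m - of_nat p" by auto
    show ?thesis
    proof (cases "p = l")
      case True
      then have "d b \<in> d ` (W \<inter> Vg (- m))" using b p ml by auto
      then show ?thesis using bot subspace_0[OF sW] by auto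
    next
      case False
      then have "d b \<in> W \<inter> Vg (m - of_nat (Suc p))" using onto[of p] b p by auto
      then show ?thesis by simp
    qed
  next
    case False
    then have "b = 0" using out b by blast
    then show ?thesis using subspace_0[OF sW] by simp
  qed
  have "stable (span (\<Union>i. W \<inter> Vg i))"
    by (rule stable_span) (use dE spW in auto)
  then show st: "stable W" by (simp only: spW)
  \<comment> \<open>A map from a line onto a nonzero line cannot kill a nonzero vector.\<close>
  have step: "d v \<noteq> 0" if v: "v \<in> W \<inter> Vg (m - of_nat p)" "v \<noteq> 0" and p: "p < l" for v p
  proof
    assume dv: "d v = 0"
    let ?E = "W \<inter> Vg (m - of_nat p)"
    have "span {v} = ?E"
    proof (rule subspace_dim_equal)
      show "subspace ?E" using sW subspace_Vg by (rule subspace_inter)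
      show "span {v} \<subseteq> ?E" using v \<open>subspace ?E\<close> by (intro span_minimal) auto
      show "dim (span {v}) \<ge> dim ?E" using v(2) dim1[of p] p by simp
    qed simp
    then have "d ` ?E = d ` span {v}" by simp
    also have "\<dots> \<subseteq> {0}" using dv by (auto simp: span_singleton d_scale)
    finally have "W \<inter> Vg (m - of_nat (Suc p)) \<subseteq> {0}" using onto[OF p] by simp
    then have "dim (W \<inter> Vg (m - of_nat (Suc p))) = 0" by simp
    moreover have "dim (W \<inter> Vg (m - of_nat (Suc p))) = 1" using p by (intro dim1) simp
    ultimately show False by linarith
  qed
  have pow_in: "(d ^^ n) v \<in> W \<inter> Vg (m - of_nat (p + n))" if "v \<in> W \<inter> Vg (m - of_nat p)" for v p n
    using stable_dpow[OF st] dpow_Vg[of v "m - of_nat p" n] that by (simp add: algebra_simps)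
  have nz: "(d ^^ n) v \<noteq> 0" if "v \<in> W \<inter> Vg (m - of_nat p)" "v \<noteq> 0" "p + n \<le> l" for v p n
    using that(3)
  proof (induction n)
    case 0
    then show ?case using that by simp
  next
    case (Suc n)
    then show ?case using step[OF pow_in[OF that(1), of n]] by simp
  qed
  have zero: "(d ^^ n) v = 0" if "v \<in> W \<inter> Vg (m - of_nat p)" "p + n > l" for v p n
  proof -
    have "\<not> (\<exists>q\<le>l. m - of_nat (p + n) = m - of_nat q)"
      using that(2) by (metis add_diff_cancel_left' diff_diff_eq2 leD of_nat_eq_iff add.commute diff_add_cancel)
    then show ?thesis using out pow_in[OF that(1), of n] by blast
  qed
  show "matched m l 1 W"
    unfolding matched_def
  proof (intro conjI ballI impI)
    fix v assume "v \<in> W"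
    then have "v \<in> span (\<Union>i. W \<inter> Vg i)" by (simp only: spW)
    then show "(d ^^ Suc l) v = 0"
    proof (induction rule: span_induct_alt)
      case (step c b v)
      then obtain i where b: "b \<in> W \<inter> Vg i" by auto
      have "(d ^^ Suc l) b = 0"
      proof (cases "\<exists>p\<le>l. i = m - of_nat p")
        case True
        then show ?thesis using zero[of b _ "Suc l"] b by fastforce
      next
        case False
        then have "b = 0" using out b by blast
        then show ?thesis by (simp del: funpow.simps)
      qed
      then show ?case using step by (simp add: dpow_add dpow_scale del: funpow.simps)
    qed (simp del: funpow.simps)
  next
    fix v assume "v \<in> W \<inter> Vg m" "(d ^^ l) v = 0"
    then show "v = 0" using nz[of v 0 l] by auto
  next
    show "dim (W \<inter> Vg m) = 1" using dim1[of 0] by simp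
  qed
  show "unmatched a k W" if ne: "(a, k) \<noteq> (m, l)"
    unfolding unmatched_def
  proof (intro ballI impI)
    fix v assume v: "v \<in> W \<inter> Vg a" and dv: "(d ^^ Suc k) v = 0"
    show "\<exists>z. (d ^^ k) v = (d ^^ Suc k) z"
    proof (cases "(d ^^ k) v = 0")
      case True
      then have "(d ^^ k) v = (d ^^ Suc k) 0" by (simp del: funpow.simps)
      then show ?thesis by blast
    next
      case False
      then have "v \<noteq> 0" by auto
      then obtain p where p: "p \<le> l" "a = m - of_nat p" using out v by blast
      have vE: "v \<in> W \<inter> Vg (m - of_nat p)" using v p by simp
      have "\<not> p + Suc k \<le> l" using nz[OF vE \<open>v \<noteq> 0\<close>] dv by blast
      moreover have "\<not> p + k > l" using zero[OF vE] False by blast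
      \<comment> \<open>\<open>(d ^^ k) v\<close> is nonzero but the next power kills
        \<open>v\<close>, so \<open>(d ^^ k) v\<close> sits at the bottom of the string. Then
        \<open>p = 0\<close> would give the excluded pair \<open>(m, l)\<close>.\<close>
      ultimately have "p + k = l" by simp
      then have "p \<noteq> 0" using ne p by auto
      then obtain p' where p': "p = Suc p'" by (cases p) auto
      then have "v \<in> d ` (W \<inter> Vg (m - of_nat p'))" using onto[of p'] vE p by simp
      then obtain z where "v = d z" by auto
      then have "(d ^^ k) v = (d ^^ Suc k) z" by (simp add: funpow_swap1)
      then show ?thesis by blast
    qed
  qed
qed

text \<open>Forgets the sign: \<open>NTB\<close> is tested with \<open>d\<close> in place of
  \<open>- d\<close>, which is legitimate by \<open>is_Tblock_neg\<close>. Thus one counting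
  argument covers all index sets and fields.\<close>

definition gen_block :: "'v set \<Rightarrow> blk \<Rightarrow> bool" where
  "gen_block W b \<longleftrightarrow> (case b of
     DB s l \<Rightarrow> of_nat l \<le> 2 * s \<and> (s \<in> halfodd \<longrightarrow> of_nat l < 2 * s) \<and> is_Dblock scale sig Vg d s l W
   | TB m \<Rightarrow> m \<in> halfodd \<and> m > 0 \<and> is_Tblock scale sig Vg d m W
   | NTB m \<Rightarrow> m \<in> halfodd \<and> m > 0 \<and> is_Tblock scale sig Vg d m W)"

lemma gen_block_valid: "gen_block W b \<Longrightarrow> valid_blk b"
  unfolding gen_block_def valid_blk_def by (cases b) auto

lemma okZ_gen_block: "okZ scale sig Vg d W b \<Longrightarrow> gen_block W b"
proof (cases b)
  case (DB s l)
  assume ok: "okZ scale sig Vg d W b"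
  then obtain i where i: "s = of_int i" and l: "int l \<le> 2 * \<lfloor>s\<rfloor>"
    unfolding okZ_def DB by (auto elim: Ints_cases)
  have "of_int (int l) \<le> (of_int (2 * i) :: rat)" using l i by (simp only: floor_of_int of_int_le_iff)
  then have "of_nat l \<le> 2 * s" using i by simp
  moreover have "s \<notin> halfodd"
  proof
    assume "s \<in> halfodd"
    then obtain j where "of_int i = (of_int j :: rat) + 1/2" using i unfolding halfodd_iff by auto
    then have "of_int (2 * i) = (of_int (2 * j + 1) :: rat)" by simp
    then have "2 * i = 2 * j + 1" by (simp only: of_int_eq_iff)
    then show False by presburger
  qed
  ultimately show ?thesis using ok unfolding okZ_def gen_block_def DB by simp
qed (auto simp: okZ_def)

lemma okC_gen_block: "okC scale sig Vg d W b \<Longrightarrow> gen_block W b"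
  unfolding okC_def gen_block_def by (cases b) (auto simp: halfodd_bound_iff)

lemma gen_block_matching:
  assumes W: "gen_block W b" and W0: "valid_blk b0"
  shows gen_block_stable: "stable W"
    and gen_block_matched: "top_data b = top_data b0 \<Longrightarrow>
      matched (fst (top_data b0)) (snd (top_data b0)) (block_mult b0) W"
    and gen_block_unmatched: "top_data b \<noteq> top_data b0 \<Longrightarrow>
      unmatched (fst (top_data b0)) (snd (top_data b0)) W"
proof -
  obtain a k where ak: "top_data b0 = (a, k)" by fastforce
  have kT: "of_nat k = 2 * a" if "b0 = TB m \<or> b0 = NTB m" for m
    using that ak W0 halfodd_top unfolding valid_blk_def by auto
  have k2a: "of_nat k \<le> 2 * a" and kh: "b0 = DB s l \<Longrightarrow> s \<in> halfodd \<Longrightarrow> of_nat k < 2 * a" for s l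
    using kT ak W0 by (cases b0; auto simp: valid_blk_def)+
  have "stable W \<and> (top_data b = (a, k) \<longrightarrow> matched a k (block_mult b0) W) \<and>
    (top_data b \<noteq> (a, k) \<longrightarrow> unmatched a k W)"
  proof (cases b)
    case (DB s l)
    then have D: "is_Dblock scale sig Vg d s l W" and l: "of_nat l \<le> 2 * s"
      and lh: "s \<in> halfodd \<longrightarrow> of_nat l < 2 * s"
      using W unfolding gen_block_def by auto
    have "matched a k (block_mult b0) W" if eq: "top_data b = (a, k)"
    proof -
      have sl: "s = a" "l = k" using eq DB by auto
      \<comment> \<open>Were \<open>b0\<close> a \<open>\<tau>\<close>-type, \<open>a\<close> would
        be half-odd with \<open>k = 2 a\<close>, against the strict bound for
        \<open>DB\<close>.\<close>
      have "b0 = DB a k"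
      proof (cases b0)
        case (DB s' l')
        then show ?thesis using ak by simp
      next
        case (TB m)
        then have "a \<in> halfodd" using ak W0 by (simp add: valid_blk_def)
        then show ?thesis using lh sl kT[of m] TB by simp
      next
        case (NTB m)
        then have "a \<in> halfodd" using ak W0 by (simp add: valid_blk_def)
        then show ?thesis using lh sl kT[of m] NTB by simp
      qed
      then show ?thesis using D_matched[OF D l] sl by simp
    qed
    moreover have "unmatched a k W" if ne: "top_data b \<noteq> (a, k)"
    proof (rule D_unmatched[OF D])
      show "(a, k) \<noteq> (s, l)" using ne DB by auto
      \<comment> \<open>The lower string is never mistaken for a counted one:
        \<open>k \<le> 2 a\<close> and \<open>l \<le> 2 s\<close> would force
        \<open>l = 2 s\<close>, where both strings start in degree \<open>s\<close>.\<close>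
      show "(a, k) \<noteq> (of_nat l - s, l)"
      proof
        assume "(a, k) = (of_nat l - s, l)"
        then have "a = of_nat l - s" "k = l" by auto
        moreover from this have "of_nat l = 2 * s" using k2a l by linarith
        ultimately show False using ne DB by simp
      qed
    qed
    ultimately show ?thesis using D_stable[OF D] by simp
  next
    case (TB m)
    then have T: "is_Tblock scale sig Vg d m W" and m: "m \<in> halfodd" "m > 0"
      using W unfolding gen_block_def by auto
    note mt = is_Tblock_matching[OF T m(1) halfodd_top[OF m]]
    have "block_mult b0 = 1" if "top_data b = (a, k)"
      using that kh halfodd_top[OF m] m TB ak by (cases b0) auto
    then show ?thesis using mt(1,2) mt(3)[of a k] TB by auto
  next
    case (NTB m)
    then have T: "is_Tblock scale sig Vg d m W" and m: "m \<in> halfodd" "m > 0"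
      using W unfolding gen_block_def by auto
    note mt = is_Tblock_matching[OF T m(1) halfodd_top[OF m]]
    have "block_mult b0 = 1" if "top_data b = (a, k)"
      using that kh halfodd_top[OF m] m NTB ak by (cases b0) auto
    then show ?thesis using mt(1,2) mt(3)[of a k] NTB by auto
  qed
  then show "stable W" "top_data b = top_data b0 \<Longrightarrow>
      matched (fst (top_data b0)) (snd (top_data b0)) (block_mult b0) W"
    "top_data b \<noteq> top_data b0 \<Longrightarrow> unmatched (fst (top_data b0)) (snd (top_data b0)) W"
    by (simp_all add: ak)
qed

lemma count_blocks: "count (mset (map snd ws)) b = card {j. j < length ws \<and> snd (ws ! j) = b}"
proof -
  have "count (mset (map snd ws)) b = length (filter (\<lambda>c. c = b) (map snd ws))"
    by (induction ws) auto
  also have "\<dots> = card {j. j < length ws \<and> snd (ws ! j) = b}"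
    unfolding length_filter_conv_card by (intro arg_cong[of _ _ card]) auto
  finally show ?thesis .
qed

text \<open>By \<open>inj\<close> no other admissible type shares the top data of \<open>b0\<close>,
  so every block of another type is unmatched.\<close>

lemma count_max_good:
  assumes dec: "block_decomp scale sig ok ws" and gen: "\<And>W b. ok W b \<Longrightarrow> gen_block W b"
    and W0: "valid_blk b0"
    and inj: "\<And>W b. ok W b \<Longrightarrow> top_data b = top_data b0 \<Longrightarrow> b = b0"
  shows "max_good d (fst (top_data b0)) (snd (top_data b0))
    (\<lambda>v. \<nexists>z. (d ^^ snd (top_data b0)) v = (d ^^ Suc (snd (top_data b0))) z)
    (block_mult b0 * count (mset (map snd ws)) b0)"
  unfolding count_blocks
proof (rule max_good_matched[OF dec])
  have ok: "ok (fst (ws ! j)) (snd (ws ! j))" if "j < length ws" for j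
    using dec nth_mem[OF that] unfolding block_decomp_def by (auto simp: split_beta)
  show "stable (fst (ws ! j))" if "j < length ws" for j
    using gen_block_stable[OF gen[OF ok[OF that]] W0] .
  show "matched (fst (top_data b0)) (snd (top_data b0)) (block_mult b0) (fst (ws ! j))"
    if "j \<in> {j. j < length ws \<and> snd (ws ! j) = b0}" for j
    using gen_block_matched[OF gen[OF ok] W0] that by auto
  show "unmatched (fst (top_data b0)) (snd (top_data b0)) (fst (ws ! j))"
    if "j \<in> {..<length ws} - {j. j < length ws \<and> snd (ws ! j) = b0}" for j
    using gen_block_unmatched[OF gen[OF ok] W0] inj[OF ok] that by auto
qed auto

end

context graded_symplectic
begin

lemma not_range_conj:
  assumes "graded_conj scale sig Vg g d d'"
  shows "(\<nexists>z. (d' ^^ k) (g v) = (d' ^^ Suc k) z) \<longleftrightarrow> (\<nexists>z. (d ^^ k) v = (d ^^ Suc k) z)"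
proof -
  have bij: "bij g" using assms unfolding graded_conj_def by simp
  have "(\<exists>z. (d' ^^ k) (g v) = (d' ^^ Suc k) z) \<longleftrightarrow> (\<exists>z. (d' ^^ k) (g v) = (d' ^^ Suc k) (g z))"
    using bij by (metis bij_pointE)
  also have "\<dots> \<longleftrightarrow> (\<exists>z. (d ^^ k) v = (d ^^ Suc k) z)"
    unfolding conj_pow[OF assms] using bij by (auto simp: bij_def inj_eq simp del: funpow.simps)
  finally show ?thesis by simp
qed

end

section \<open>Uniqueness and the classification\<close>

lemma mset_blocks_eqI:
  assumes "\<And>b. b \<in> snd ` set ws \<union> snd ` set ws' \<Longrightarrow> count (mset (map snd ws)) b = count (mset (map snd ws')) b"
  shows "mset (map snd ws) = mset (map snd ws')"
proof (rule multiset_eqI)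
  fix b
  show "count (mset (map snd ws)) b = count (mset (map snd ws')) b"
  proof (cases "b \<in> snd ` set ws \<union> snd ` set ws'")
    case False
    then have "b \<notin># mset (map snd ws)" "b \<notin># mset (map snd ws')" by auto
    then show ?thesis by (simp only: not_in_iff)
  qed (rule assms)
qed

lemma block_decomp_ok:
  "block_decomp scale sig ok ws \<Longrightarrow> b \<in> snd ` set ws \<Longrightarrow> \<exists>W. ok W b"
  "block_decomp scale sig ok ws \<Longrightarrow> j < length ws \<Longrightarrow> ok (fst (ws ! j)) (snd (ws ! j))"
proof -
  assume "block_decomp scale sig ok ws"
  then have "\<forall>(W, b)\<in>set ws. ok W b" unfolding block_decomp_def by (elim conjE)
  then have ok: "ok (fst w) (snd w)" if "w \<in> set ws" for w using that by (auto simp: split_beta)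
  show "b \<in> snd ` set ws \<Longrightarrow> \<exists>W. ok W b" using ok by auto
  show "j < length ws \<Longrightarrow> ok (fst (ws ! j)) (snd (ws ! j))" using ok by simp
qed

context graded_sp_endo
begin

text \<open>The invariant dimension is the number of summands times \<open>block_mult b\<close>, a
  nonzero factor depending on the type only, which cancels.\<close>

lemma count_conj:
  assumes g: "graded_conj scale sig Vg g d d'"
    and dec: "block_decomp scale sig ok ws" and dec': "block_decomp scale sig ok' ws'"
    and gen: "\<And>W b. ok W b \<Longrightarrow> gen_block W b"
    and gen': "\<And>W b. ok' W b \<Longrightarrow> graded_sp_endo.gen_block scale sig Vg d' W b"
    and b: "valid_blk b"
    and inj: "\<And>W b'. ok W b' \<or> ok' W b' \<Longrightarrow> top_data b' = top_data b \<Longrightarrow> b' = b"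
  shows "count (mset (map snd ws)) b = count (mset (map snd ws')) b"
proof -
  interpret E': graded_sp_endo scale Basis sig I Vg d'
    by unfold_locales (rule conj_sp[OF g sp])
  have "block_mult b * count (mset (map snd ws)) b = block_mult b * count (mset (map snd ws')) b"
    by (rule max_good_conj[OF g not_range_conj[OF g] count_max_good[OF dec gen b]
        E'.count_max_good[OF dec' gen' b]]) (use inj in auto)
  moreover have "block_mult b \<noteq> 0" by (cases b) auto
  ultimately show ?thesis by simp
qed

lemma unique_Z:
  assumes g: "graded_conj scale sig Vg g d d'"
    and dec: "block_decomp scale sig (okZ scale sig Vg d) ws"
    and dec': "block_decomp scale sig (okZ scale sig Vg d') ws'"
  shows "mset (map snd ws) = mset (map snd ws')"
proof (rule mset_blocks_eqI)
  interpret E': graded_sp_endo scale Basis sig I Vg d'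
    by unfold_locales (rule conj_sp[OF g sp])
  fix b assume "b \<in> snd ` set ws \<union> snd ` set ws'"
  then obtain W where W: "okZ scale sig Vg d W b \<or> okZ scale sig Vg d' W b"
    using block_decomp_ok(1)[OF dec] block_decomp_ok(1)[OF dec'] by blast
  have valid: "valid_blk b'" if "okZ scale sig Vg d W b' \<or> okZ scale sig Vg d' W b'" for W b'
    using that okZ_gen_block E'.okZ_gen_block gen_block_valid E'.gen_block_valid by blast
  show "count (mset (map snd ws)) b = count (mset (map snd ws')) b"
  proof (rule count_conj[OF g dec dec' okZ_gen_block E'.okZ_gen_block valid[OF W]])
    fix W' b' assume W': "okZ scale sig Vg d W' b' \<or> okZ scale sig Vg d' W' b'" "top_data b' = top_data b"
    \<comment> \<open>The remaining ambiguity would exchange \<open>TB\<close> and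
      \<open>NTB\<close>, and \<open>okZ\<close> admits neither.\<close>
    show "b' = b"
      using top_data_eqD[OF valid[OF W'(1)] valid[OF W] W'(2)] W W' by (auto simp: okZ_def)
  qed
qed

lemma unique_C:
  assumes g: "graded_conj scale sig Vg g d d'"
    and dec: "block_decomp scale sig (okC scale sig Vg d) ws"
    and dec': "block_decomp scale sig (okC scale sig Vg d') ws'"
  shows "mset (map snd ws) = mset (map snd ws')"
proof (rule mset_blocks_eqI)
  interpret E': graded_sp_endo scale Basis sig I Vg d'
    by unfold_locales (rule conj_sp[OF g sp])
  fix b assume "b \<in> snd ` set ws \<union> snd ` set ws'"
  then obtain W where W: "okC scale sig Vg d W b \<or> okC scale sig Vg d' W b"
    using block_decomp_ok(1)[OF dec] block_decomp_ok(1)[OF dec'] by blast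
  have valid: "valid_blk b'" if "okC scale sig Vg d W b' \<or> okC scale sig Vg d' W b'" for W b'
    using that okC_gen_block E'.okC_gen_block gen_block_valid E'.gen_block_valid by blast
  show "count (mset (map snd ws)) b = count (mset (map snd ws')) b"
  proof (rule count_conj[OF g dec dec' okC_gen_block E'.okC_gen_block valid[OF W]])
    fix W' b' assume W': "okC scale sig Vg d W' b' \<or> okC scale sig Vg d' W' b'" "top_data b' = top_data b"
    show "b' = b"
      using top_data_eqD[OF valid[OF W'(1)] valid[OF W] W'(2)] W W' by (auto simp: okC_def)
  qed
qed

end

section \<open>Signs over the reals: a law of inertia\<close>

context graded_sp_endo_real
begin

lemma okR_gen_block: "okR scale sig Vg d W b \<Longrightarrow> gen_block W b"
proof (cases b)
  case (NTB m)
  assume ok: "okR scale sig Vg d W b"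
  then have "is_Tblock scale sig Vg (\<lambda>x. - d x) m W" by (simp add: okR_def NTB)
  moreover from this have "subspace W" unfolding is_Tblock_def by simp
  ultimately show ?thesis using ok is_Tblock_neg unfolding okR_def gen_block_def NTB by simp
qed (auto simp: okR_def gen_block_def halfodd_bound_iff)

text \<open>For \<open>v\<close> of degree \<open>p + 1/2\<close> the vector
  \<open>(d ^^ p) v\<close> has degree 1/2, where the sign condition lives. Up to the factor
  \<open>(- 1) ^ (p + 1)\<close> this is \<open>sig v ((d ^^ (2 * p + 1)) v)\<close>.\<close>

definition mid_form :: "nat \<Rightarrow> 'v \<Rightarrow> real" where
  "mid_form p v = sig (d ((d ^^ p) v)) ((d ^^ p) v)"

text \<open>Cross terms vanish because the blocks are \<open>d\<close>-stable and mutually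
  orthogonal.\<close>

lemma mid_form_orthogonal_sum:
  assumes dec: "block_decomp scale sig ok ws"
    and st: "\<And>j. j < length ws \<Longrightarrow> stable (fst (ws ! j))"
    and J: "J \<subseteq> {..<length ws}" and x: "\<And>j. j \<in> J \<Longrightarrow> x j \<in> fst (ws ! j)"
  shows "mid_form p (sum x J) = (\<Sum>j\<in>J. mid_form p (x j))"
proof -
  have fin: "finite J" using J finite_subset by blast
  have orth: "\<forall>j < length ws. \<forall>j' < length ws. j \<noteq> j' \<longrightarrow>
        (\<forall>x \<in> fst (ws ! j). \<forall>y \<in> fst (ws ! j'). sig x y = 0)"
    using dec unfolding block_decomp_def by (elim conjE)
  have "mid_form p (sum x J) = (\<Sum>j\<in>J. \<Sum>i\<in>J. sig (d ((d ^^ p) (x j))) ((d ^^ p) (x i)))"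
    unfolding mid_form_def dpow_sum d_sum sig_sum by (rule sum.swap)
  also have "\<dots> = (\<Sum>j\<in>J. \<Sum>i\<in>J. if i = j then mid_form p (x j) else 0)"
  proof (intro sum.cong refl)
    fix j i assume ji: "j \<in> J" "i \<in> J"
    then have n: "j < length ws" "i < length ws" using J by auto
    have "d ((d ^^ p) (x j)) \<in> fst (ws ! j)" "(d ^^ p) (x i) \<in> fst (ws ! i)"
      using stable_dpow[OF st[OF n(1)] x[OF ji(1)], of "Suc p"] stable_dpow[OF st[OF n(2)] x[OF ji(2)]]
      by auto
    then show "sig (d ((d ^^ p) (x j))) ((d ^^ p) (x i)) = (if i = j then mid_form p (x j) else 0)"
      using orth n by (auto simp: mid_form_def)
  qed
  also have "\<dots> = (\<Sum>j\<in>J. mid_form p (x j))" using fin by simp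
  finally show ?thesis .
qed

text \<open>With \<open>k = 2 p + 1\<close> and \<open>(d ^^ k) v = (d ^^ Suc k) z\<close>, moving
  \<open>d ^^ Suc k\<close> over to \<open>v\<close> gives 0.\<close>

lemma mid_form_unmatched:
  assumes "unmatched m (2 * p + 1) W" "v \<in> W \<inter> deg_ker d m (2 * p + 1)"
  shows "mid_form p v = 0"
proof -
  let ?k = "2 * p + 1"
  have v: "v \<in> W \<inter> Vg m" "(d ^^ Suc ?k) v = 0" using assms(2) unfolding deg_ker_def by auto
  then obtain z where z: "(d ^^ ?k) v = (d ^^ Suc ?k) z" using assms(1) unfolding unmatched_def by blast
  have "sig v ((d ^^ Suc ?k) z) = 0"
    using sig_dpow[of "Suc ?k" v z] v(2) by (simp del: funpow.simps)
  then have "sig v ((d ^^ ?k) v) = 0" by (simp only: z)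
  moreover have "mid_form p v = (- 1) ^ Suc p * sig v ((d ^^ (Suc p + p)) v)"
    using sig_dpow_dpow[of "Suc p" v p v] unfolding mid_form_def by simp
  moreover have "Suc p + p = ?k" by simp
  ultimately show ?thesis by (simp only: mult_zero_right)
qed

text \<open>Sylvester's argument: the form times \<open>\<epsilon>\<close> is positive definite on
  the part from \<open>J\<close> and at most 0 on the rest of the kernel. It is applied with
  \<open>\<epsilon>\<close> equal to 1 and to -1.\<close>

lemma max_good_sign:
  assumes dec: "block_decomp scale sig ok ws"
    and st: "\<And>j. j < length ws \<Longrightarrow> stable (fst (ws ! j))"
    and J: "J \<subseteq> {..<length ws}"
    and m: "\<And>j. j \<in> J \<Longrightarrow> matched m (2 * p + 1) 1 (fst (ws ! j))"
    and pos: "\<And>j v. j \<in> J \<Longrightarrow> v \<in> fst (ws ! j) \<inter> Vg m \<Longrightarrow> v \<noteq> 0 \<Longrightarrow> \<epsilon> * mid_form p v > 0"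
    and neg: "\<And>j. j \<in> {..<length ws} - J \<Longrightarrow> unmatched m (2 * p + 1) (fst (ws ! j)) \<or>
      (\<forall>v\<in>fst (ws ! j) \<inter> Vg m. \<epsilon> * mid_form p v \<le> 0)"
  shows "max_good d m (2 * p + 1) (\<lambda>v. \<epsilon> * mid_form p v > 0) (1 * card J)"
proof (rule max_good_decomp[OF dec st J])
  let ?n = "length ws"
  show "fst (ws ! j) \<inter> Vg m \<subseteq> deg_ker d m (2 * p + 1)" if "j \<in> J" for j
    using m[OF that] unfolding matched_def deg_ker_def by auto
  show "dim (fst (ws ! j) \<inter> Vg m) = 1" if "j \<in> J" for j
    using m[OF that] unfolding matched_def by auto
  show "\<epsilon> * mid_form p (sum x J) > 0"
    if x: "\<And>j. j \<in> J \<Longrightarrow> x j \<in> fst (ws ! j) \<inter> Vg m" and nz: "sum x J \<noteq> 0" for x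
  proof -
    obtain j where j: "j \<in> J" "x j \<noteq> 0" using nz by (metis sum.neutral)
    have "\<epsilon> * mid_form p (x i) \<ge> 0" if "i \<in> J" for i
      using pos[OF that x[OF that]] by (cases "x i = 0") (auto simp: mid_form_def)
    moreover have "\<epsilon> * mid_form p (x j) > 0" using pos[OF j(1) x[OF j(1)] j(2)] .
    moreover have "finite J" using J finite_subset by blast
    ultimately have "(\<Sum>j\<in>J. \<epsilon> * mid_form p (x j)) > 0"
      using j(1) by (intro sum_pos2[of J j]) auto
    then show ?thesis
      using mid_form_orthogonal_sum[OF dec st J, of x] x by (simp add: sum_distrib_left)
  qed
  show "\<not> \<epsilon> * mid_form p (sum x ({..<?n} - J)) > 0"
    if x: "\<And>j. j \<in> {..<?n} - J \<Longrightarrow> x j \<in> fst (ws ! j) \<inter> deg_ker d m (2 * p + 1)" for x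
  proof -
    have "\<epsilon> * mid_form p (x j) \<le> 0" if "j \<in> {..<?n} - J" for j
      using neg[OF that] mid_form_unmatched[OF _ x[OF that]] x[OF that] unfolding deg_ker_def by auto
    then have "(\<Sum>j\<in>{..<?n} - J. \<epsilon> * mid_form p (x j)) \<le> 0" by (rule sum_nonpos)
    then show ?thesis
      using mid_form_orthogonal_sum[OF dec st, of "{..<?n} - J" x] x by (simp add: sum_distrib_left)
  qed
qed

text \<open>The condition in degree 1/2 is pulled back to the top degree along
  \<open>d ^^ p\<close>, which is injective there because \<open>d ^^ (2 * p + 1)\<close>
  is.\<close>

lemma okR_sign:
  assumes ok: "okR scale sig Vg d W b" and b: "b = TB (of_nat p + 1/2) \<or> b = NTB (of_nat p + 1/2)"
    and v: "v \<in> W \<inter> Vg (of_nat p + 1/2)" "v \<noteq> 0"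
  shows "(if b = TB (of_nat p + 1/2) then 1 else - 1) * mid_form p v > 0"
proof -
  let ?m = "of_nat p + 1/2 :: rat"
  have m: "?m \<in> halfodd" "?m > 0"
    using b ok by (auto simp: okR_def)
  have T: "is_Tblock scale sig Vg d ?m W"
    using okR_gen_block[OF ok] b unfolding gen_block_def by auto
  have eq: "of_nat (2 * p + 1) = 2 * ?m" by simp
  note mt = is_Tblock_matching[OF T m(1) eq]
  have "(d ^^ (2 * p + 1)) v \<noteq> 0" using mt(2) v unfolding matched_def by blast
  then have nz: "(d ^^ p) v \<noteq> 0" using dpow_eq_0[of p v "2 * p + 1"] by auto
  have "(d ^^ p) v \<in> Vg (?m - of_nat p)" using v dpow_Vg by blast
  then have "(d ^^ p) v \<in> W \<inter> Vg (1/2)" using stable_dpow[OF mt(1)] v by simp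
  then show ?thesis using b ok nz unfolding okR_def mid_form_def by (auto simp: sig_minus)
qed

lemma count_max_good_sign:
  assumes dec: "block_decomp scale sig (okR scale sig Vg d) ws"
    and b: "b = TB (of_nat p + 1/2) \<or> b = NTB (of_nat p + 1/2)" and valid: "valid_blk b"
  shows "max_good d (of_nat p + 1/2) (2 * p + 1)
    (\<lambda>v. (if b = TB (of_nat p + 1/2) then 1 else - 1) * mid_form p v > 0)
    (1 * count (mset (map snd ws)) b)"
  unfolding count_blocks
proof (rule max_good_sign[OF dec])
  let ?m = "of_nat p + 1/2 :: rat"
  note ok = block_decomp_ok(2)[OF dec]
  have "\<lfloor>2 * ?m\<rfloor> = int (2 * p + 1)"
  proof -
    have "2 * ?m = of_int (int (2 * p + 1))" by simp
    then show ?thesis by (simp only: floor_of_int)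
  qed
  then have "nat \<lfloor>2 * ?m\<rfloor> = 2 * p + 1" by simp
  then have top: "top_data b = (?m, 2 * p + 1)" and mult: "block_mult b = 1" using b by auto
  note mt = gen_block_matching[OF okR_gen_block[OF ok] valid, unfolded top mult fst_conv snd_conv]
  show "stable (fst (ws ! j))" if "j < length ws" for j
    using mt(1)[OF that] .
  show "matched ?m (2 * p + 1) 1 (fst (ws ! j))"
    if "j \<in> {j. j < length ws \<and> snd (ws ! j) = b}" for j
    using mt(2)[of j] that top by auto
  show "(if b = TB ?m then 1 else - 1) * mid_form p v > 0"
    if "j \<in> {j. j < length ws \<and> snd (ws ! j) = b}" "v \<in> fst (ws ! j) \<inter> Vg ?m" "v \<noteq> 0" for j v
    using okR_sign[OF _ b that(2,3)] ok[of j] that(1) by auto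
  show "unmatched ?m (2 * p + 1) (fst (ws ! j)) \<or>
      (\<forall>v\<in>fst (ws ! j) \<inter> Vg ?m. (if b = TB ?m then 1 else - 1) * mid_form p v \<le> 0)"
    if j: "j \<in> {..<length ws} - {j. j < length ws \<and> snd (ws ! j) = b}" for j
  proof (cases "top_data (snd (ws ! j)) = (?m, 2 * p + 1)")
    case False
    then show ?thesis using mt(3)[of j] j by auto
  next
    case True
    have jn: "j < length ws" and ne: "snd (ws ! j) \<noteq> b" using j by auto
    have "valid_blk (snd (ws ! j))" using gen_block_valid[OF okR_gen_block[OF ok[OF jn]]] .
    \<comment> \<open>Equal top data but a different type leaves only the opposite sign, so this
      block contributes nonpositive values.\<close>
    then have opp: "(b = TB ?m \<and> snd (ws ! j) = NTB ?m) \<or> (b = NTB ?m \<and> snd (ws ! j) = TB ?m)"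
      using top_data_eqD[OF _ valid, of "snd (ws ! j)"] True top ne b by auto
    have "(if b = TB ?m then 1 else - 1) * mid_form p v \<le> 0" if v: "v \<in> fst (ws ! j) \<inter> Vg ?m" for v
    proof (cases "v = 0")
      case False
      then show ?thesis using okR_sign[OF ok[OF jn] _ v False] opp by auto
    qed (simp add: mid_form_def)
    then show ?thesis by blast
  qed
qed auto

lemma unique_R:
  assumes g: "graded_conj scale sig Vg g d d'"
    and dec: "block_decomp scale sig (okR scale sig Vg d) ws"
    and dec': "block_decomp scale sig (okR scale sig Vg d') ws'"
  shows "mset (map snd ws) = mset (map snd ws')"
proof (rule mset_blocks_eqI)
  interpret E': graded_sp_endo_real scale Basis sig I Vg d'
    by unfold_locales (rule conj_sp[OF g sp])
  fix b assume "b \<in> snd ` set ws \<union> snd ` set ws'"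
  then obtain W where W: "okR scale sig Vg d W b \<or> okR scale sig Vg d' W b"
    using block_decomp_ok(1)[OF dec] block_decomp_ok(1)[OF dec'] by blast
  have valid: "valid_blk b'" if "okR scale sig Vg d W b' \<or> okR scale sig Vg d' W b'" for W b'
    using that okR_gen_block E'.okR_gen_block gen_block_valid E'.gen_block_valid by blast
  show "count (mset (map snd ws)) b = count (mset (map snd ws')) b"
  \<comment> \<open>A \<open>DB\<close> is determined by its top data and is counted as before; only
    the two \<open>\<tau>\<close>-types need the signed invariant.\<close>
  proof (cases "\<exists>s l. b = DB s l")
    case True
    show ?thesis
    proof (rule count_conj[OF g dec dec' okR_gen_block E'.okR_gen_block valid[OF W]])
      fix W' b' assume W': "okR scale sig Vg d W' b' \<or> okR scale sig Vg d' W' b'" "top_data b' = top_data b"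
      show "b' = b"
        using top_data_eqD[OF valid[OF W'(1)] valid[OF W] W'(2)] True by auto
    qed
  next
    case False
    then obtain m where bm: "b = TB m \<or> b = NTB m" by (cases b) auto
    then have m: "m \<in> halfodd" "m > 0" using valid[OF W] by (auto simp: valid_blk_def)
    then obtain i where i: "m = of_int i + 1/2" unfolding halfodd_iff by auto
    have "i \<ge> 0" using m(2) i by linarith
    then have mp: "m = of_nat (nat i) + 1/2" using i by (simp add: of_nat_nat)
    have lin: "sig (g x) (g y) = sig x y" "d' (g x) = g (d x)" for x y
      using g unfolding graded_conj_def by auto
    have q: "E'.mid_form p (g v) = mid_form p v" for p v
      unfolding mid_form_def E'.mid_form_def conj_pow[OF g] lin ..
    have "1 * count (mset (map snd ws)) b = 1 * count (mset (map snd ws')) b"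
      using count_max_good_sign[OF dec, of b "nat i"] E'.count_max_good_sign[OF dec', of b "nat i"]
        bm mp valid[OF W]
      by (intro max_good_conj[OF g _ _ _]) (auto simp: q)
    then show ?thesis by simp
  qed
qed

end

section \<open>From the definitions to the locales\<close>

lemma gsymp_graded_symplectic:
  fixes scale :: "'k::field_char_0 \<Rightarrow> 'v::ab_group_add \<Rightarrow> 'v"
  assumes gs: "gsymp scale sig I Vg"
  shows "\<exists>Basis. graded_symplectic scale Basis sig I Vg"
proof -
  have "vector_space scale" using gs unfolding gsymp_def by simp
  then interpret vector_space scale .
  obtain B where B: "finite B" "span B = UNIV" using gs unfolding gsymp_def by auto
  \<comment> \<open>The locale requires an independent basis, whereas \<open>gsymp\<close> supplies
    a finite spanning set.\<close>
  obtain C where C: "C \<subseteq> B" "independent C" "B \<subseteq> span C"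
    using maximal_independent_subset[of B] by auto
  have "span C = UNIV" using B(2) C(3) span_minimal[OF C(3)] by auto
  then have "graded_symplectic scale C sig I Vg"
    using B(1) C gs finite_subset by unfold_locales auto
  then show ?thesis ..
qed

lemma sp_endo_graded_sp_endo:
  fixes scale :: "'k::field_char_0 \<Rightarrow> 'v::ab_group_add \<Rightarrow> 'v"
  assumes "gsymp scale sig I Vg" "sp_deg_m1 scale sig Vg d"
  shows "\<exists>Basis. graded_sp_endo scale Basis sig I Vg d"
  using gsymp_graded_symplectic[OF assms(1)] assms(2)
  by (auto simp: graded_sp_endo_def graded_sp_endo_axioms_def)

text \<open>Stated over an arbitrary field of characteristic 0, so that the real and the complex
  integer-graded cases are both instances.\<close>

lemma classification_Z:
  fixes scale :: "'k::field_char_0 \<Rightarrow> 'v::ab_group_add \<Rightarrow> 'v"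
  assumes "gsymp scale sig \<int> Vg" "sp_deg_m1 scale sig Vg d"
  shows "\<exists>ws. block_decomp scale sig (okZ scale sig Vg d) ws"
    and "graded_conj scale sig Vg g d d' \<Longrightarrow> block_decomp scale sig (okZ scale sig Vg d) ws \<Longrightarrow>
      block_decomp scale sig (okZ scale sig Vg d') ws' \<Longrightarrow> mset (map snd ws) = mset (map snd ws')"
proof -
  obtain Basis where "graded_sp_endo scale Basis sig \<int> Vg d"
    using sp_endo_graded_sp_endo[OF assms] by auto
  then interpret graded_sp_endo scale Basis sig \<int> Vg d .
  show "\<exists>ws. block_decomp scale sig (okZ scale sig Vg d) ws" by (rule ex_decomp_Z) simp
  show "graded_conj scale sig Vg g d d' \<Longrightarrow> block_decomp scale sig (okZ scale sig Vg d) ws \<Longrightarrow>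
      block_decomp scale sig (okZ scale sig Vg d') ws' \<Longrightarrow> mset (map snd ws) = mset (map snd ws')"
    by (rule unique_Z)
qed

lemma classification_C:
  fixes scale :: "'k::field_char_0 \<Rightarrow> 'v::ab_group_add \<Rightarrow> 'v"
  assumes "gsymp scale sig halfodd Vg" "sp_deg_m1 scale sig Vg d"
  shows "\<exists>ws. block_decomp scale sig (okC scale sig Vg d) ws"
    and "graded_conj scale sig Vg g d d' \<Longrightarrow> block_decomp scale sig (okC scale sig Vg d) ws \<Longrightarrow>
      block_decomp scale sig (okC scale sig Vg d') ws' \<Longrightarrow> mset (map snd ws) = mset (map snd ws')"
proof -
  obtain Basis where "graded_sp_endo scale Basis sig halfodd Vg d"
    using sp_endo_graded_sp_endo[OF assms] by auto
  then interpret graded_sp_endo scale Basis sig halfodd Vg d .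
  show "\<exists>ws. block_decomp scale sig (okC scale sig Vg d) ws" by (rule ex_decomp_C) simp
  show "graded_conj scale sig Vg g d d' \<Longrightarrow> block_decomp scale sig (okC scale sig Vg d) ws \<Longrightarrow>
      block_decomp scale sig (okC scale sig Vg d') ws' \<Longrightarrow> mset (map snd ws) = mset (map snd ws')"
    by (rule unique_C)
qed

lemma classification_R:
  fixes scale :: "real \<Rightarrow> 'v::ab_group_add \<Rightarrow> 'v"
  assumes "gsymp scale sig halfodd Vg" "sp_deg_m1 scale sig Vg d"
  shows "\<exists>ws. block_decomp scale sig (okR scale sig Vg d) ws"
    and "graded_conj scale sig Vg g d d' \<Longrightarrow> block_decomp scale sig (okR scale sig Vg d) ws \<Longrightarrow>
      block_decomp scale sig (okR scale sig Vg d') ws' \<Longrightarrow> mset (map snd ws) = mset (map snd ws')"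
proof -
  obtain Basis where "graded_sp_endo scale Basis sig halfodd Vg d"
    using sp_endo_graded_sp_endo[OF assms] by auto
  then interpret graded_sp_endo_real scale Basis sig halfodd Vg d
    by (rule graded_sp_endo_real.intro)
  show "\<exists>ws. block_decomp scale sig (okR scale sig Vg d) ws" by (rule ex_decomp_R) simp
  show "graded_conj scale sig Vg g d d' \<Longrightarrow> block_decomp scale sig (okR scale sig Vg d) ws \<Longrightarrow>
      block_decomp scale sig (okR scale sig Vg d') ws' \<Longrightarrow> mset (map snd ws) = mset (map snd ws')"
    by (rule unique_R)
qed

theorem theorem7p2:
  shows
  \<comment> \<open>(1), K = R\<close>
  "(\<forall>(scale :: real \<Rightarrow> 'a::ab_group_add \<Rightarrow> 'a) sig Vg.
      gsymp scale sig \<int> Vg \<longrightarrow>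
      (\<forall>d. sp_deg_m1 scale sig Vg d \<longrightarrow>
          (\<exists>ws. block_decomp scale sig (okZ scale sig Vg d) ws)) \<and>
      (\<forall>d d' g ws ws'. sp_deg_m1 scale sig Vg d \<and> graded_conj scale sig Vg g d d' \<and>
          block_decomp scale sig (okZ scale sig Vg d) ws \<and>
          block_decomp scale sig (okZ scale sig Vg d') ws'
          \<longrightarrow> mset (map snd ws) = mset (map snd ws')))
   \<and>
  \<comment> \<open>(1), K = C\<close>
   (\<forall>(scale :: complex \<Rightarrow> 'b::ab_group_add \<Rightarrow> 'b) sig Vg.
      gsymp scale sig \<int> Vg \<longrightarrow>
      (\<forall>d. sp_deg_m1 scale sig Vg d \<longrightarrow>
          (\<exists>ws. block_decomp scale sig (okZ scale sig Vg d) ws)) \<and>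
      (\<forall>d d' g ws ws'. sp_deg_m1 scale sig Vg d \<and> graded_conj scale sig Vg g d d' \<and>
          block_decomp scale sig (okZ scale sig Vg d) ws \<and>
          block_decomp scale sig (okZ scale sig Vg d') ws'
          \<longrightarrow> mset (map snd ws) = mset (map snd ws')))
   \<and>
  \<comment> \<open>(2), K = C, half-odd grading\<close>
   (\<forall>(scale :: complex \<Rightarrow> 'c::ab_group_add \<Rightarrow> 'c) sig Vg.
      gsymp scale sig halfodd Vg \<longrightarrow>
      (\<forall>d. sp_deg_m1 scale sig Vg d \<longrightarrow>
          (\<exists>ws. block_decomp scale sig (okC scale sig Vg d) ws)) \<and>
      (\<forall>d d' g ws ws'. sp_deg_m1 scale sig Vg d \<and> graded_conj scale sig Vg g d d' \<and>
          block_decomp scale sig (okC scale sig Vg d) ws \<and>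
          block_decomp scale sig (okC scale sig Vg d') ws'
          \<longrightarrow> mset (map snd ws) = mset (map snd ws')))
   \<and>
  \<comment> \<open>(3), K = R, half-odd grading\<close>
   (\<forall>(scale :: real \<Rightarrow> 'd::ab_group_add \<Rightarrow> 'd) sig Vg.
      gsymp scale sig halfodd Vg \<longrightarrow>
      (\<forall>d. sp_deg_m1 scale sig Vg d \<longrightarrow>
          (\<exists>ws. block_decomp scale sig (okR scale sig Vg d) ws)) \<and>
      (\<forall>d d' g ws ws'. sp_deg_m1 scale sig Vg d \<and> graded_conj scale sig Vg g d d' \<and>
          block_decomp scale sig (okR scale sig Vg d) ws \<and>
          block_decomp scale sig (okR scale sig Vg d') ws'
          \<longrightarrow> mset (map snd ws) = mset (map snd ws')))"
  by (intro conjI allI impI; (elim conjE)?;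
      rule classification_Z classification_C classification_R; assumption)

end
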